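(* Let $n\ge1$, let $E_n = \wedge\{\alpha_1,\dots,\alpha_n,\theta_1,\dots,\theta_n\}$ be the exterior algebra over $\mathbb{C}$ bigraded by $(E_n)_{i,j} = \wedge^i\{\alpha_1,\dots,\alpha_n\}\otimes\wedge^j\{\theta_1,\dots,\theta_n\}$, with $\mathfrak{S}_n$ acting by $w\cdot\alpha_i=\alpha_{w(i)}$, $w\cdot\theta_i=\theta_{w(i)}$. Let $\tau(f)=\sum_{i=1}^n\alpha_i\cdot(\partial/\partial\theta_i)f$ (an $\mathfrak{S}_n$-equivariant map of bidegree $(1,-1)$), and let $H^1(M,\mathcal{O}) = E_n/\tau(E_n)$ with bigraded components $H^1(M,\mathcal{O})_{i,j} = (E_n)_{i,j}/\tau((E_n)_{i-1,j+1})$, which are $\mathfrak{S}_n$-modules. Then $H^1(M,\mathcal{O})_{i,j}=0$ unless $i\le j$, and when $i\le j$, $$[H^1(M,\mathcal{O})_{i,j}] = [\wedge^i\mathbb{C}^n]\cdot[\wedge^j\mathbb{C}^n]-[\wedge^{i-1}\mathbb{C}^n]\cdot[\wedge^{j+1}\mathbb{C}^n] = [(E_n)_{i,j}]-[(E_n)_{i-1,j+1}]$$ in the Grothendieck ring of $\mathfrak{S}_n$, where $\mathfrak{S}_n$ acts on $\mathbb{C}^n$ by coordinate permutation.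
   Context: The fermionic derivative $\partial/\partial\theta_i$ on $E_n$ is the linear extension of $\partial/\partial\theta_i(\omega_{j_1}\cdots\omega_{j_r}) = (-1)^{s-1}\omega_{j_1}\cdots\widehat{\omega_{j_s}}\cdots\omega_{j_r}$ if $\omega_{j_s}=\theta_i$, and $0$ if $\theta_i$ does not occur, for monomials in distinct generators of $E_n$. Equivalently $H^1(M,\mathcal{O})=E_n/\{T(f)-f\}$ where $T$ is the algebra map $\theta_i\mapsto\theta_i+\alpha_i$, $\alpha_i\mapsto\alpha_i$. The Grothendieck ring of $\mathfrak{S}_n$ is the free $\mathbb{Z}$-module on classes of irreducible modules with $[V]=[U]+[W]$ for short exact sequences and $[V][W]=[V\otimes W]$. Exterior powers $\wedge^k\mathbb{C}^n$ with $k<0$ or $k>n$ are zero. *)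

theory Defs
  imports
    Complex_Main
    "HOL-Library.FSet"
    "HOL-Library.Poly_Mapping"
    "HOL-Algebra.QuotRing"
    "HOL-Algebra.Module"
    "HOL-Algebra.Sym_Groups"
    "HOL-Algebra.Free_Abelian_Groups"
    "HOL-Algebra.Algebraic_Closure_Type"
begin

section \<open>The exterior algebra on an ordered set of generators\<close>

text \<open>
  An element is a finitely supported family of coefficients; the index \<open>S\<close> stands for the
  monomial that is the product of the generators in \<open>S\<close> in increasing order.
\<close>

typedef 'g ext = "UNIV :: ('g fset \<Rightarrow>\<^sub>0 complex) set"
  morphisms ext_coeffs Abs_ext
  by simp

setup_lifting type_definition_ext

text \<open>
  The sign comes from sorting the concatenation of two increasing words: each pair \<open>b < a\<close> with
  \<open>a\<close> in the first and \<open>b\<close> in the second word costs one transposition.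
\<close>

definition shuffle_sign :: "'g::linorder fset \<Rightarrow> 'g fset \<Rightarrow> complex" where
  "shuffle_sign A B = (-1) ^ card {(a, b). a |\<in>| A \<and> b |\<in>| B \<and> b < a}"

definition wedge_monomials ::
  "'g::linorder fset \<Rightarrow> 'g fset \<Rightarrow> complex \<Rightarrow> complex \<Rightarrow> 'g fset \<Rightarrow>\<^sub>0 complex" where
  "wedge_monomials A B a b =
     (if A |\<inter>| B = {||} then Poly_Mapping.single (A |\<union>| B) (shuffle_sign A B * a * b) else 0)"

definition wedge_coeffs ::
  "('g::linorder fset \<Rightarrow>\<^sub>0 complex) \<Rightarrow> ('g fset \<Rightarrow>\<^sub>0 complex) \<Rightarrow> ('g fset \<Rightarrow>\<^sub>0 complex)" where
  "wedge_coeffs f g =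
     (\<Sum>A\<in>Poly_Mapping.keys f. \<Sum>B\<in>Poly_Mapping.keys g.
        wedge_monomials A B (Poly_Mapping.lookup f A) (Poly_Mapping.lookup g B))"

lemma wedge_monomials_0 [simp]:
  "wedge_monomials A B 0 b = 0" "wedge_monomials A B a 0 = 0"
  by (simp_all add: wedge_monomials_def)

lemma wedge_monomials_add:
  "wedge_monomials A B (a + a') b = wedge_monomials A B a b + wedge_monomials A B a' b"
  "wedge_monomials A B a (b + b') = wedge_monomials A B a b + wedge_monomials A B a b'"
  by (simp_all add: wedge_monomials_def algebra_simps single_add)

lemma wedge_coeffs_superset:
  assumes "finite F" "finite G" "Poly_Mapping.keys f \<subseteq> F" "Poly_Mapping.keys g \<subseteq> G"
  shows "wedge_coeffs f g =
    (\<Sum>A\<in>F. \<Sum>B\<in>G. wedge_monomials A B (Poly_Mapping.lookup f A) (Poly_Mapping.lookup g B))"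
proof -
  have "wedge_coeffs f g = (\<Sum>A\<in>Poly_Mapping.keys f. \<Sum>B\<in>G.
      wedge_monomials A B (Poly_Mapping.lookup f A) (Poly_Mapping.lookup g B))"
    unfolding wedge_coeffs_def using assms
    by (intro sum.cong refl sum.mono_neutral_left) (auto simp: in_keys_iff)
  also have "\<dots> = (\<Sum>A\<in>F. \<Sum>B\<in>G.
      wedge_monomials A B (Poly_Mapping.lookup f A) (Poly_Mapping.lookup g B))"
    using assms by (intro sum.mono_neutral_left) (auto simp: in_keys_iff)
  finally show ?thesis .
qed

lemma wedge_coeffs_0 [simp]: "wedge_coeffs 0 g = 0" "wedge_coeffs f 0 = 0"
  by (simp_all add: wedge_coeffs_def)

lemma wedge_coeffs_add_left: "wedge_coeffs (f + f') g = wedge_coeffs f g + wedge_coeffs f' g"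
proof -
  let ?F = "Poly_Mapping.keys f \<union> Poly_Mapping.keys f'" and ?G = "Poly_Mapping.keys g"
  have "Poly_Mapping.keys (f + f') \<subseteq> ?F" by (rule Poly_Mapping.keys_add)
  then show ?thesis
    by (simp add: wedge_coeffs_superset[of ?F ?G] lookup_add wedge_monomials_add sum.distrib)
qed

lemma wedge_coeffs_add_right: "wedge_coeffs f (g + g') = wedge_coeffs f g + wedge_coeffs f g'"
proof -
  let ?G = "Poly_Mapping.keys g \<union> Poly_Mapping.keys g'" and ?F = "Poly_Mapping.keys f"
  have "Poly_Mapping.keys (g + g') \<subseteq> ?G" by (rule Poly_Mapping.keys_add)
  then show ?thesis
    by (simp add: wedge_coeffs_superset[of ?F ?G] lookup_add wedge_monomials_add sum.distrib)
qed

lemma wedge_coeffs_single: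
  "wedge_coeffs (Poly_Mapping.single A a) (Poly_Mapping.single B b) = wedge_monomials A B a b"
  by (subst wedge_coeffs_superset[of "{A}" "{B}"]) auto

lemma shuffle_sign_empty [simp]: "shuffle_sign {||} B = 1" "shuffle_sign A {||} = 1"
  by (simp_all add: shuffle_sign_def)

lemma finite_inversions: "finite {(a, b). a |\<in>| A \<and> b |\<in>| B \<and> b < (a::'g::linorder)}"
  by (rule finite_subset[of _ "fset A \<times> fset B"]) auto

lemma shuffle_sign_union:
  assumes "A |\<inter>| B = {||}"
  shows "shuffle_sign (A |\<union>| B) C = shuffle_sign A C * shuffle_sign B C"
    and "shuffle_sign C (A |\<union>| B) = shuffle_sign C A * shuffle_sign C B"
proof -
  have *: "x |\<notin>| B" if "x |\<in>| A" for x using assms that by auto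
  have "{(a, b). a |\<in>| A |\<union>| B \<and> b |\<in>| C \<and> b < a} =
      {(a, b). a |\<in>| A \<and> b |\<in>| C \<and> b < a} \<union> {(a, b). a |\<in>| B \<and> b |\<in>| C \<and> b < a}" by auto
  moreover have "card \<dots> = card {(a, b). a |\<in>| A \<and> b |\<in>| C \<and> b < a} +
      card {(a, b). a |\<in>| B \<and> b |\<in>| C \<and> b < a}"
    using * by (intro card_Un_disjoint finite_inversions) auto
  ultimately show "shuffle_sign (A |\<union>| B) C = shuffle_sign A C * shuffle_sign B C"
    by (simp add: shuffle_sign_def power_add)
  have "{(a, b). a |\<in>| C \<and> b |\<in>| A |\<union>| B \<and> b < a} =
      {(a, b). a |\<in>| C \<and> b |\<in>| A \<and> b < a} \<union> {(a, b). a |\<in>| C \<and> b |\<in>| B \<and> b < a}" by auto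
  moreover have "card \<dots> = card {(a, b). a |\<in>| C \<and> b |\<in>| A \<and> b < a} +
      card {(a, b). a |\<in>| C \<and> b |\<in>| B \<and> b < a}"
    using * by (intro card_Un_disjoint finite_inversions) auto
  ultimately show "shuffle_sign C (A |\<union>| B) = shuffle_sign C A * shuffle_sign C B"
    by (simp add: shuffle_sign_def power_add)
qed

lemma wedge_coeffs_assoc_single:
  "wedge_coeffs (wedge_coeffs (Poly_Mapping.single A a) (Poly_Mapping.single B b))
     (Poly_Mapping.single C c) =
   wedge_coeffs (Poly_Mapping.single A a)
     (wedge_coeffs (Poly_Mapping.single B b) (Poly_Mapping.single C c))"
proof (cases "A |\<inter>| B = {||} \<and> A |\<inter>| C = {||} \<and> B |\<inter>| C = {||}")
  case True
  then have "(A |\<union>| B) |\<inter>| C = {||}" "A |\<inter>| (B |\<union>| C) = {||}"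
    by (simp_all add: inf_sup_distrib1 inf_sup_distrib2)
  with True show ?thesis
    by (simp add: wedge_coeffs_single wedge_monomials_def shuffle_sign_union funion_assoc
        mult_ac)
next
  case False
  then show ?thesis
    by (auto simp: wedge_coeffs_single wedge_monomials_def inf_sup_distrib1 inf_sup_distrib2)
qed

lemma ext_coeffs_induct [case_names single add]:
  fixes f :: "'k \<Rightarrow>\<^sub>0 complex"
  assumes "\<And>k v. P (Poly_Mapping.single k v)" "\<And>f g. P f \<Longrightarrow> P g \<Longrightarrow> P (f + g)"
  shows "P f"
proof (induction f rule: update_induct)
  case const
  have "P (Poly_Mapping.single undefined 0)" by (rule assms)
  then show ?case by simp
next
  case (update f k v)
  have "Poly_Mapping.update k v f = Poly_Mapping.single k v + f"
    using update(1)
    by (intro poly_mapping_eqI) (auto simp: lookup_update lookup_add lookup_single in_keys_iff)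
  with update(3) assms show ?case by simp
qed

lemma wedge_coeffs_assoc:
  "wedge_coeffs (wedge_coeffs f g) h = wedge_coeffs f (wedge_coeffs g h)"
proof (induction f rule: ext_coeffs_induct)
  case f: (single A a)
  show ?case
  proof (induction g rule: ext_coeffs_induct)
    case g: (single B b)
    show ?case
      by (induction h rule: ext_coeffs_induct)
         (simp_all add: wedge_coeffs_assoc_single wedge_coeffs_add_right)
  qed (simp add: wedge_coeffs_add_left wedge_coeffs_add_right)
qed (simp add: wedge_coeffs_add_left)

lemma wedge_coeffs_1:
  "wedge_coeffs (Poly_Mapping.single {||} 1) f = f"
  "wedge_coeffs f (Poly_Mapping.single {||} 1) = f"
  by (induction f rule: ext_coeffs_induct;
      simp add: wedge_coeffs_add_left wedge_coeffs_add_right wedge_coeffs_single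
        wedge_monomials_def)+

instantiation ext :: (linorder) ring_1
begin

lift_definition zero_ext :: "'a ext" is 0 .
lift_definition one_ext :: "'a ext" is "Poly_Mapping.single {||} 1" .
lift_definition plus_ext :: "'a ext \<Rightarrow> 'a ext \<Rightarrow> 'a ext" is "(+)" .
lift_definition minus_ext :: "'a ext \<Rightarrow> 'a ext \<Rightarrow> 'a ext" is "(-)" .
lift_definition uminus_ext :: "'a ext \<Rightarrow> 'a ext" is uminus .
lift_definition times_ext :: "'a ext \<Rightarrow> 'a ext \<Rightarrow> 'a ext" is wedge_coeffs .

instance
proof
  show "(0::'a ext) \<noteq> 1" by transfer (metis single_zero inj_single injD zero_neq_one)
qed (transfer; simp add: algebra_simps wedge_coeffs_assoc wedge_coeffs_1
      wedge_coeffs_add_left wedge_coeffs_add_right)+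

end

lift_definition ext_scale :: "complex \<Rightarrow> 'g ext \<Rightarrow> 'g ext" is
  "\<lambda>c. Poly_Mapping.map ((*) c)" .

lift_definition ext_monomial :: "'g fset \<Rightarrow> complex \<Rightarrow> 'g ext" is Poly_Mapping.single .

definition ext_gen :: "'g \<Rightarrow> 'g ext" where
  "ext_gen x = ext_monomial {|x|} 1"

lemma ext_gen_square: "ext_gen x * ext_gen x = 0"
  unfolding ext_gen_def by transfer (simp add: wedge_coeffs_single wedge_monomials_def)

lemma ext_gen_anticommute: "ext_gen x * ext_gen y = - (ext_gen y * ext_gen x)"
proof (cases "x = y")
  case False
  have "{(a, b). a = x \<and> b = y \<and> b < a} = (if y < x then {(x, y)} else {})"
    "{(a, b). a = y \<and> b = x \<and> b < a} = (if x < y then {(y, x)} else {})" by auto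
  with False show ?thesis
    unfolding ext_gen_def
    by transfer (auto simp: wedge_coeffs_single wedge_monomials_def shuffle_sign_def
        finsert_commute single_uminus)
qed (simp add: ext_gen_square)

text \<open>The derivative with respect to a generator \<open>x\<close>; the exponent counts the factors to the
  left of \<open>x\<close> in the monomial.\<close>

definition ext_deriv :: "'g::linorder \<Rightarrow> 'g ext \<Rightarrow> 'g ext" where
  "ext_deriv x f =
     (\<Sum>S\<in>Poly_Mapping.keys (ext_coeffs f).
        if x |\<in>| S
        then ext_monomial (S |-| {|x|})
               ((-1) ^ card {y. y |\<in>| S \<and> y < x} * Poly_Mapping.lookup (ext_coeffs f) S)
        else 0)"

text \<open>The algebra endomorphism that sends each generator \<open>x\<close> to the generator \<open>p x\<close>.\<close>

definition ext_act :: "('g \<Rightarrow> 'g) \<Rightarrow> 'g::linorder ext \<Rightarrow> 'g ext" where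
  "ext_act p f =
     (\<Sum>S\<in>Poly_Mapping.keys (ext_coeffs f).
        ext_scale (Poly_Mapping.lookup (ext_coeffs f) S)
          (prod_list (map (\<lambda>x. ext_gen (p x)) (sorted_list_of_fset S))))"


section \<open>Finite-dimensional complex representations of a group\<close>

text \<open>
  The fields \<open>mult\<close> and \<open>one\<close> inherited from \<open>ring\<close> through \<open>module\<close> play no role, as in the
  locale \<open>module\<close>.
\<close>

abbreviation complex_ring :: "complex ring" where
  "complex_ring \<equiv> ring_of_type_algebra"

record ('g, 'a) rep = "(complex, 'a) module" +
  act :: "'g \<Rightarrow> 'a \<Rightarrow> 'a"

locale fd_rep = G?: group G + V?: module complex_ring V
  for G :: "('g, 'm) monoid_scheme" (structure) and V :: "('g, 'a) rep" (structure) +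
  assumes act_closed: "\<lbrakk>g \<in> carrier G; v \<in> carrier V\<rbrakk> \<Longrightarrow> act V g v \<in> carrier V"
    and act_add: "\<lbrakk>g \<in> carrier G; v \<in> carrier V; w \<in> carrier V\<rbrakk> \<Longrightarrow>
      act V g (v \<oplus>\<^bsub>V\<^esub> w) = act V g v \<oplus>\<^bsub>V\<^esub> act V g w"
    and act_smult: "\<lbrakk>g \<in> carrier G; v \<in> carrier V\<rbrakk> \<Longrightarrow>
      act V g (c \<odot>\<^bsub>V\<^esub> v) = c \<odot>\<^bsub>V\<^esub> act V g v"
    and act_one: "v \<in> carrier V \<Longrightarrow> act V \<one>\<^bsub>G\<^esub> v = v"
    and act_mult: "\<lbrakk>g \<in> carrier G; h \<in> carrier G; v \<in> carrier V\<rbrakk> \<Longrightarrow>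
      act V (g \<otimes>\<^bsub>G\<^esub> h) v = act V g (act V h v)"
    and finite_dim: "\<exists>B. finite B \<and> B \<subseteq> carrier V \<and>
      (\<forall>v\<in>carrier V. \<exists>c. v = (\<Oplus>\<^bsub>V\<^esub>b\<in>B. c b \<odot>\<^bsub>V\<^esub> b))"

definition rep_hom ::
  "('g, 'm) monoid_scheme \<Rightarrow> ('g, 'a) rep \<Rightarrow> ('g, 'b) rep \<Rightarrow> ('a \<Rightarrow> 'b) set" where
  "rep_hom G V W =
     {f \<in> carrier V \<rightarrow> carrier W.
        (\<forall>v\<in>carrier V. \<forall>v'\<in>carrier V. f (v \<oplus>\<^bsub>V\<^esub> v') = f v \<oplus>\<^bsub>W\<^esub> f v') \<and>
        (\<forall>c. \<forall>v\<in>carrier V. f (c \<odot>\<^bsub>V\<^esub> v) = c \<odot>\<^bsub>W\<^esub> f v) \<and>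
        (\<forall>g\<in>carrier G. \<forall>v\<in>carrier V. f (act V g v) = act W g (f v))}"

definition rep_iso :: "('g, 'm) monoid_scheme \<Rightarrow> ('g, 'a) rep \<Rightarrow> ('g, 'b) rep \<Rightarrow> bool" where
  "rep_iso G V W \<longleftrightarrow> (\<exists>f\<in>rep_hom G V W. bij_betw f (carrier V) (carrier W))"

definition irreducible_rep :: "('g, 'm) monoid_scheme \<Rightarrow> ('g, 'a) rep \<Rightarrow> bool" where
  "irreducible_rep G V \<longleftrightarrow>
     fd_rep G V \<and> carrier V \<noteq> {\<zero>\<^bsub>V\<^esub>} \<and>
     (\<forall>N. submodule N complex_ring V \<and> (\<forall>g\<in>carrier G. \<forall>v\<in>N. act V g v \<in> N)
        \<longrightarrow> N = {\<zero>\<^bsub>V\<^esub>} \<or> N = carrier V)"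

definition short_exact ::
  "('g, 'm) monoid_scheme \<Rightarrow> ('g, 'a) rep \<Rightarrow> ('g, 'b) rep \<Rightarrow> ('g, 'c) rep \<Rightarrow> bool" where
  "short_exact G U V W \<longleftrightarrow>
     fd_rep G U \<and> fd_rep G V \<and> fd_rep G W \<and>
     (\<exists>f\<in>rep_hom G U V. \<exists>g\<in>rep_hom G V W.
        inj_on f (carrier U) \<and> f ` carrier U = {v \<in> carrier V. g v = \<zero>\<^bsub>W\<^esub>} \<and>
        g ` carrier V = carrier W)"

definition quot_rep :: "('g, 'a) rep \<Rightarrow> 'a set \<Rightarrow> ('g, 'a set) rep" where
  "quot_rep V N =
     \<lparr>carrier = a_rcosets\<^bsub>V\<^esub> N, mult = undefined, one = undefined, zero = N, add = set_add V,
      module.smult = (\<lambda>c C. \<Union>v\<in>C. N +>\<^bsub>V\<^esub> (c \<odot>\<^bsub>V\<^esub> v)),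
      act = (\<lambda>g C. \<Union>v\<in>C. N +>\<^bsub>V\<^esub> act V g v)\<rparr>"

definition trivial_rep :: "('g, complex) rep" where
  "trivial_rep =
     \<lparr>carrier = UNIV, mult = (*), one = 1, zero = 0, add = (+), module.smult = (*), act = (\<lambda>g v. v)\<rparr>"

text \<open>
  The tensor product over the complex numbers is the free vector space on pairs modulo the
  subspace generated by the bilinearity relations, with the diagonal action.
\<close>

definition free_pairs_rep ::
  "('g, 'a) rep \<Rightarrow> ('g, 'b) rep \<Rightarrow> ('g, ('a \<times> 'b) \<Rightarrow>\<^sub>0 complex) rep" where
  "free_pairs_rep V W =
     \<lparr>carrier = {x. Poly_Mapping.keys x \<subseteq> carrier V \<times> carrier W},
      mult = undefined, one = undefined, zero = 0, add = (+),
      module.smult = (\<lambda>c. Poly_Mapping.map ((*) c)),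
      act = (\<lambda>g x. \<Sum>(v, w)\<in>Poly_Mapping.keys x.
        Poly_Mapping.single (act V g v, act W g w) (Poly_Mapping.lookup x (v, w)))\<rparr>"

definition bilinear_relations ::
  "('g, 'a) rep \<Rightarrow> ('g, 'b) rep \<Rightarrow> (('a \<times> 'b) \<Rightarrow>\<^sub>0 complex) set" where
  "bilinear_relations V W =
     {Poly_Mapping.single (v \<oplus>\<^bsub>V\<^esub> v', w) 1 - Poly_Mapping.single (v, w) 1
        - Poly_Mapping.single (v', w) 1 | v v' w.
        v \<in> carrier V \<and> v' \<in> carrier V \<and> w \<in> carrier W} \<union>
     {Poly_Mapping.single (v, w \<oplus>\<^bsub>W\<^esub> w') 1 - Poly_Mapping.single (v, w) 1
        - Poly_Mapping.single (v, w') 1 | v w w'.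
        v \<in> carrier V \<and> w \<in> carrier W \<and> w' \<in> carrier W} \<union>
     {Poly_Mapping.single (c \<odot>\<^bsub>V\<^esub> v, w) 1 - Poly_Mapping.single (v, w) c | c v w.
        v \<in> carrier V \<and> w \<in> carrier W} \<union>
     {Poly_Mapping.single (v, c \<odot>\<^bsub>W\<^esub> w) 1 - Poly_Mapping.single (v, w) c | c v w.
        v \<in> carrier V \<and> w \<in> carrier W}"

definition tensor_rep ::
  "('g, 'a) rep \<Rightarrow> ('g, 'b) rep \<Rightarrow> ('g, (('a \<times> 'b) \<Rightarrow>\<^sub>0 complex) set) rep" where
  "tensor_rep V W =
     (let F = free_pairs_rep V W
      in quot_rep F ((\<lambda>N. submodule N complex_ring F) hull bilinear_relations V W))"


section \<open>The Grothendieck ring\<close>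

text \<open>
  Representations on arbitrary carrier types do not form a type, so isomorphism classes are
  formed inside one fixed carrier type.  It is large enough to hold a copy of every space of
  coordinate vectors, hence an isomorphic copy of every finite-dimensional representation.
\<close>

type_synonym 'g model = "('g, nat \<Rightarrow> complex) rep"

definition irr_class :: "('g, 'm) monoid_scheme \<Rightarrow> 'g model \<Rightarrow> 'g model set" where
  "irr_class G V = {M. irreducible_rep G M \<and> rep_iso G M V}"

definition irr_classes :: "('g, 'm) monoid_scheme \<Rightarrow> 'g model set set" where
  "irr_classes G = irr_class G ` {V. irreducible_rep G V}"

text \<open>
  The class of a representation is the element of the free abelian group on the irreducible
  classes that is determined by additivity on short exact sequences.  It is unique by the
  Jordan-Hoelder theorem.
\<close>

inductive has_class ::
  "('g, 'm) monoid_scheme \<Rightarrow> 'g model \<Rightarrow> ('g model set \<Rightarrow>\<^sub>0 int) \<Rightarrow> bool" for G where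
  zero: "\<lbrakk>fd_rep G V; carrier V = {\<zero>\<^bsub>V\<^esub>}\<rbrakk> \<Longrightarrow> has_class G V 0"
| irreducible: "irreducible_rep G V \<Longrightarrow> has_class G V (frag_of (irr_class G V))"
| short_exact: "\<lbrakk>short_exact G U V W; has_class G U x; has_class G W y\<rbrakk> \<Longrightarrow>
    has_class G V (x + y)"

definition rep_class ::
  "('g, 'm) monoid_scheme \<Rightarrow> ('g, 'a) rep \<Rightarrow> ('g model set \<Rightarrow>\<^sub>0 int)" where
  "rep_class G V = (THE x. \<exists>M. rep_iso G M V \<and> has_class G M x)"

text \<open>The product is the biadditive extension of \<open>[S] [T] = [S \<otimes> T]\<close> for irreducible \<open>S\<close>, \<open>T\<close>.\<close>

definition groth_mult ::
  "('g, 'm) monoid_scheme \<Rightarrow> ('g model set \<Rightarrow>\<^sub>0 int) \<Rightarrow> ('g model set \<Rightarrow>\<^sub>0 int)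
     \<Rightarrow> ('g model set \<Rightarrow>\<^sub>0 int)" where
  "groth_mult G x y =
     frag_extend (\<lambda>s. frag_extend (\<lambda>t.
       rep_class G (tensor_rep (SOME S. S \<in> s) (SOME T. T \<in> t))) y) x"

definition groth_ring :: "('g, 'm) monoid_scheme \<Rightarrow> ('g model set \<Rightarrow>\<^sub>0 int) ring" where
  "groth_ring G =
     \<lparr>carrier = carrier (free_Abelian_group (irr_classes G)),
      mult = groth_mult G, one = rep_class G trivial_rep, zero = 0, add = (+)\<rparr>"


section \<open>The bigraded exterior algebra and its first cohomology quotient\<close>

datatype 'i gen = Alpha 'i | Theta 'i

instantiation gen :: (linorder) linorder
begin

fun less_eq_gen :: "'a gen \<Rightarrow> 'a gen \<Rightarrow> bool" where
  "less_eq_gen (Alpha i) (Alpha j) \<longleftrightarrow> i \<le> j"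
| "less_eq_gen (Alpha i) (Theta j) \<longleftrightarrow> True"
| "less_eq_gen (Theta i) (Alpha j) \<longleftrightarrow> False"
| "less_eq_gen (Theta i) (Theta j) \<longleftrightarrow> i \<le> j"

definition less_gen :: "'a gen \<Rightarrow> 'a gen \<Rightarrow> bool" where
  "less_gen x y \<longleftrightarrow> x \<le> y \<and> \<not> y \<le> x"

instance
proof
  fix x y z :: "'a gen"
  show "x < y \<longleftrightarrow> x \<le> y \<and> \<not> y \<le> x" by (rule less_gen_def)
  show "x \<le> x" by (cases x) auto
  show "x \<le> y \<Longrightarrow> y \<le> z \<Longrightarrow> x \<le> z" by (cases x; cases y; cases z) auto
  show "x \<le> y \<Longrightarrow> y \<le> x \<Longrightarrow> x = y" by (cases x; cases y) auto
  show "x \<le> y \<or> y \<le> x" by (cases x; cases y) auto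
qed

end

definition ext_rep ::
  "('g::linorder fset \<Rightarrow> bool) \<Rightarrow> ('p \<Rightarrow> 'g \<Rightarrow> 'g) \<Rightarrow> ('p, 'g ext) rep" where
  "ext_rep P a =
     \<lparr>carrier = {f. \<forall>S\<in>Poly_Mapping.keys (ext_coeffs f). P S},
      mult = (*), one = 1, zero = 0, add = (+), module.smult = ext_scale,
      act = (\<lambda>w. ext_act (a w))\<rparr>"

text \<open>
  The generator \<open>i\<close> is the \<open>i\<close>-th standard basis vector, permuted by \<open>w\<close> to the \<open>w i\<close>-th one.
  Degrees are integers, so that the exterior powers of negative degree are zero.
\<close>

definition ext_power :: "nat \<Rightarrow> int \<Rightarrow> (nat \<Rightarrow> nat, nat ext) rep" where
  "ext_power n k = ext_rep (\<lambda>S. fset S \<subseteq> {1..n} \<and> int (fcard S) = k) (\<lambda>w. w)"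

definition E :: "nat \<Rightarrow> int \<Rightarrow> int \<Rightarrow> (nat \<Rightarrow> nat, nat gen ext) rep" where
  "E n i j =
     ext_rep (\<lambda>S. fset S \<subseteq> Alpha ` {1..n} \<union> Theta ` {1..n} \<and>
                  int (card (fset S \<inter> range Alpha)) = i \<and>
                  int (card (fset S \<inter> range Theta)) = j)
             map_gen"

definition tau :: "nat \<Rightarrow> nat gen ext \<Rightarrow> nat gen ext" where
  "tau n f = (\<Sum>i=1..n. ext_gen (Alpha i) * ext_deriv (Theta i) f)"

definition H1 :: "nat \<Rightarrow> int \<Rightarrow> int \<Rightarrow> (nat \<Rightarrow> nat, nat gen ext set) rep" where
  "H1 n i j = quot_rep (E n i j) (tau n ` carrier (E n (i - 1) (j + 1)))"

end

theory Submission
  imports Defs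
begin

text \<open>
  The operator \<open>tau\<close> is the raising operator of an sl2-action on the exterior algebra in which the
  component of bidegree \<open>(i, j)\<close> has weight \<open>i - j\<close>; the lowering operator exchanges the roles of the
  two kinds of generators.  Hence \<open>tau\<close> is surjective onto the components of positive weight and
  injective on those of negative weight, and for \<open>i \<le> j\<close> the quotient is the cokernel of an
  equivariant injection.  Its class is therefore a difference of classes by additivity, once classes
  are known to be well defined: removing a simple submodule from a representation removes the class
  of that submodule from every class of the representation.  The products come from the
  multiplication isomorphism between the tensor product of the two exterior powers and the bigraded
  component, because tensoring with a fixed representation is exact.
\<close>

section \<open>Complex vector spaces as modules\<close>

text \<open>Size is measured by the number of elements of a finite spanning set. A proper subspace
  is the image of V under a linear projection, and a quotient by a nonzero subspace is an image too;
  both maps have a nonzero kernel, and the image under such a map is spanned by fewer elements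
  (\<open>gen_image_kernel\<close>). This one measure drives the descent to a simple submodule and
  both the existence and the uniqueness of classes. Classes are generated inside one fixed carrier
  type, while quotients, tensor products and exterior algebras live on other types; hence the
  frequent transport along isomorphisms. Signs in the exterior algebra depend on the order of the
  generators. The product rules are therefore first shown for a generator placed before a monomial
  of larger ones, and then extended by anticommutation. For \<open>tau\<close> no decomposition into
  irreducibles of sl2 is made: if \<open>tau f = 0\<close> then
  \<open>tau (sigma^(k+1) f) = (k+1)(i-j-k) sigma^k f\<close>, and nilpotency holds because a
  component with a negative degree is zero.\<close>

lemma complex_ring_simps [simp]:
  "carrier complex_ring = UNIV" "\<zero>\<^bsub>complex_ring\<^esub> = 0" "\<one>\<^bsub>complex_ring\<^esub> = 1"
  "x \<oplus>\<^bsub>complex_ring\<^esub> y = x + y" "x \<otimes>\<^bsub>complex_ring\<^esub> y = x * y"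
  by (simp_all add: ring_of_type_algebra_def)

locale complex_space = module complex_ring V for V :: "('g, 'a) rep" (structure)
begin

lemma add_cl: "\<lbrakk>v \<in> carrier V; w \<in> carrier V\<rbrakk> \<Longrightarrow> v \<oplus> w \<in> carrier V"
  by (rule M.a_closed)

lemma smult_cl: "v \<in> carrier V \<Longrightarrow> c \<odot> v \<in> carrier V"
  using smult_closed by simp

lemma zero_cl: "\<zero> \<in> carrier V"
  by (rule M.zero_closed)

lemma smult_add: "v \<in> carrier V \<Longrightarrow> (a + b) \<odot> v = a \<odot> v \<oplus> b \<odot> v"
  using smult_l_distr[of a b v] by simp

lemma smult_add_right: "\<lbrakk>v \<in> carrier V; w \<in> carrier V\<rbrakk> \<Longrightarrow> c \<odot> (v \<oplus> w) = c \<odot> v \<oplus> c \<odot> w"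
  using smult_r_distr[of c v w] by simp

lemma smult_smult: "v \<in> carrier V \<Longrightarrow> a \<odot> (b \<odot> v) = (a * b) \<odot> v"
  using smult_assoc1[of a b v] by simp

lemma smult_1: "v \<in> carrier V \<Longrightarrow> 1 \<odot> v = v"
  using smult_one[of v] by simp

lemma smult_0: "v \<in> carrier V \<Longrightarrow> 0 \<odot> v = \<zero>"
  using smult_l_null[of v] by simp

lemma smult_zero: "c \<odot> \<zero> = \<zero>"
  using smult_r_null[of c] by simp

lemma smult_m1_add: "v \<in> carrier V \<Longrightarrow> v \<oplus> (-1) \<odot> v = \<zero>"
  using smult_add[of v 1 "-1"] by (simp add: smult_1 smult_0)

lemma smult_m1_add': "v \<in> carrier V \<Longrightarrow> (-1) \<odot> v \<oplus> v = \<zero>"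
  using smult_m1_add M.a_comm smult_cl by metis

lemma minus_eq_smult: "v \<in> carrier V \<Longrightarrow> \<ominus> v = (-1) \<odot> v"
  by (metis M.minus_equality M.a_comm smult_cl smult_m1_add)

lemma add_m1_eq: "\<lbrakk>v \<in> carrier V; w \<in> carrier V\<rbrakk> \<Longrightarrow> w \<oplus> (v \<oplus> (-1) \<odot> w) = v"
  using smult_m1_add[of w] by (metis M.a_lcomm M.r_zero smult_cl)

lemma add_smult_m1_cancel:
  "\<lbrakk>v \<in> carrier V; w \<in> carrier V\<rbrakk> \<Longrightarrow> (v \<oplus> w) \<oplus> (-1) \<odot> w = v"
  by (simp add: M.a_assoc smult_cl smult_m1_add)

lemma eqI_diff: "\<lbrakk>v \<in> carrier V; w \<in> carrier V; v \<oplus> (-1) \<odot> w = \<zero>\<rbrakk> \<Longrightarrow> v = w"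
  by (metis add_m1_eq M.r_zero)

end

text \<open>Additive inverses are demanded in the form \<open>(-1) \<odot> v\<close>, so an instance
  supplies addition and scaling only. Differences are written in this form from here on.\<close>

lemma complex_spaceI:
  fixes V :: "('g, 'a) rep" (structure)
  assumes "\<zero> \<in> carrier V"
    and "\<And>v w. \<lbrakk>v \<in> carrier V; w \<in> carrier V\<rbrakk> \<Longrightarrow> v \<oplus> w \<in> carrier V"
    and "\<And>c v. v \<in> carrier V \<Longrightarrow> c \<odot> v \<in> carrier V"
    and "\<And>u v w. \<lbrakk>u \<in> carrier V; v \<in> carrier V; w \<in> carrier V\<rbrakk> \<Longrightarrow> u \<oplus> v \<oplus> w = u \<oplus> (v \<oplus> w)"
    and "\<And>v w. \<lbrakk>v \<in> carrier V; w \<in> carrier V\<rbrakk> \<Longrightarrow> v \<oplus> w = w \<oplus> v"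
    and "\<And>v. v \<in> carrier V \<Longrightarrow> \<zero> \<oplus> v = v"
    and "\<And>v. v \<in> carrier V \<Longrightarrow> (-1) \<odot> v \<oplus> v = \<zero>"
    and "\<And>a b v. v \<in> carrier V \<Longrightarrow> (a + b) \<odot> v = a \<odot> v \<oplus> b \<odot> v"
    and "\<And>c v w. \<lbrakk>v \<in> carrier V; w \<in> carrier V\<rbrakk> \<Longrightarrow> c \<odot> (v \<oplus> w) = c \<odot> v \<oplus> c \<odot> w"
    and "\<And>a b v. v \<in> carrier V \<Longrightarrow> (a * b) \<odot> v = a \<odot> (b \<odot> v)"
    and "\<And>v. v \<in> carrier V \<Longrightarrow> 1 \<odot> v = v"
  shows "complex_space V"
  unfolding complex_space_def
proof (rule moduleI)
  show "cring complex_ring" by (rule cring_from_type_algebra)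
  show "abelian_group V"
    using assms by (intro abelian_groupI) metis+
qed (use assms in auto)

section \<open>Subspaces, spanning sets and linear maps\<close>

definition csub :: "('g, 'a) rep \<Rightarrow> 'a set \<Rightarrow> bool" where
  "csub V N \<longleftrightarrow> N \<subseteq> carrier V \<and> \<zero>\<^bsub>V\<^esub> \<in> N \<and> (\<forall>x\<in>N. \<forall>y\<in>N. x \<oplus>\<^bsub>V\<^esub> y \<in> N) \<and>
     (\<forall>c. \<forall>x\<in>N. c \<odot>\<^bsub>V\<^esub> x \<in> N)"

text \<open>Spanning is expressed through subspaces, so a statement about all vectors becomes the
  claim that some subspace contains B, without any manipulation of sums.\<close>

definition generates :: "('g, 'a) rep \<Rightarrow> 'a set \<Rightarrow> bool" where
  "generates V B \<longleftrightarrow> finite B \<and> B \<subseteq> carrier V \<and> (\<forall>N. csub V N \<and> B \<subseteq> N \<longrightarrow> carrier V \<subseteq> N)"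

text \<open>The linear half of \<open>rep_hom\<close>. It is kept apart because projections,
  splittings and lifts are built as linear maps, and equivariance is checked afterwards where it
  holds.\<close>

definition linmap :: "('g, 'a) rep \<Rightarrow> ('h, 'b) rep \<Rightarrow> ('a \<Rightarrow> 'b) set" where
  "linmap V W =
     {f \<in> carrier V \<rightarrow> carrier W.
        (\<forall>v\<in>carrier V. \<forall>v'\<in>carrier V. f (v \<oplus>\<^bsub>V\<^esub> v') = f v \<oplus>\<^bsub>W\<^esub> f v') \<and>
        (\<forall>c. \<forall>v\<in>carrier V. f (c \<odot>\<^bsub>V\<^esub> v) = c \<odot>\<^bsub>W\<^esub> f v)}"

lemma genD: "\<lbrakk>generates V B; csub V N; B \<subseteq> N\<rbrakk> \<Longrightarrow> carrier V \<subseteq> N"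
  by (auto simp: generates_def)

lemma linmapI:
  assumes "\<And>v. v \<in> carrier V \<Longrightarrow> f v \<in> carrier W"
    and "\<And>v v'. \<lbrakk>v \<in> carrier V; v' \<in> carrier V\<rbrakk> \<Longrightarrow> f (v \<oplus>\<^bsub>V\<^esub> v') = f v \<oplus>\<^bsub>W\<^esub> f v'"
    and "\<And>c v. v \<in> carrier V \<Longrightarrow> f (c \<odot>\<^bsub>V\<^esub> v) = c \<odot>\<^bsub>W\<^esub> f v"
  shows "f \<in> linmap V W"
  using assms by (auto simp: linmap_def)

lemma linmapD:
  assumes "f \<in> linmap V W" "v \<in> carrier V"
  shows "f v \<in> carrier W"
    and "v' \<in> carrier V \<Longrightarrow> f (v \<oplus>\<^bsub>V\<^esub> v') = f v \<oplus>\<^bsub>W\<^esub> f v'"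
    and "f (c \<odot>\<^bsub>V\<^esub> v) = c \<odot>\<^bsub>W\<^esub> f v"
  using assms by (auto simp: linmap_def)

lemma linmap_zero:
  assumes "complex_space V" "complex_space W" "f \<in> linmap V W"
  shows "f \<zero>\<^bsub>V\<^esub> = \<zero>\<^bsub>W\<^esub>"
  using linmapD(1,3)[OF assms(3), of "\<zero>\<^bsub>V\<^esub>"] complex_space.zero_cl[OF assms(1)]
    complex_space.smult_0 assms(1,2) by metis

lemma linmap_comp: "\<lbrakk>f \<in> linmap U V; g \<in> linmap V W\<rbrakk> \<Longrightarrow> g \<circ> f \<in> linmap U W"
  by (auto simp: linmap_def Pi_def)

lemma csubD:
  assumes "csub V N"
  shows "N \<subseteq> carrier V" "\<zero>\<^bsub>V\<^esub> \<in> N" "\<lbrakk>x \<in> N; y \<in> N\<rbrakk> \<Longrightarrow> x \<oplus>\<^bsub>V\<^esub> y \<in> N" "x \<in> N \<Longrightarrow> c \<odot>\<^bsub>V\<^esub> x \<in> N"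
    "x \<in> N \<Longrightarrow> x \<in> carrier V"
  using assms by (auto simp: csub_def)

context complex_space
begin

lemma submodule_iff_csub: "submodule N complex_ring V \<longleftrightarrow> csub V N"
proof
  assume N: "submodule N complex_ring V"
  note s = submoduleE[OF N]
  then obtain x where "x \<in> N" by auto
  with s(4)[of 0 x] s(1) have "\<zero> \<in> N" by (auto simp: smult_0 subset_iff)
  with s show "csub V N" by (auto simp: csub_def)
next
  assume "csub V N"
  then show "submodule N complex_ring V"
    by (intro submoduleI) (auto simp: csub_def minus_eq_smult subset_iff)
qed

lemma csub_carrier: "csub V (carrier V)"
  by (simp add: csub_def zero_cl add_cl smult_cl)

lemma csub_zero: "csub V {\<zero>}"
  by (simp add: csub_def smult_zero)

lemma csub_Inter: "\<lbrakk>\<And>N. N \<in> S \<Longrightarrow> csub V N; S \<noteq> {}\<rbrakk> \<Longrightarrow> csub V (\<Inter>S)"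
  unfolding csub_def by blast

lemma csub_preimage:
  assumes "complex_space W" "f \<in> linmap V W" "csub W N"
  shows "csub V {v \<in> carrier V. f v \<in> N}"
  using linmapD[OF assms(2)] csubD[OF assms(3)] linmap_zero[OF _ assms(1,2)]
  by (auto simp: csub_def zero_cl add_cl smult_cl complex_space_axioms)

lemma csub_image:
  assumes "complex_space W" "f \<in> linmap V W" "csub V N"
  shows "csub W (f ` N)"
  unfolding csub_def
proof (intro conjI allI ballI)
  note f = linmapD[OF assms(2)] and N = csubD[OF assms(3)]
  show "f ` N \<subseteq> carrier W" using f N by auto
  show "\<zero>\<^bsub>W\<^esub> \<in> f ` N"
    using N linmap_zero[OF complex_space_axioms assms(1,2)] by (metis image_eqI)
  show "x \<oplus>\<^bsub>W\<^esub> y \<in> f ` N" if "x \<in> f ` N" "y \<in> f ` N" for x y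
    using that f(2)[symmetric] N by auto
  show "c \<odot>\<^bsub>W\<^esub> x \<in> f ` N" if "x \<in> f ` N" for x c
    using that f(3)[symmetric] N by auto
qed

lemma csub_kernel:
  assumes "complex_space W" "f \<in> linmap V W"
  shows "csub V {v \<in> carrier V. f v = \<zero>\<^bsub>W\<^esub>}"
  using csub_preimage[OF assms complex_space.csub_zero[OF assms(1)]] by simp

lemma csub_equalizer:
  assumes "complex_space W" "f \<in> linmap V W" "g \<in> linmap V W"
  shows "csub V {v \<in> carrier V. f v = g v}"
  using linmapD[OF assms(2)] linmapD[OF assms(3)]
    linmap_zero[OF complex_space_axioms assms(1,2)] linmap_zero[OF complex_space_axioms assms(1,3)]
  by (simp add: csub_def zero_cl add_cl smult_cl)

lemma gen_image:
  assumes "complex_space W" "f \<in> linmap V W" "f ` carrier V = carrier W" "generates V B"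
  shows "generates W (f ` B)"
  unfolding generates_def
proof (intro conjI allI impI)
  show "finite (f ` B)" "f ` B \<subseteq> carrier W" using assms by (auto simp: generates_def)
  fix N assume N: "csub W N \<and> f ` B \<subseteq> N"
  then have "carrier V \<subseteq> {v \<in> carrier V. f v \<in> N}"
    using assms csub_preimage[of W f N] unfolding generates_def by blast
  then show "carrier W \<subseteq> N" unfolding assms(3)[symmetric] by blast
qed

lemma finsum_in_csub:
  assumes "csub V N" "finite A" "\<And>a. a \<in> A \<Longrightarrow> f a \<in> N"
  shows "(\<Oplus>a\<in>A. f a) \<in> N"
  using assms(2,3)
proof (induction A rule: finite_induct)
  case empty
  then show ?case using csubD(2)[OF assms(1)] by simp
next
  case (insert a A)
  then show ?case using csubD[OF assms(1)] by (subst finsum_insert) auto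
qed

lemma csub_combinations:
  assumes "finite B" "B \<subseteq> carrier V"
  shows "csub V (range (\<lambda>c. \<Oplus>b\<in>B. c b \<odot> b))" (is "csub V ?N")
proof -
  have cl: "(\<lambda>b. c b \<odot> b) \<in> B \<rightarrow> carrier V" for c
    using assms by (auto intro: smult_cl)
  have "(\<Oplus>b\<in>B. c b \<odot> b) \<oplus> (\<Oplus>b\<in>B. d b \<odot> b) = (\<Oplus>b\<in>B. (c b + d b) \<odot> b)" for c d
  proof -
    have "(\<Oplus>b\<in>B. (c b + d b) \<odot> b) = (\<Oplus>b\<in>B. c b \<odot> b \<oplus> d b \<odot> b)"
      using assms(2) cl by (intro finsum_cong') (auto simp: smult_add subset_iff add_cl smult_cl)
    then show ?thesis using finsum_addf[OF cl cl] by simp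
  qed
  moreover have "a \<odot> (\<Oplus>b\<in>B. c b \<odot> b) = (\<Oplus>b\<in>B. (a * c b) \<odot> b)" for a c
  proof -
    have "(\<Oplus>b\<in>B. (a * c b) \<odot> b) = (\<Oplus>b\<in>B. a \<odot> (c b \<odot> b))"
      using assms(2) cl by (intro finsum_cong') (auto simp: smult_smult subset_iff smult_cl)
    then show ?thesis using finsum_smult_ldistr[OF assms(1) _ cl, of a] by simp
  qed
  moreover have "(\<Oplus>b\<in>B. 0 \<odot> b) = (\<Oplus>b\<in>B. \<zero>)"
    using assms(2) by (intro finsum_cong') (auto simp: smult_0 subset_iff zero_cl)
  then have "\<zero> = (\<Oplus>b\<in>B. 0 \<odot> b)" by simp
  ultimately show ?thesis
    unfolding csub_def using finsum_closed[OF cl] by fast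
qed

text \<open>The combinations of B form a subspace that contains B, and every subspace that contains
  B contains them.\<close>

lemma gen_iff_combinations:
  assumes "finite B" "B \<subseteq> carrier V"
  shows "generates V B \<longleftrightarrow> (\<forall>v\<in>carrier V. \<exists>c. v = (\<Oplus>b\<in>B. c b \<odot> b))"
proof
  assume g: "generates V B"
  have "b \<in> range (\<lambda>c. \<Oplus>b\<in>B. c b \<odot> b)" if b: "b \<in> B" for b
  proof -
    have "(\<Oplus>a\<in>B. (if a = b then 1 else 0) \<odot> a) = (\<Oplus>a\<in>B. if b = a then a else \<zero>)"
      using assms b by (intro finsum_cong') (auto simp: smult_1 smult_0 subset_iff zero_cl)
    also have "\<dots> = b" using b assms by (intro finsum_singleton) auto
    finally have eq: "b = (\<Oplus>a\<in>B. (if a = b then 1 else 0) \<odot> a)" by (rule sym)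
    show ?thesis by (rule range_eqI) (rule eq)
  qed
  then have "carrier V \<subseteq> range (\<lambda>c. \<Oplus>b\<in>B. c b \<odot> b)"
    using g csub_combinations[OF assms] unfolding generates_def by blast
  then show "\<forall>v\<in>carrier V. \<exists>c. v = (\<Oplus>b\<in>B. c b \<odot> b)" by blast
next
  assume r: "\<forall>v\<in>carrier V. \<exists>c. v = (\<Oplus>b\<in>B. c b \<odot> b)"
  show "generates V B"
    unfolding generates_def
  proof (intro conjI assms allI impI subsetI)
    fix N v assume N: "csub V N \<and> B \<subseteq> N" and "v \<in> carrier V"
    with r obtain c where "v = (\<Oplus>b\<in>B. c b \<odot> b)" by blast
    with N show "v \<in> N" using csubD(4)[of V N] by (auto intro!: finsum_in_csub assms(1))
  qed
qed

text \<open>A relation among the generators makes one of them redundant in the image.\<close>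

lemma gen_image_kernel:
  assumes W: "complex_space W" and f: "f \<in> linmap V W" and surj: "f ` carrier V = carrier W"
    and B: "generates V B" and u: "u \<in> carrier V" "u \<noteq> \<zero>" "f u = \<zero>\<^bsub>W\<^esub>"
  shows "\<exists>C. generates W C \<and> card C < card B"
proof -
  have fin: "finite B" and sub: "B \<subseteq> carrier V" using B by (auto simp: generates_def)
  obtain c where c: "u = (\<Oplus>b\<in>B. c b \<odot> b)"
    using B u(1) gen_iff_combinations[OF fin sub] by blast
  obtain b where b: "b \<in> B" "c b \<noteq> 0"
  proof (rule ccontr)
    assume "\<not> thesis"
    then have "\<And>b. b \<in> B \<Longrightarrow> c b = 0" using that by blast
    then have "u = (\<Oplus>b\<in>B. \<zero>)"
      unfolding c using sub by (intro finsum_cong') (auto simp: smult_0 zero_cl subset_iff)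
    with u(2) show False by simp
  qed
  have u': "u = c b \<odot> b \<oplus> (\<Oplus>b\<in>B - {b}. c b \<odot> b)" (is "_ = _ \<oplus> ?r")
    unfolding c using b fin sub
    by (subst (1) insert_Diff[OF b(1), symmetric], subst finsum_insert)
      (auto intro!: smult_cl)
  have r: "?r \<in> carrier V" using sub by (auto intro!: finsum_closed smult_cl)
  have bV: "b \<in> carrier V" using b sub by auto
  have "generates W (f ` (B - {b}))"
    unfolding generates_def
  proof (intro conjI allI impI)
    show "finite (f ` (B - {b}))" "f ` (B - {b}) \<subseteq> carrier W" using fin sub surj by auto
    fix N assume N: "csub W N \<and> f ` (B - {b}) \<subseteq> N"
    \<comment> \<open>This subspace contains u, whose image is zero, and every generator except b.
      The coefficient \<open>c b\<close> is invertible, so the relation for u forces b into it as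
      well.\<close>
    let ?P = "{v \<in> carrier V. f v \<in> N}"
    have P: "csub V ?P" using N by (intro csub_preimage[OF W f]) auto
    have uP: "u \<in> ?P" using N u by (auto simp: csub_def)
    have "a \<in> ?P" if "a \<in> B - {b}" for a using that N sub by blast
    then have "?r \<in> ?P" by (intro finsum_in_csub[OF P] csubD(4)[OF P]) (simp_all add: fin)
    then have "u \<oplus> (-1) \<odot> ?r \<in> ?P" using csubD(3,4)[OF P] uP by blast
    moreover have "u \<oplus> (-1) \<odot> ?r = c b \<odot> b"
      by (subst u') (rule add_smult_m1_cancel[OF smult_cl[OF bV] r])
    ultimately have "c b \<odot> b \<in> ?P" by (simp only:)
    then have "(1 / c b) \<odot> (c b \<odot> b) \<in> ?P" by (rule csubD(4)[OF P])
    then have "b \<in> ?P" using b(2) bV by (simp add: smult_smult smult_1)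
    then have "B \<subseteq> ?P" using N sub by auto
    then have "carrier V \<subseteq> ?P" by (rule genD[OF B P])
    then show "carrier W \<subseteq> N" unfolding surj[symmetric] by blast
  qed
  moreover have "card (f ` (B - {b})) < card B"
    using card_image_le[of "B - {b}" f] card_Diff1_less[OF fin b(1)] fin by simp
  ultimately show ?thesis by blast
qed

section \<open>Complements, projections and splittings\<close>

lemma add_combination:
  assumes "x \<in> carrier V" "x' \<in> carrier V" "y \<in> carrier V" "y' \<in> carrier V"
  shows "x \<oplus> y \<oplus> (x' \<oplus> y') = x \<oplus> x' \<oplus> (y \<oplus> y')"
  using assms by (simp add: M.a_ac)

lemma csub_sum:
  assumes "csub V M" "csub V N"
  shows "csub V {m \<oplus> n | m n. m \<in> M \<and> n \<in> N}"
  unfolding csub_def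
proof (intro conjI allI ballI)
  note M = csubD[OF assms(1)] and N = csubD[OF assms(2)]
  show "{m \<oplus> n | m n. m \<in> M \<and> n \<in> N} \<subseteq> carrier V" using M N by (auto intro: add_cl)
  show "\<zero> \<in> {m \<oplus> n | m n. m \<in> M \<and> n \<in> N}"
    using M(2) N(2) M.r_zero[OF zero_cl, symmetric] by blast
  fix x y assume "x \<in> {m \<oplus> n | m n. m \<in> M \<and> n \<in> N}" "y \<in> {m \<oplus> n | m n. m \<in> M \<and> n \<in> N}"
  then obtain m n m' n' where "x = m \<oplus> n" "y = m' \<oplus> n'" "m \<in> M" "m' \<in> M" "n \<in> N" "n' \<in> N"
    by blast
  moreover have "x \<oplus> y = (m \<oplus> m') \<oplus> (n \<oplus> n')"
    using calculation M(5) N(5) by (simp add: add_combination)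
  ultimately show "x \<oplus> y \<in> {m \<oplus> n | m n. m \<in> M \<and> n \<in> N}" using M(3) N(3) by blast
next
  note M = csubD[OF assms(1)] and N = csubD[OF assms(2)]
  fix x c assume "x \<in> {m \<oplus> n | m n. m \<in> M \<and> n \<in> N}"
  then obtain m n where "x = m \<oplus> n" "m \<in> M" "n \<in> N" by blast
  moreover have "c \<odot> x = c \<odot> m \<oplus> c \<odot> n"
    using calculation M(5) N(5) by (simp add: smult_add_right)
  ultimately show "c \<odot> x \<in> {m \<oplus> n | m n. m \<in> M \<and> n \<in> N}" using M(4) N(4) by blast
qed

lemma csub_line: "v \<in> carrier V \<Longrightarrow> csub V (range (\<lambda>c. c \<odot> v))"
  unfolding csub_def
  by (auto simp: smult_cl smult_add[symmetric] smult_smult image_iff) (metis smult_0)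

text \<open>M grows by one vector of B at a time. A vector b outside M + N contributes its line; if
  m + c b lay in N with c nonzero, solving for b would put b into M + N, so the intersection with N
  stays trivial.\<close>

lemma complement_exists:
  assumes N: "csub V N" and "finite B" "B \<subseteq> carrier V"
  shows "\<exists>M. csub V M \<and> M \<inter> N = {\<zero>} \<and> B \<subseteq> {m \<oplus> n | m n. m \<in> M \<and> n \<in> N}"
  using assms(2,3)
proof (induction B rule: finite_induct)
  case empty
  then show ?case using csub_zero csubD(2)[OF N] by (intro exI[of _ "{\<zero>}"]) auto
next
  case (insert b B)
  note cN = csubD[OF N]
  from insert.prems have "B \<subseteq> carrier V" by simp
  from insert.IH[OF this] obtain M where M: "csub V M" "M \<inter> N = {\<zero>}"
    "B \<subseteq> {m \<oplus> n | m n. m \<in> M \<and> n \<in> N}" by (elim exE conjE)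
  note cM = csubD[OF M(1)]
  have b: "b \<in> carrier V" using insert by auto
  show ?case
  proof (cases "b \<in> {m \<oplus> n | m n. m \<in> M \<and> n \<in> N}")
    case True
    with M show ?thesis by blast
  next
    case False
    let ?M = "{m \<oplus> n | m n. m \<in> M \<and> n \<in> range (\<lambda>c. c \<odot> b)}"
    have "x = \<zero>" if "x \<in> ?M" "x \<in> N" for x
    proof -
      from that(1) obtain m c where x: "x = m \<oplus> c \<odot> b" and m: "m \<in> M" by auto
      have mV: "m \<in> carrier V" and xV: "x \<in> carrier V" using m cM that cN by auto
      show ?thesis
      proof (cases "c = 0")
        case True
        then have "x = m" using x b mV by (simp add: smult_0)
        with m M(2) that show ?thesis by blast
      next
        case c: False
        have "x \<oplus> (-1) \<odot> m = c \<odot> b"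
          unfolding x using mV b by (simp add: M.a_comm[of m] M.a_assoc smult_cl smult_m1_add)
        then have "(1 / c) \<odot> (x \<oplus> (-1) \<odot> m) = b"
          using c b by (simp add: smult_smult smult_1)
        then have "b = (1 / c) \<odot> ((-1) \<odot> m) \<oplus> (1 / c) \<odot> x"
          using mV xV by (simp add: smult_add_right smult_cl M.a_comm)
        then have "b \<in> {m \<oplus> n | m n. m \<in> M \<and> n \<in> N}"
          using cM(4) cN(4) m that by blast
        with False show ?thesis by blast
      qed
    qed
    moreover have cM': "csub V ?M" by (rule csub_sum[OF M(1) csub_line[OF b]])
    ultimately have "?M \<inter> N = {\<zero>}" using csubD(2)[OF cM'] cN(2) by blast
    moreover have "M \<subseteq> ?M"
    proof
      fix m assume "m \<in> M"
      moreover have "m = m \<oplus> 0 \<odot> b" using \<open>m \<in> M\<close> cM(5) b by (simp add: smult_0)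
      ultimately show "m \<in> ?M" by blast
    qed
    then have "B \<subseteq> {m \<oplus> n | m n. m \<in> ?M \<and> n \<in> N}" using M(3) by blast
    moreover have "b \<in> {m \<oplus> n | m n. m \<in> ?M \<and> n \<in> N}"
    proof -
      have "b = \<zero> \<oplus> 1 \<odot> b" "b = b \<oplus> \<zero>" using b by (simp_all add: smult_1)
      then show ?thesis using cM(2) cN(2) by blast
    qed
    ultimately show ?thesis using cM' by blast
  qed
qed

text \<open>The map takes the N-component along a complement M of N.\<close>

lemma projection_exists:
  assumes N: "csub V N" and B: "generates V B"
  shows "\<exists>p\<in>linmap V V. p ` carrier V \<subseteq> N \<and> (\<forall>v\<in>N. p v = v)"
proof -
  have "finite B" "B \<subseteq> carrier V" using B by (simp_all add: generates_def)
  from complement_exists[OF N this] obtain M where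
    M: "csub V M" "M \<inter> N = {\<zero>}" "B \<subseteq> {m \<oplus> n | m n. m \<in> M \<and> n \<in> N}"
    by (elim exE conjE)
  note cM = csubD[OF M(1)] and cN = csubD[OF N]
  have all: "\<exists>m\<in>M. \<exists>n\<in>N. v = m \<oplus> n" if "v \<in> carrier V" for v
  proof -
    have "carrier V \<subseteq> {m \<oplus> n | m n. m \<in> M \<and> n \<in> N}"
      by (rule genD[OF B csub_sum[OF M(1) N] M(3)])
    from subsetD[OF this that] show ?thesis by blast
  qed
  have uniq: "n = n'" if "m \<in> M" "m' \<in> M" "n \<in> N" "n' \<in> N" "m \<oplus> n = m' \<oplus> n'" for m m' n n'
  proof -
    have V: "m \<in> carrier V" "m' \<in> carrier V" "n \<in> carrier V" "n' \<in> carrier V"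
      using that cM cN by auto
    \<comment> \<open>Adding \<open>(-1) \<odot> m \<oplus> (-1) \<odot> n'\<close> to both sides of
      the equation shows that n - n' equals m' - m, which lies in both M and N.\<close>
    have "n \<oplus> (-1) \<odot> n' = (m \<oplus> n) \<oplus> ((-1) \<odot> m \<oplus> (-1) \<odot> n')"
      using V by (subst add_combination) (simp_all add: smult_cl smult_m1_add)
    also have "\<dots> = m' \<oplus> (-1) \<odot> m"
      unfolding that(5) using V by (subst add_combination) (simp_all add: smult_cl smult_m1_add)
    finally have e: "n \<oplus> (-1) \<odot> n' = m' \<oplus> (-1) \<odot> m" .
    have "n \<oplus> (-1) \<odot> n' \<in> M" unfolding e by (intro cM that)
    moreover have "n \<oplus> (-1) \<odot> n' \<in> N" by (intro cN that)
    ultimately have "n \<oplus> (-1) \<odot> n' \<in> M \<inter> N" by (rule IntI)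
    then have "n \<oplus> (-1) \<odot> n' = \<zero>" unfolding M(2) by (rule singletonD)
    then show ?thesis by (rule eqI_diff[OF V(3,4)])
  qed
  define p where "p v = (SOME n. n \<in> N \<and> (\<exists>m\<in>M. v = m \<oplus> n))" for v
  have p: "p v = n" if "m \<in> M" "n \<in> N" "v = m \<oplus> n" for v m n
    unfolding p_def
  proof (rule some_equality)
    show "n \<in> N \<and> (\<exists>m\<in>M. v = m \<oplus> n)" using that by blast
    show "n' = n" if "n' \<in> N \<and> (\<exists>m\<in>M. v = m \<oplus> n')" for n'
      using that uniq \<open>m \<in> M\<close> \<open>n \<in> N\<close> \<open>v = m \<oplus> n\<close> by metis
  qed
  have "p \<in> linmap V V"
  proof (rule linmapI)
    fix v assume v: "v \<in> carrier V"
    then obtain m n where v': "m \<in> M" "n \<in> N" "v = m \<oplus> n" using all by blast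
    then show "p v \<in> carrier V" using p cN by simp
    show "p (c \<odot> v) = c \<odot> p v" for c
    proof -
      have "c \<odot> v = c \<odot> m \<oplus> c \<odot> n" using v' cM(5) cN(5) by (simp add: smult_add_right)
      then show ?thesis using p v' cM(4) cN(4) by metis
    qed
    fix w assume "w \<in> carrier V"
    then obtain m' n' where w': "m' \<in> M" "n' \<in> N" "w = m' \<oplus> n'" using all by blast
    have "v \<oplus> w = (m \<oplus> m') \<oplus> (n \<oplus> n')" using v' w' cM(5) cN(5) by (simp add: add_combination)
    then show "p (v \<oplus> w) = p v \<oplus> p w" using p v' w' cM(3) cN(3) by metis
  qed
  moreover have "p ` carrier V \<subseteq> N" using p all by fastforce
  moreover have "p v = v" if "v \<in> N" for v
    using p[of "\<zero>" v v] that cM(2) cN(5) by simp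
  ultimately show ?thesis by blast
qed

end

text \<open>The universal property of a surjection: h takes the value of g at a chosen preimage, and
  two preimages differ by an element of the kernel of q, where g vanishes.\<close>

lemma linmap_factor:
  assumes V: "complex_space V" and W: "complex_space W"
    and q: "q \<in> linmap V Q" "q ` carrier V = carrier Q" and Q: "complex_space Q"
    and g: "g \<in> linmap V W"
    and ker: "\<And>v. \<lbrakk>v \<in> carrier V; q v = \<zero>\<^bsub>Q\<^esub>\<rbrakk> \<Longrightarrow> g v = \<zero>\<^bsub>W\<^esub>"
  shows "\<exists>h\<in>linmap Q W. \<forall>v\<in>carrier V. h (q v) = g v"
proof -
  interpret V: complex_space V by fact
  interpret W: complex_space W by fact
  interpret Q: complex_space Q by fact
  define h where "h x = g (SOME v. v \<in> carrier V \<and> q v = x)" for x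
  have h: "h (q v) = g v" if v: "v \<in> carrier V" for v
  proof -
    define v' where "v' = (SOME v'. v' \<in> carrier V \<and> q v' = q v)"
    have v': "v' \<in> carrier V" "q v' = q v"
      using someI[of "\<lambda>v'. v' \<in> carrier V \<and> q v' = q v" v] v by (auto simp: v'_def)
    have "q (v' \<oplus>\<^bsub>V\<^esub> (-1) \<odot>\<^bsub>V\<^esub> v) = \<zero>\<^bsub>Q\<^esub>"
      using v v' by (simp add: linmapD[OF q(1)] V.smult_cl Q.smult_m1_add)
    then have "g (v' \<oplus>\<^bsub>V\<^esub> (-1) \<odot>\<^bsub>V\<^esub> v) = \<zero>\<^bsub>W\<^esub>"
      using ker v v' by (simp add: V.smult_cl V.add_cl)
    then have "g v' \<oplus>\<^bsub>W\<^esub> (-1) \<odot>\<^bsub>W\<^esub> g v = \<zero>\<^bsub>W\<^esub>"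
      using v v' by (simp add: linmapD[OF g] V.smult_cl)
    then have "g v' = g v"
      by (rule W.eqI_diff[OF linmapD(1)[OF g v'(1)] linmapD(1)[OF g v]])
    then show ?thesis by (simp add: h_def v'_def)
  qed
  have "h \<in> linmap Q W"
  proof (rule linmapI)
    fix x assume "x \<in> carrier Q"
    then obtain v where v: "v \<in> carrier V" "x = q v" using q(2) by auto
    then show "h x \<in> carrier W" using h linmapD(1)[OF g] by simp
    show "h (c \<odot>\<^bsub>Q\<^esub> x) = c \<odot>\<^bsub>W\<^esub> h x" for c
      using v h[of "c \<odot>\<^bsub>V\<^esub> v"] h[of v] by (simp add: linmapD[OF g] linmapD[OF q(1)] V.smult_cl)
    fix y assume "y \<in> carrier Q"
    then obtain w where w: "w \<in> carrier V" "y = q w" using q(2) by auto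
    then show "h (x \<oplus>\<^bsub>Q\<^esub> y) = h x \<oplus>\<^bsub>W\<^esub> h y"
      using v h[of "v \<oplus>\<^bsub>V\<^esub> w"] h[of v] h[of w]
      by (simp add: linmapD[OF g] linmapD[OF q(1)] V.add_cl)
  qed
  with h show ?thesis by blast
qed

text \<open>Cancels an injective f from the left of a map with values in its image. With g the
  identity this inverts an isomorphism, with g a projection onto the image it gives a retraction,
  and with g another embedding it factors that embedding through f.\<close>

lemma linmap_inverse:
  assumes V: "complex_space V" and W: "complex_space W" and f: "f \<in> linmap V W"
    and inj: "inj_on f (carrier V)" and N: "csub W N" "N \<subseteq> f ` carrier V"
    and g: "g \<in> linmap T W" "g ` carrier T \<subseteq> N" and T: "complex_space T"
  shows "(\<lambda>x. inv_into (carrier V) f (g x)) \<in> linmap T V"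
proof -
  interpret V: complex_space V by fact
  interpret W: complex_space W by fact
  interpret T: complex_space T by fact
  let ?h = "\<lambda>x. inv_into (carrier V) f (g x)"
  have h: "?h x \<in> carrier V" "f (?h x) = g x" if "x \<in> carrier T" for x
    using that g N(2) inv_into_into[of "g x" f "carrier V"] f_inv_into_f[of "g x" f "carrier V"]
    by blast+
  note eq = inj_onD[OF inj]
  show ?thesis
  proof (rule linmapI)
    fix x assume x: "x \<in> carrier T"
    then show "?h x \<in> carrier V" by (rule h)
    show "?h (c \<odot>\<^bsub>T\<^esub> x) = c \<odot>\<^bsub>V\<^esub> ?h x" for c
      using x h h[OF T.smult_cl[OF x, of c]]
      by (intro eq) (simp_all add: linmapD[OF f] linmapD[OF g(1)] V.smult_cl)
    fix y assume y: "y \<in> carrier T"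
    show "?h (x \<oplus>\<^bsub>T\<^esub> y) = ?h x \<oplus>\<^bsub>V\<^esub> ?h y"
      using x y h h[OF T.add_cl[OF x y]]
      by (intro eq) (simp_all add: linmapD[OF f] linmapD[OF g(1)] V.add_cl)
  qed
qed

text \<open>The splitting is only linear, not equivariant, but it is enough to make the tensor product
  exact.\<close>

lemma linear_splitting:
  assumes U: "complex_space U" and V: "complex_space V" and W: "complex_space W"
    and B: "generates V B" and f: "f \<in> linmap U V" and g: "g \<in> linmap V W"
    and inj: "inj_on f (carrier U)" and surj: "g ` carrier V = carrier W"
    and exact: "f ` carrier U = {v \<in> carrier V. g v = \<zero>\<^bsub>W\<^esub>}"
  shows "\<exists>r\<in>linmap V U. \<exists>s\<in>linmap W V.
    (\<forall>u\<in>carrier U. r (f u) = u) \<and> (\<forall>v\<in>carrier V. f (r v) \<oplus>\<^bsub>V\<^esub> s (g v) = v)"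
proof -
  interpret U: complex_space U by fact
  interpret V: complex_space V by fact
  interpret W: complex_space W by fact
  have N: "csub V (f ` carrier U)" by (rule U.csub_image[OF V f U.csub_carrier])
  obtain p where p: "p \<in> linmap V V" "p ` carrier V \<subseteq> f ` carrier U" "\<forall>v\<in>f ` carrier U. p v = v"
    using V.projection_exists[OF N B] by blast
  define r where "r v = inv_into (carrier U) f (p v)" for v
  have r: "r \<in> linmap V U"
    unfolding r_def by (rule linmap_inverse[OF U V f inj N _ p(1,2) V]) simp
  have rf: "r (f u) = u" if "u \<in> carrier U" for u
    using that p(3) inj by (simp add: r_def)
  \<comment> \<open>The map v - f (r v) vanishes on the kernel of g, which is the image of f, so it
    descends along g to the section s.\<close>
  have "(\<lambda>v. v \<oplus>\<^bsub>V\<^esub> (-1) \<odot>\<^bsub>V\<^esub> f (r v)) \<in> linmap V V"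
    by (rule linmapI)
      (simp_all add: linmapD[OF r] linmapD[OF f] V.add_cl V.smult_cl V.smult_add_right
         V.add_combination V.smult_smult mult.commute)
  moreover have "v \<oplus>\<^bsub>V\<^esub> (-1) \<odot>\<^bsub>V\<^esub> f (r v) = \<zero>\<^bsub>V\<^esub>" if "v \<in> carrier V" "g v = \<zero>\<^bsub>W\<^esub>" for v
  proof -
    from that exact obtain u where "u \<in> carrier U" "v = f u" by blast
    then show ?thesis using rf linmapD(1)[OF f] by (simp add: V.smult_m1_add)
  qed
  ultimately obtain s where s: "s \<in> linmap W V"
    "\<forall>v\<in>carrier V. s (g v) = v \<oplus>\<^bsub>V\<^esub> (-1) \<odot>\<^bsub>V\<^esub> f (r v)"
    using linmap_factor[OF V V g surj W] by blast
  have "f (r v) \<oplus>\<^bsub>V\<^esub> s (g v) = v" if "v \<in> carrier V" for v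
    using that s(2) linmapD(1)[OF f] linmapD(1)[OF r] by (simp add: V.add_m1_eq)
  with r s rf show ?thesis by blast
qed

section \<open>Representations\<close>

text \<open>Finite dimension is left out because the tensor product is a quotient of the free space
  on all pairs, which is in general infinite-dimensional.\<close>

locale lin_rep = G?: group G + V?: complex_space V
  for G :: "('g, 'm) monoid_scheme" (structure) and V :: "('g, 'a) rep" (structure) +
  assumes act_cl: "\<lbrakk>g \<in> carrier G; v \<in> carrier V\<rbrakk> \<Longrightarrow> act V g v \<in> carrier V"
    and act_add: "\<lbrakk>g \<in> carrier G; v \<in> carrier V; w \<in> carrier V\<rbrakk> \<Longrightarrow>
      act V g (v \<oplus>\<^bsub>V\<^esub> w) = act V g v \<oplus>\<^bsub>V\<^esub> act V g w"
    and act_smult: "\<lbrakk>g \<in> carrier G; v \<in> carrier V\<rbrakk> \<Longrightarrow>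
      act V g (c \<odot>\<^bsub>V\<^esub> v) = c \<odot>\<^bsub>V\<^esub> act V g v"
    and act_one: "v \<in> carrier V \<Longrightarrow> act V \<one>\<^bsub>G\<^esub> v = v"
    and act_mult: "\<lbrakk>g \<in> carrier G; h \<in> carrier G; v \<in> carrier V\<rbrakk> \<Longrightarrow>
      act V (g \<otimes>\<^bsub>G\<^esub> h) v = act V g (act V h v)"

lemma fd_rep_iff: "fd_rep G V \<longleftrightarrow> lin_rep G V \<and> (\<exists>B. generates V B)"
proof -
  have "(\<exists>B. generates V B) \<longleftrightarrow> (\<exists>B. finite B \<and> B \<subseteq> carrier V \<and>
      (\<forall>v\<in>carrier V. \<exists>c. v = (\<Oplus>\<^bsub>V\<^esub>b\<in>B. c b \<odot>\<^bsub>V\<^esub> b)))" if V: "complex_space V"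
  proof (intro ex_cong1)
    fix B
    have "generates V B \<Longrightarrow> finite B \<and> B \<subseteq> carrier V" by (simp add: generates_def)
    then show "generates V B \<longleftrightarrow> finite B \<and> B \<subseteq> carrier V \<and>
        (\<forall>v\<in>carrier V. \<exists>c. v = (\<Oplus>\<^bsub>V\<^esub>b\<in>B. c b \<odot>\<^bsub>V\<^esub> b))"
      using complex_space.gen_iff_combinations[OF V] by (cases "finite B \<and> B \<subseteq> carrier V") auto
  qed
  then show ?thesis
    unfolding fd_rep_def lin_rep_def fd_rep_axioms_def lin_rep_axioms_def complex_space_def
    by auto
qed

lemma fd_repD:
  assumes "fd_rep G V"
  shows "lin_rep G V" "complex_space V" "\<exists>B. generates V B"
  using assms by (auto simp: fd_rep_iff lin_rep_def)

lemma rep_hom_iff: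
  "f \<in> rep_hom G V W \<longleftrightarrow> f \<in> linmap V W \<and>
     (\<forall>g\<in>carrier G. \<forall>v\<in>carrier V. f (act V g v) = act W g (f v))"
  by (auto simp: rep_hom_def linmap_def)

lemma rep_homD:
  assumes "f \<in> rep_hom G V W" "v \<in> carrier V"
  shows "f v \<in> carrier W"
    and "v' \<in> carrier V \<Longrightarrow> f (v \<oplus>\<^bsub>V\<^esub> v') = f v \<oplus>\<^bsub>W\<^esub> f v'"
    and "f (c \<odot>\<^bsub>V\<^esub> v) = c \<odot>\<^bsub>W\<^esub> f v"
    and "g \<in> carrier G \<Longrightarrow> f (act V g v) = act W g (f v)"
  using assms by (auto simp: rep_hom_def)

lemma rep_hom_linmap: "f \<in> rep_hom G V W \<Longrightarrow> f \<in> linmap V W"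
  by (simp add: rep_hom_iff)

lemma rep_hom_comp: "\<lbrakk>f \<in> rep_hom G U V; g \<in> rep_hom G V W\<rbrakk> \<Longrightarrow> g \<circ> f \<in> rep_hom G U W"
  by (auto simp: rep_hom_iff linmap_comp linmapD(1))

text \<open>Each axiom is closure or an equation, so it passes along a surjection that respects the
  operations. This makes quotients and transported copies into representations. The condition on
  zero is separate because it can be derived from linearity only once W is known to be a
  space.\<close>

lemma lin_rep_image:
  assumes "lin_rep G V" and f: "f \<in> rep_hom G V W" and surj: "f ` carrier V = carrier W"
    and zero: "f \<zero>\<^bsub>V\<^esub> = \<zero>\<^bsub>W\<^esub>"
  shows "lin_rep G W"
proof -
  interpret V: lin_rep G V by fact
  note fh [simp] = rep_homD(2-4)[OF f, symmetric] zero[symmetric]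
  have ex: "\<exists>v\<in>carrier V. w = f v" if "w \<in> carrier W" for w using that surj by auto
  have cl: "v \<in> carrier V \<Longrightarrow> f v \<in> carrier W" for v using surj by auto
  note [simp] = cl V.add_cl V.smult_cl V.zero_cl V.act_cl
  have "complex_space W"
    by (rule complex_spaceI)
      (auto dest!: ex simp: V.M.a_ac V.smult_add V.smult_add_right V.smult_1 V.smult_smult
        V.smult_m1_add V.smult_m1_add')
  moreover have "lin_rep_axioms G W"
    by unfold_locales
      (auto dest!: ex simp: V.act_add V.act_smult V.act_one V.act_mult)
  ultimately show ?thesis by (simp add: lin_rep_def V.G.is_group)
qed

lemma fd_rep_image:
  assumes "fd_rep G V" "f \<in> rep_hom G V W" "f ` carrier V = carrier W" "f \<zero>\<^bsub>V\<^esub> = \<zero>\<^bsub>W\<^esub>"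
  shows "fd_rep G W"
proof -
  note V = fd_repD[OF assms(1)]
  have W: "lin_rep G W" by (rule lin_rep_image[OF V(1) assms(2-4)])
  obtain B where "generates V B" using V(3) by blast
  then have "generates W (f ` B)"
    using W by (intro complex_space.gen_image[OF V(2) _ rep_hom_linmap[OF assms(2)] assms(3)])
      (simp_all add: lin_rep_def)
  with W show ?thesis by (auto simp: fd_rep_iff)
qed

lemma rep_hom_zero:
  "\<lbrakk>complex_space V; complex_space W; f \<in> rep_hom G V W\<rbrakk> \<Longrightarrow> f \<zero>\<^bsub>V\<^esub> = \<zero>\<^bsub>W\<^esub>"
  using linmap_zero rep_hom_linmap by blast

section \<open>Subrepresentations and quotients\<close>

definition rep_sub :: "('g, 'm) monoid_scheme \<Rightarrow> ('g, 'a) rep \<Rightarrow> 'a set \<Rightarrow> bool" where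
  "rep_sub G V N \<longleftrightarrow> csub V N \<and> (\<forall>g\<in>carrier G. \<forall>v\<in>N. act V g v \<in> N)"

definition sub_rep :: "('g, 'a) rep \<Rightarrow> 'a set \<Rightarrow> ('g, 'a) rep" where
  "sub_rep V N = V\<lparr>carrier := N\<rparr>"

lemma sub_rep_simps [simp]:
  "carrier (sub_rep V N) = N" "\<zero>\<^bsub>sub_rep V N\<^esub> = \<zero>\<^bsub>V\<^esub>" "x \<oplus>\<^bsub>sub_rep V N\<^esub> y = x \<oplus>\<^bsub>V\<^esub> y"
  "c \<odot>\<^bsub>sub_rep V N\<^esub> x = c \<odot>\<^bsub>V\<^esub> x" "act (sub_rep V N) g x = act V g x"
  "sub_rep (sub_rep V N) M = sub_rep V M" "sub_rep V (carrier V) = V"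
  by (simp_all add: sub_rep_def)

lemma csub_space:
  assumes "complex_space V" "csub V N"
  shows "complex_space (sub_rep V N)"
proof -
  interpret complex_space V by fact
  note c = csubD[OF assms(2)]
  show ?thesis
    by (rule complex_spaceI)
      (auto simp: c smult_add smult_add_right smult_1 M.a_assoc smult_cl smult_m1_add'
        smult_smult intro: M.a_comm)
qed

text \<open>A linear projection p onto N carries generators of V to generators of N. If N is proper,
  some v - p v is a nonzero element of its kernel, and one generator can be saved.\<close>

lemma gen_sub:
  assumes V: "complex_space V" and N: "csub V N" and B: "generates V B"
  shows "\<exists>C. generates (sub_rep V N) C \<and> (N \<noteq> carrier V \<longrightarrow> card C < card B)"
proof -
  interpret complex_space V by fact
  note c = csubD[OF N]
  obtain p where p: "p \<in> linmap V V" "p ` carrier V \<subseteq> N" "\<forall>v\<in>N. p v = v"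
    using projection_exists[OF N B] by blast
  have p': "p \<in> linmap V (sub_rep V N)"
    using p(2) by (intro linmapI) (auto simp: linmapD[OF p(1)])
  have surj: "p ` carrier V = carrier (sub_rep V N)"
    using p(2,3) c(1) by (force simp: image_iff)
  note S = csub_space[OF V N]
  show ?thesis
  proof (cases "N = carrier V")
    case True
    then show ?thesis using gen_image[OF S p' surj B] by blast
  next
    case False
    then obtain v where v: "v \<in> carrier V" "v \<notin> N" using c(1) by blast
    let ?u = "v \<oplus>\<^bsub>V\<^esub> (-1) \<odot>\<^bsub>V\<^esub> p v"
    have pv: "p v \<in> N" "p v \<in> carrier V" using v p(2) c(5) by auto
    have u: "?u \<in> carrier V" using v pv by (simp add: add_cl smult_cl)
    have "?u \<noteq> \<zero>\<^bsub>V\<^esub>" using eqI_diff[OF v(1) pv(2)] v(2) pv(1) by auto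
    moreover have "p ?u = \<zero>\<^bsub>sub_rep V N\<^esub>"
      using v pv p(3) by (simp add: linmapD[OF p(1)] smult_cl smult_m1_add)
    ultimately show ?thesis using gen_image_kernel[OF S p' surj B u] by blast
  qed
qed

lemma fd_rep_sub:
  assumes "fd_rep G V" "rep_sub G V N"
  shows "fd_rep G (sub_rep V N)"
proof -
  interpret V: lin_rep G V using assms(1) by (rule fd_repD)
  have N: "csub V N" and inv: "\<And>g v. \<lbrakk>g \<in> carrier G; v \<in> N\<rbrakk> \<Longrightarrow> act V g v \<in> N"
    using assms(2) by (auto simp: rep_sub_def)
  note c = csubD(5)[OF N]
  have "lin_rep_axioms G (sub_rep V N)"
    by unfold_locales (auto simp: inv c V.act_add V.act_smult V.act_one V.act_mult)
  then show ?thesis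
    using csub_space[OF V.complex_space_axioms N] gen_sub[OF V.complex_space_axioms N]
      fd_repD(3)[OF assms(1)] by (auto simp: fd_rep_iff lin_rep_def V.G.is_group)
qed

lemma rep_sub_iff_submodule:
  "complex_space V \<Longrightarrow> rep_sub G V N \<longleftrightarrow>
     submodule N complex_ring V \<and> (\<forall>g\<in>carrier G. \<forall>v\<in>N. act V g v \<in> N)"
  by (simp add: rep_sub_def complex_space.submodule_iff_csub)

lemma irreducible_rep_iff:
  "irreducible_rep G V \<longleftrightarrow> fd_rep G V \<and> carrier V \<noteq> {\<zero>\<^bsub>V\<^esub>} \<and>
     (\<forall>N. rep_sub G V N \<longrightarrow> N = {\<zero>\<^bsub>V\<^esub>} \<or> N = carrier V)"
  unfolding irreducible_rep_def using rep_sub_iff_submodule[of V G] fd_repD(2)[of G V] by blast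

lemma rep_sub_preimage:
  assumes "lin_rep G V" "lin_rep G W" "f \<in> rep_hom G V W" "rep_sub G W N"
  shows "rep_sub G V {v \<in> carrier V. f v \<in> N}"
  using complex_space.csub_preimage[OF _ _ rep_hom_linmap[OF assms(3)], of N]
    assms rep_homD[OF assms(3)] lin_rep.act_cl[OF assms(1)]
  by (auto simp: rep_sub_def lin_rep_def)

lemma rep_sub_image:
  assumes "lin_rep G V" "lin_rep G W" "f \<in> rep_hom G V W" "rep_sub G V N"
  shows "rep_sub G W (f ` N)"
proof -
  have "csub W (f ` N)"
    using assms complex_space.csub_image[OF _ _ rep_hom_linmap[OF assms(3)], of N]
    by (auto simp: rep_sub_def lin_rep_def)
  moreover have "act W g (f v) = f (act V g v)" if "g \<in> carrier G" "v \<in> N" for g v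
    using that assms csubD(5)[of V N] rep_homD(4)[OF assms(3)] by (simp add: rep_sub_def)
  ultimately show ?thesis using assms(4) by (auto simp: rep_sub_def)
qed

lemma rep_sub_carrier: "lin_rep G V \<Longrightarrow> rep_sub G V (carrier V)"
  by (simp add: rep_sub_def lin_rep_def lin_rep_axioms_def complex_space.csub_carrier)

lemma quot_rep_simps [simp]:
  "carrier (quot_rep V N) = a_rcosets\<^bsub>V\<^esub> N" "\<zero>\<^bsub>quot_rep V N\<^esub> = N"
  "C \<oplus>\<^bsub>quot_rep V N\<^esub> D = C <+>\<^bsub>V\<^esub> D"
  "c \<odot>\<^bsub>quot_rep V N\<^esub> C = (\<Union>v\<in>C. N +>\<^bsub>V\<^esub> (c \<odot>\<^bsub>V\<^esub> v))"
  "act (quot_rep V N) g C = (\<Union>v\<in>C. N +>\<^bsub>V\<^esub> act V g v)"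
  by (simp_all add: quot_rep_def)

text \<open>Once the projection is seen to respect the coset operations, the axioms for the quotient
  are inherited from V through \<open>lin_rep_image\<close>.\<close>

lemma quot_rep_proj:
  assumes "lin_rep G V" "rep_sub G V N"
  defines "p \<equiv> \<lambda>v. N +>\<^bsub>V\<^esub> v"
  shows "p \<in> rep_hom G V (quot_rep V N)" "p ` carrier V = carrier (quot_rep V N)"
    "p \<zero>\<^bsub>V\<^esub> = \<zero>\<^bsub>quot_rep V N\<^esub>" "v \<in> carrier V \<Longrightarrow> p v = \<zero>\<^bsub>quot_rep V N\<^esub> \<longleftrightarrow> v \<in> N"
    "lin_rep G (quot_rep V N)"
proof -
  interpret V: lin_rep G V by fact
  have N: "csub V N" and inv: "\<And>g v. \<lbrakk>g \<in> carrier G; v \<in> N\<rbrakk> \<Longrightarrow> act V g v \<in> N"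
    using assms(2) by (auto simp: rep_sub_def)
  note c = csubD[OF N]
  have p: "x \<in> p v \<longleftrightarrow> (\<exists>n\<in>N. x = n \<oplus>\<^bsub>V\<^esub> v)" for x v
    by (simp add: p_def a_r_coset_def')
  have coset: "p (n \<oplus>\<^bsub>V\<^esub> v) = p v" if "n \<in> N" "v \<in> carrier V" for n v
  proof (intro equalityI subsetI)
    fix x assume "x \<in> p (n \<oplus>\<^bsub>V\<^esub> v)"
    then obtain m where "m \<in> N" "x = m \<oplus>\<^bsub>V\<^esub> (n \<oplus>\<^bsub>V\<^esub> v)" by (auto simp: p)
    then have "m \<oplus>\<^bsub>V\<^esub> n \<in> N" "x = (m \<oplus>\<^bsub>V\<^esub> n) \<oplus>\<^bsub>V\<^esub> v"
      using that c(3,5) by (auto simp: V.M.a_assoc)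
    then show "x \<in> p v" by (auto simp: p)
  next
    fix x assume "x \<in> p v"
    then obtain m where m: "m \<in> N" "x = m \<oplus>\<^bsub>V\<^esub> v" by (auto simp: p)
    let ?k = "m \<oplus>\<^bsub>V\<^esub> (-1) \<odot>\<^bsub>V\<^esub> n"
    have "?k \<in> N" using m that c by blast
    moreover have "x = ?k \<oplus>\<^bsub>V\<^esub> (n \<oplus>\<^bsub>V\<^esub> v)"
      using m that c(5) V.smult_m1_add[of n] V.smult_cl[of n]
      by (simp add: V.M.a_assoc V.M.a_comm[of "(-1) \<odot>\<^bsub>V\<^esub> n"] flip: V.M.a_assoc[of _ n v])
    ultimately show "x \<in> p (n \<oplus>\<^bsub>V\<^esub> v)" by (auto simp: p)
  qed
  have self: "v \<in> p v" if "v \<in> carrier V" for v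
    using that c(2) V.M.l_zero[OF that] by (auto simp: p intro!: bexI[of _ "\<zero>\<^bsub>V\<^esub>"])
  show surj: "p ` carrier V = carrier (quot_rep V N)"
    by (auto simp: p_def A_RCOSETS_def')
  have p0: "p n = N" if "n \<in> N" for n
  proof (intro equalityI subsetI)
    fix x assume "x \<in> p n" then show "x \<in> N" using that c(3) by (auto simp: p)
  next
    fix x assume x: "x \<in> N"
    have "x = (x \<oplus>\<^bsub>V\<^esub> (-1) \<odot>\<^bsub>V\<^esub> n) \<oplus>\<^bsub>V\<^esub> n"
      using x that c(5) by (simp add: V.M.a_assoc V.smult_cl V.smult_m1_add')
    moreover have "x \<oplus>\<^bsub>V\<^esub> (-1) \<odot>\<^bsub>V\<^esub> n \<in> N" using x that c by blast
    ultimately show "x \<in> p n" by (auto simp: p)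
  qed
  show zero: "p \<zero>\<^bsub>V\<^esub> = \<zero>\<^bsub>quot_rep V N\<^esub>" using p0 c(2) by simp
  show "p v = \<zero>\<^bsub>quot_rep V N\<^esub> \<longleftrightarrow> v \<in> N" if "v \<in> carrier V"
    using self[OF that] p0 by auto
  \<comment> \<open>Scaling and action on cosets are unions over all representatives. Each
    representative contributes the same coset, so the union equals the contribution of v
    alone.\<close>
  have UN: "(\<Union>x\<in>p v. p (f x)) = p (f v)"
    if v: "v \<in> carrier V" and f: "\<And>x. x \<in> carrier V \<Longrightarrow> f x \<in> carrier V"
      "\<And>n. n \<in> N \<Longrightarrow> f n \<in> N" "\<And>n. n \<in> N \<Longrightarrow> f (n \<oplus>\<^bsub>V\<^esub> v) = f n \<oplus>\<^bsub>V\<^esub> f v" for f v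
  proof -
    have "p (f x) = p (f v)" if "x \<in> p v" for x
      using that f v by (auto simp: p coset)
    with self[OF v] show ?thesis by blast
  qed
  show hom: "p \<in> rep_hom G V (quot_rep V N)"
    unfolding rep_hom_iff
  proof (intro conjI linmapI ballI)
    fix v assume v: "v \<in> carrier V"
    show "p v \<in> carrier (quot_rep V N)" using surj v by blast
    show "p (c \<odot>\<^bsub>V\<^esub> v) = c \<odot>\<^bsub>quot_rep V N\<^esub> p v" for c
      using UN[of v "\<lambda>v. c \<odot>\<^bsub>V\<^esub> v"] v c
      by (simp add: p_def[symmetric] V.smult_cl V.smult_add_right)
    show "p (act V g v) = act (quot_rep V N) g (p v)" if "g \<in> carrier G" for g
      using UN[of v "act V g"] v c that inv
      by (simp add: p_def[symmetric] V.act_cl V.act_add)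
    fix w assume w: "w \<in> carrier V"
    show "p (v \<oplus>\<^bsub>V\<^esub> w) = p v \<oplus>\<^bsub>quot_rep V N\<^esub> p w"
    proof (intro equalityI subsetI)
      fix x assume "x \<in> p (v \<oplus>\<^bsub>V\<^esub> w)"
      then obtain n where n: "n \<in> N" "x = n \<oplus>\<^bsub>V\<^esub> (v \<oplus>\<^bsub>V\<^esub> w)" by (auto simp: p)
      then have "x = (n \<oplus>\<^bsub>V\<^esub> v) \<oplus>\<^bsub>V\<^esub> w" using c(5) v w by (simp add: V.M.a_assoc)
      moreover have "n \<oplus>\<^bsub>V\<^esub> v \<in> p v" using n by (auto simp: p)
      ultimately show "x \<in> p v \<oplus>\<^bsub>quot_rep V N\<^esub> p w" using self[OF w] by (auto simp: set_add_def')
    next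
      fix x assume "x \<in> p v \<oplus>\<^bsub>quot_rep V N\<^esub> p w"
      then obtain n m where n: "n \<in> N" "m \<in> N" "x = (n \<oplus>\<^bsub>V\<^esub> v) \<oplus>\<^bsub>V\<^esub> (m \<oplus>\<^bsub>V\<^esub> w)"
        by (auto simp: p set_add_def')
      then have "x = (n \<oplus>\<^bsub>V\<^esub> m) \<oplus>\<^bsub>V\<^esub> (v \<oplus>\<^bsub>V\<^esub> w)"
        using c(5) v w V.add_combination[of n m v w] by simp
      then show "x \<in> p (v \<oplus>\<^bsub>V\<^esub> w)" using n c(3) by (auto simp: p)
    qed
  qed
  show "lin_rep G (quot_rep V N)"
    by (rule lin_rep_image[OF assms(1) hom surj zero])
qed

section \<open>Isomorphisms and copies on coordinate vectors\<close>

lemma rep_iso_refl: "rep_iso G V V"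
  unfolding rep_iso_def by (rule bexI[of _ id]) (auto simp: rep_hom_def)

lemma rep_isoI:
  assumes "f \<in> rep_hom G V W" "h \<in> linmap W V"
    "\<And>v. v \<in> carrier V \<Longrightarrow> h (f v) = v" "\<And>w. w \<in> carrier W \<Longrightarrow> f (h w) = w"
  shows "rep_iso G V W"
  unfolding rep_iso_def
  by (rule bexI[OF bij_betwI[where g = h] assms(1)])
    (use rep_homD(1)[OF assms(1)] linmapD(1)[OF assms(2)] assms(3,4) in auto)

lemma rep_iso_inverse:
  assumes "lin_rep G V" "lin_rep G W" "rep_iso G V W"
  obtains f h where "f \<in> rep_hom G V W" "h \<in> rep_hom G W V"
    "\<And>v. v \<in> carrier V \<Longrightarrow> h (f v) = v" "\<And>w. w \<in> carrier W \<Longrightarrow> f (h w) = w"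
proof -
  interpret V: lin_rep G V by fact
  interpret W: lin_rep G W by fact
  obtain f where f: "f \<in> rep_hom G V W" "bij_betw f (carrier V) (carrier W)"
    using assms by (auto simp: rep_iso_def)
  let ?h = "inv_into (carrier V) f"
  have lin: "?h \<in> linmap W V"
    by (rule linmap_inverse[OF V.complex_space_axioms W.complex_space_axioms
          rep_hom_linmap[OF f(1)] bij_betw_imp_inj_on[OF f(2)] W.csub_carrier _ _ _
          W.complex_space_axioms, of "\<lambda>x. x"])
      (simp_all add: bij_betw_imp_surj_on[OF f(2)] linmap_def)
  have hf: "?h (f v) = v" if "v \<in> carrier V" for v using bij_betw_inv_into_left[OF f(2) that] .
  have fh: "f (?h w) = w" if "w \<in> carrier W" for w using bij_betw_inv_into_right[OF f(2) that] .
  have "?h (act W g w) = act V g (?h w)" if "g \<in> carrier G" "w \<in> carrier W" for g w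
    using that rep_homD(4)[OF f(1) linmapD(1)[OF lin that(2)] that(1)] fh
      hf[OF V.act_cl[OF that(1) linmapD(1)[OF lin that(2)]]] by simp
  with lin have "?h \<in> rep_hom G W V" by (simp add: rep_hom_iff)
  with f(1) show ?thesis using hf fh by (rule that)
qed

lemma fd_rep_iso_sym:
  assumes "fd_rep G V" "fd_rep G W" "rep_iso G V W"
  shows "rep_iso G W V"
proof -
  obtain f h where "f \<in> rep_hom G V W" "h \<in> rep_hom G W V"
    "\<And>v. v \<in> carrier V \<Longrightarrow> h (f v) = v" "\<And>w. w \<in> carrier W \<Longrightarrow> f (h w) = w"
    using rep_iso_inverse[OF fd_repD(1)[OF assms(1)] fd_repD(1)[OF assms(2)] assms(3)] by metis
  then show ?thesis by (intro rep_isoI[of h G W V f] rep_hom_linmap)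
qed

lemma rep_iso_trans: "\<lbrakk>rep_iso G U V; rep_iso G V W\<rbrakk> \<Longrightarrow> rep_iso G U W"
  unfolding rep_iso_def by (elim bexE, rule bexI, rule bij_betw_trans, assumption+, rule rep_hom_comp)

text \<open>A choice of coefficients embeds the carrier into the coordinate vectors as a set; the
  structure is then transported, so the embedding need not be linear.\<close>

lemma model_exists:
  fixes V :: "('g, 'a) rep"
  assumes "fd_rep G V"
  shows "\<exists>M :: 'g model. fd_rep G M \<and> rep_iso G M V"
proof -
  interpret V: lin_rep G V using assms by (rule fd_repD)
  obtain B where B: "generates V B" using fd_repD(3)[OF assms] by blast
  then have fin: "finite B" and sub: "B \<subseteq> carrier V" by (auto simp: generates_def)
  obtain e :: "nat \<Rightarrow> 'a" and k where e: "B = e ` {i. i < k}"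
    using finite_imp_nat_seg_image_inj_on[OF fin] by blast
  obtain c where c: "\<And>v. v \<in> carrier V \<Longrightarrow> v = (\<Oplus>\<^bsub>V\<^esub>b\<in>B. c v b \<odot>\<^bsub>V\<^esub> b)"
    using iffD1[OF V.gen_iff_combinations[OF fin sub] B] by (auto dest!: bchoice)
  define f where "f v = (\<lambda>i. c v (e i))" for v
  have inj: "inj_on f (carrier V)"
  proof (rule inj_onI)
    fix v w assume vw: "v \<in> carrier V" "w \<in> carrier V" "f v = f w"
    then have "c v b = c w b" if "b \<in> B" for b using that by (auto simp: f_def e dest: fun_cong)
    then have "(\<Oplus>\<^bsub>V\<^esub>b\<in>B. c v b \<odot>\<^bsub>V\<^esub> b) = (\<Oplus>\<^bsub>V\<^esub>b\<in>B. c w b \<odot>\<^bsub>V\<^esub> b)"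
      using sub by (intro V.M.finsum_cong') (auto intro: V.smult_cl)
    then show "v = w" using c[OF vw(1)] c[OF vw(2)] by (simp only:)
  qed
  let ?h = "inv_into (carrier V) f"
  define M :: "'g model" where "M =
     \<lparr>carrier = f ` carrier V, mult = undefined, one = undefined, zero = f \<zero>\<^bsub>V\<^esub>,
      add = (\<lambda>x y. f (?h x \<oplus>\<^bsub>V\<^esub> ?h y)), module.smult = (\<lambda>a x. f (a \<odot>\<^bsub>V\<^esub> ?h x)),
      act = (\<lambda>g x. f (act V g (?h x)))\<rparr>"
  have f: "f \<in> rep_hom G V M" by (auto simp: rep_hom_def M_def inj)
  have M: "fd_rep G M" by (rule fd_rep_image[OF assms f]) (auto simp: M_def)
  have "rep_iso G V M"
    unfolding rep_iso_def using f inj by (auto simp: bij_betw_def M_def)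
  from fd_rep_iso_sym[OF assms M this] M show ?thesis by blast
qed

section \<open>Short exact sequences\<close>

lemma short_exactI:
  assumes "fd_rep G U" "fd_rep G V" "fd_rep G W" "f \<in> rep_hom G U V" "g \<in> rep_hom G V W"
    "inj_on f (carrier U)" "f ` carrier U = {v \<in> carrier V. g v = \<zero>\<^bsub>W\<^esub>}"
    "g ` carrier V = carrier W"
  shows "short_exact G U V W"
  unfolding short_exact_def using assms by blast

lemma short_exactE:
  assumes "short_exact G U V W"
  obtains f g where "f \<in> rep_hom G U V" "g \<in> rep_hom G V W"
    "inj_on f (carrier U)" "f ` carrier U = {v \<in> carrier V. g v = \<zero>\<^bsub>W\<^esub>}"
    "g ` carrier V = carrier W" "fd_rep G U" "fd_rep G V" "fd_rep G W"
  using assms unfolding short_exact_def by blast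

lemma inj_on_iff_kernel:
  assumes "complex_space V" "complex_space W" "f \<in> linmap V W"
  shows "inj_on f (carrier V) \<longleftrightarrow> (\<forall>v\<in>carrier V. f v = \<zero>\<^bsub>W\<^esub> \<longrightarrow> v = \<zero>\<^bsub>V\<^esub>)"
proof
  interpret V: complex_space V by fact
  interpret W: complex_space W by fact
  note f = linmapD[OF assms(3)]
  show "\<forall>v\<in>carrier V. f v = \<zero>\<^bsub>W\<^esub> \<longrightarrow> v = \<zero>\<^bsub>V\<^esub>" if "inj_on f (carrier V)"
    using inj_onD[OF that _ _ V.zero_cl] linmap_zero[OF assms] by simp
  assume k: "\<forall>v\<in>carrier V. f v = \<zero>\<^bsub>W\<^esub> \<longrightarrow> v = \<zero>\<^bsub>V\<^esub>"
  show "inj_on f (carrier V)"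
  proof (rule inj_onI)
    fix v w assume v: "v \<in> carrier V" and w: "w \<in> carrier V" and eq: "f v = f w"
    have "f (v \<oplus>\<^bsub>V\<^esub> (-1) \<odot>\<^bsub>V\<^esub> w) = \<zero>\<^bsub>W\<^esub>"
      using v w f(1)[OF w] by (simp add: f eq V.smult_cl W.smult_m1_add)
    with k v w have "v \<oplus>\<^bsub>V\<^esub> (-1) \<odot>\<^bsub>V\<^esub> w = \<zero>\<^bsub>V\<^esub>" by (simp add: V.add_cl V.smult_cl)
    then show "v = w" by (rule V.eqI_diff[OF v w])
  qed
qed

text \<open>Both maps are conjugated by the isomorphisms. This moves a sequence on arbitrary
  carriers to coordinate vectors, where \<open>has_class\<close> can use it.\<close>

lemma short_exact_iso:
  assumes ex: "short_exact G U V W" and fd: "fd_rep G U'" "fd_rep G V'" "fd_rep G W'"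
    and iso: "rep_iso G U' U" "rep_iso G V' V" "rep_iso G W W'"
  shows "short_exact G U' V' W'"
proof -
  obtain f g where fg: "f \<in> rep_hom G U V" "g \<in> rep_hom G V W"
    "inj_on f (carrier U)" "f ` carrier U = {v \<in> carrier V. g v = \<zero>\<^bsub>W\<^esub>}"
    "g ` carrier V = carrier W" and fd': "fd_rep G U" "fd_rep G V" "fd_rep G W"
    using ex by (rule short_exactE)
  note lin = fd[THEN fd_repD(1)] fd'[THEN fd_repD(1)]
  obtain a a' where a: "a \<in> rep_hom G U' U" and a': "a' \<in> rep_hom G U U'"
    and aa: "\<And>u. u \<in> carrier U' \<Longrightarrow> a' (a u) = u" "\<And>u. u \<in> carrier U \<Longrightarrow> a (a' u) = u"
    using rep_iso_inverse[OF lin(1,4) iso(1)] by metis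
  obtain b b' where b: "b \<in> rep_hom G V' V" and b': "b' \<in> rep_hom G V V'"
    and bb: "\<And>v. v \<in> carrier V' \<Longrightarrow> b' (b v) = v" "\<And>v. v \<in> carrier V \<Longrightarrow> b (b' v) = v"
    using rep_iso_inverse[OF lin(2,5) iso(2)] by metis
  obtain c c' where c: "c \<in> rep_hom G W W'" and c': "c' \<in> rep_hom G W' W"
    and cc: "\<And>w. w \<in> carrier W \<Longrightarrow> c' (c w) = w" "\<And>w. w \<in> carrier W' \<Longrightarrow> c (c' w) = w"
    using rep_iso_inverse[OF lin(6,3) iso(3)] by metis
  note mem = a[THEN rep_homD(1)] a'[THEN rep_homD(1)] b[THEN rep_homD(1)] b'[THEN rep_homD(1)]
    c[THEN rep_homD(1)] c'[THEN rep_homD(1)] fg(1,2)[THEN rep_homD(1)]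
  note sp = fd_repD(2)
  note c0 = rep_hom_zero[OF sp[OF fd'(3)] sp[OF fd(3)] c]
    and c'0 = rep_hom_zero[OF sp[OF fd(3)] sp[OF fd'(3)] c']
  let ?f = "b' \<circ> (f \<circ> a)" and ?g = "c \<circ> (g \<circ> b)"
  show ?thesis
  proof (rule short_exactI[OF fd])
    show "?f \<in> rep_hom G U' V'" by (intro rep_hom_comp[OF rep_hom_comp[OF a fg(1)] b'])
    show "?g \<in> rep_hom G V' W'" by (intro rep_hom_comp[OF rep_hom_comp[OF b fg(2)] c])
    show "inj_on ?f (carrier U')"
    proof (rule inj_onI)
      fix u v assume uv: "u \<in> carrier U'" "v \<in> carrier U'" "?f u = ?f v"
      from arg_cong[OF uv(3), of b] have "f (a u) = f (a v)" using uv(1,2) by (simp add: bb mem)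
      then have "a u = a v" by (rule inj_onD[OF fg(3) _ mem(1)[OF uv(1)] mem(1)[OF uv(2)]])
      from arg_cong[OF this, of a'] show "u = v" using uv(1,2) by (simp add: aa)
    qed
    show "?f ` carrier U' = {v \<in> carrier V'. ?g v = \<zero>\<^bsub>W'\<^esub>}"
    proof (intro equalityI subsetI)
      fix v assume "v \<in> ?f ` carrier U'"
      then obtain u where u: "u \<in> carrier U'" "v = ?f u" by blast
      have "f (a u) \<in> f ` carrier U" using mem(1)[OF u(1)] by (rule imageI)
      then have "g (f (a u)) = \<zero>\<^bsub>W\<^esub>" unfolding fg(4) by blast
      with u show "v \<in> {v \<in> carrier V'. ?g v = \<zero>\<^bsub>W'\<^esub>}" by (simp add: bb mem c0)
    next
      fix v assume v: "v \<in> {v \<in> carrier V'. ?g v = \<zero>\<^bsub>W'\<^esub>}"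
      then have gb: "g (b v) \<in> carrier W" by (simp add: mem)
      from cc(1)[OF gb] v have "g (b v) = \<zero>\<^bsub>W\<^esub>" by (simp add: c'0)
      then have "b v \<in> f ` carrier U" unfolding fg(4) using v by (simp add: mem)
      then obtain u where u: "u \<in> carrier U" "b v = f u" by blast
      then have "v = ?f (a' u)" using v bb(1)[of v] by (simp add: aa)
      then show "v \<in> ?f ` carrier U'" using mem(2)[OF u(1)] by (rule image_eqI)
    qed
    have "w \<in> ?g ` carrier V'" if w: "w \<in> carrier W'" for w
    proof -
      have "c' w \<in> g ` carrier V" unfolding fg(5) using mem(6)[OF w] .
      then obtain v where v: "v \<in> carrier V" "c' w = g v" by blast
      then have "w = ?g (b' v)" using cc(2)[OF w] by (simp add: bb)
      then show ?thesis using mem(4)[OF v(1)] by (rule image_eqI)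
    qed
    then show "?g ` carrier V' = carrier W'" by (auto simp: mem)
  qed
qed

section \<open>Classes in the Grothendieck group\<close>

text \<open>Extends \<open>has_class\<close> from coordinate vectors to arbitrary carrier types and
  is closed under isomorphism by construction.\<close>

definition rep_has_class ::
  "('g, 'm) monoid_scheme \<Rightarrow> ('g, 'a) rep \<Rightarrow> ('g model set \<Rightarrow>\<^sub>0 int) \<Rightarrow> bool" where
  "rep_has_class G V x \<longleftrightarrow> fd_rep G V \<and> (\<exists>M. rep_iso G M V \<and> has_class G M x)"

lemma has_class_fd: "has_class G V x \<Longrightarrow> fd_rep G V"
  by (induction rule: has_class.induct) (simp_all add: irreducible_rep_def short_exact_def)

lemma has_class_rep_has_class: "has_class G V x \<Longrightarrow> rep_has_class G V x"
  unfolding rep_has_class_def using has_class_fd rep_iso_refl by blast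

lemma rep_has_class_iso:
  assumes "rep_has_class G V x" "rep_iso G V W" "fd_rep G W"
  shows "rep_has_class G W x"
  using assms rep_iso_trans[OF _ assms(2)] unfolding rep_has_class_def by blast

lemma rep_has_class_exact:
  assumes ex: "short_exact G U V W" and "rep_has_class G U x" "rep_has_class G W y"
  shows "rep_has_class G V (x + y)"
proof -
  have fd: "fd_rep G U" "fd_rep G V" "fd_rep G W"
    using ex by (simp_all add: short_exact_def)
  obtain M where M: "rep_iso G M U" "has_class G M x" using assms(2) by (auto simp: rep_has_class_def)
  obtain N where N: "rep_iso G N W" "has_class G N y" using assms(3) by (auto simp: rep_has_class_def)
  obtain L :: "'a model" where L: "fd_rep G L" "rep_iso G L V" using model_exists[OF fd(2)] by blast
  have "short_exact G M L N"
    by (rule short_exact_iso[OF ex has_class_fd[OF M(2)] L(1) has_class_fd[OF N(2)] M(1) L(2)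
          fd_rep_iso_sym[OF has_class_fd[OF N(2)] fd(3) N(1)]])
  then have "has_class G L (x + y)" using M(2) N(2) by (rule has_class.short_exact)
  with L(2) fd(2) show ?thesis by (auto simp: rep_has_class_def)
qed

lemma zero_rep_iso:
  assumes "complex_space V" "complex_space W" "rep_iso G V W" "carrier V = {\<zero>\<^bsub>V\<^esub>}"
  shows "carrier W = {\<zero>\<^bsub>W\<^esub>}"
proof -
  obtain f where f: "f \<in> rep_hom G V W" "bij_betw f (carrier V) (carrier W)"
    using assms(3) by (auto simp: rep_iso_def)
  show ?thesis
    using bij_betw_imp_surj_on[OF f(2)] rep_hom_zero[OF assms(1,2) f(1)] assms(4) by simp
qed

lemma zero_short_exact:
  assumes ex: "short_exact G U V W" and V: "carrier V = {\<zero>\<^bsub>V\<^esub>}"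
  shows "carrier U = {\<zero>\<^bsub>U\<^esub>}" "carrier W = {\<zero>\<^bsub>W\<^esub>}"
proof -
  obtain f g where fg: "f \<in> rep_hom G U V" "g \<in> rep_hom G V W" "inj_on f (carrier U)"
    "f ` carrier U = {v \<in> carrier V. g v = \<zero>\<^bsub>W\<^esub>}" "g ` carrier V = carrier W"
    "fd_rep G U" "fd_rep G V" "fd_rep G W"
    using ex by (rule short_exactE)
  note sp = fg(6-8)[THEN fd_repD(2)]
  have U0: "\<zero>\<^bsub>U\<^esub> \<in> carrier U" using sp(1) by (rule complex_space.zero_cl)
  have "u = \<zero>\<^bsub>U\<^esub>" if u: "u \<in> carrier U" for u
  proof -
    have "f u = f \<zero>\<^bsub>U\<^esub>" using rep_homD(1)[OF fg(1) u] rep_homD(1)[OF fg(1) U0] V by simp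
    then show ?thesis by (rule inj_onD[OF fg(3) _ u U0])
  qed
  with U0 show "carrier U = {\<zero>\<^bsub>U\<^esub>}" by blast
  show "carrier W = {\<zero>\<^bsub>W\<^esub>}"
    unfolding fg(5)[symmetric] V by (simp add: rep_hom_zero[OF sp(2,3) fg(2)])
qed

lemma has_class_zero_unique: "\<lbrakk>has_class G V x; carrier V = {\<zero>\<^bsub>V\<^esub>}\<rbrakk> \<Longrightarrow> x = 0"
proof (induction rule: has_class.induct)
  case (irreducible V)
  then show ?case by (simp add: irreducible_rep_def)
next
  case (short_exact U V W x y)
  then show ?case using zero_short_exact[OF short_exact.hyps(1)] by simp
qed simp

lemma rep_has_class_zero_unique:
  assumes "rep_has_class G V x" "carrier V = {\<zero>\<^bsub>V\<^esub>}"
  shows "x = 0"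
proof -
  obtain M where M: "rep_iso G M V" "has_class G M x" and V: "fd_rep G V"
    using assms(1) by (auto simp: rep_has_class_def)
  note fM = has_class_fd[OF M(2)]
  show ?thesis
    by (rule has_class_zero_unique[OF M(2) zero_rep_iso[OF fd_repD(2)[OF V] fd_repD(2)[OF fM]
            fd_rep_iso_sym[OF fM V M(1)] assms(2)]])
qed

lemma rep_has_class_zero:
  assumes "fd_rep G V" "carrier V = {\<zero>\<^bsub>V\<^esub>}"
  shows "rep_has_class G V 0"
proof -
  obtain M :: "'a model" where M: "fd_rep G M" "rep_iso G M V"
    using model_exists[OF assms(1)] by blast
  have "carrier M = {\<zero>\<^bsub>M\<^esub>}"
    by (rule zero_rep_iso[OF fd_repD(2)[OF assms(1)] fd_repD(2)[OF M(1)]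
          fd_rep_iso_sym[OF M(1) assms(1) M(2)] assms(2)])
  with M(1) have "has_class G M 0" by (rule has_class.zero)
  with M assms(1) show ?thesis by (auto simp: rep_has_class_def)
qed

lemma irr_class_eq:
  assumes "irreducible_rep G S" "irreducible_rep G T" "rep_iso G S T"
  shows "irr_class G S = irr_class G T"
proof -
  have fd: "fd_rep G S" "fd_rep G T" using assms by (simp_all add: irreducible_rep_def)
  show ?thesis
    unfolding irr_class_def
    using rep_iso_trans[OF _ assms(3)] rep_iso_trans[OF _ fd_rep_iso_sym[OF fd assms(3)]] by blast
qed

section \<open>Removing a simple submodule\<close>

lemma rep_hom_factor:
  assumes V: "lin_rep G V" and W: "complex_space W" and Q: "complex_space Q"
    and q: "q \<in> rep_hom G V Q" "q ` carrier V = carrier Q" and g: "g \<in> rep_hom G V W"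
    and ker: "\<And>v. \<lbrakk>v \<in> carrier V; q v = \<zero>\<^bsub>Q\<^esub>\<rbrakk> \<Longrightarrow> g v = \<zero>\<^bsub>W\<^esub>"
  shows "\<exists>h\<in>rep_hom G Q W. \<forall>v\<in>carrier V. h (q v) = g v"
proof -
  interpret V: lin_rep G V by fact
  obtain h where h: "h \<in> linmap Q W" "\<forall>v\<in>carrier V. h (q v) = g v"
    using linmap_factor[OF V.complex_space_axioms W rep_hom_linmap[OF q(1)] q(2) Q
        rep_hom_linmap[OF g] ker] by blast
  have "h (act Q k x) = act W k (h x)" if "k \<in> carrier G" "x \<in> carrier Q" for k x
  proof -
    from that(2) obtain v where v: "v \<in> carrier V" "x = q v" unfolding q(2)[symmetric] by blast
    then show ?thesis
      using that(1) h(2) V.act_cl[OF that(1) v(1)]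
      by (simp add: rep_homD(4)[OF g, symmetric] rep_homD(4)[OF q(1), symmetric])
  qed
  with h show ?thesis by (auto simp: rep_hom_iff)
qed

text \<open>The cosets are replaced by coordinate vectors, so that the quotient can enter the
  inductive rules for classes and the inductions over models.\<close>

lemma quotient_model:
  fixes V :: "('g, 'a) rep"
  assumes V: "fd_rep G V" and N: "rep_sub G V N"
  shows "\<exists>(Q :: 'g model) p. fd_rep G Q \<and> p \<in> rep_hom G V Q \<and> p ` carrier V = carrier Q \<and>
    (\<forall>v\<in>carrier V. p v = \<zero>\<^bsub>Q\<^esub> \<longleftrightarrow> v \<in> N)"
proof -
  note p = quot_rep_proj[OF fd_repD(1)[OF V] N]
  have R: "fd_rep G (quot_rep V N)" by (rule fd_rep_image[OF V p(1-3)])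
  obtain Q :: "'g model" where Q: "fd_rep G Q" "rep_iso G Q (quot_rep V N)"
    using model_exists[OF R] by blast
  obtain f where f: "f \<in> rep_hom G (quot_rep V N) Q"
    "bij_betw f (carrier (quot_rep V N)) (carrier Q)"
    using fd_rep_iso_sym[OF Q(1) R Q(2)] by (auto simp: rep_iso_def)
  note sp = fd_repD(2)[OF R] fd_repD(2)[OF Q(1)]
  have ker: "f x = \<zero>\<^bsub>Q\<^esub> \<longleftrightarrow> x = \<zero>\<^bsub>quot_rep V N\<^esub>" if "x \<in> carrier (quot_rep V N)" for x
  proof
    show "x = \<zero>\<^bsub>quot_rep V N\<^esub>" if "f x = \<zero>\<^bsub>Q\<^esub>"
      using iffD1[OF inj_on_iff_kernel[OF sp rep_hom_linmap[OF f(1)]] bij_betw_imp_inj_on[OF f(2)]]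
        \<open>x \<in> carrier (quot_rep V N)\<close> that by blast
    show "f x = \<zero>\<^bsub>Q\<^esub>" if "x = \<zero>\<^bsub>quot_rep V N\<^esub>"
      unfolding that by (rule rep_hom_zero[OF sp f(1)])
  qed
  let ?p = "f \<circ> (\<lambda>v. N +>\<^bsub>V\<^esub> v)"
  have "?p ` carrier V = carrier Q"
    by (simp only: image_comp[symmetric] p(2) bij_betw_imp_surj_on[OF f(2)])
  moreover have "?p v = \<zero>\<^bsub>Q\<^esub> \<longleftrightarrow> v \<in> N" if "v \<in> carrier V" for v
    using ker[OF rep_homD(1)[OF p(1) that]] p(4)[OF that] by simp
  ultimately show ?thesis using Q(1) rep_hom_comp[OF p(1) f(1)] by blast
qed

text \<open>The preimage of N is a subrepresentation of a simple S. This is the source of the case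
  distinction in the removal of S.\<close>

lemma irreducible_image:
  assumes S: "irreducible_rep G S" and V: "fd_rep G V" and s: "s \<in> rep_hom G S V"
    and N: "rep_sub G V N"
  shows "(\<forall>t\<in>carrier S. s t \<in> N) \<or> (\<forall>t\<in>carrier S. s t \<in> N \<longrightarrow> t = \<zero>\<^bsub>S\<^esub>)"
proof -
  have fS: "fd_rep G S" using S by (simp add: irreducible_rep_def)
  have "rep_sub G S {t \<in> carrier S. s t \<in> N}"
    by (rule rep_sub_preimage[OF fd_repD(1)[OF fS] fd_repD(1)[OF V] s N])
  then have "{t \<in> carrier S. s t \<in> N} = {\<zero>\<^bsub>S\<^esub>} \<or> {t \<in> carrier S. s t \<in> N} = carrier S"
    using S by (simp add: irreducible_rep_iff)
  then show ?thesis by blast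
qed

text \<open>The map g descends along q to a map from Q onto W with kernel q (ker g), and e
  identifies U with that kernel. Both cases of the removal of S produce their sequence for Q in this
  way.\<close>

lemma short_exact_induced:
  assumes fd: "fd_rep G U" "fd_rep G V" "fd_rep G Q" "fd_rep G W"
    and q: "q \<in> rep_hom G V Q" "q ` carrier V = carrier Q"
    and g: "g \<in> rep_hom G V W" "g ` carrier V = carrier W"
    and ker: "\<And>v. \<lbrakk>v \<in> carrier V; q v = \<zero>\<^bsub>Q\<^esub>\<rbrakk> \<Longrightarrow> g v = \<zero>\<^bsub>W\<^esub>"
    and e: "e \<in> rep_hom G U Q" "inj_on e (carrier U)"
      "e ` carrier U = q ` {v \<in> carrier V. g v = \<zero>\<^bsub>W\<^esub>}"
  shows "short_exact G U Q W"
proof -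
  obtain h where h: "h \<in> rep_hom G Q W" "\<And>v. v \<in> carrier V \<Longrightarrow> h (q v) = g v"
    using rep_hom_factor[OF fd_repD(1)[OF fd(2)] fd_repD(2)[OF fd(4)] fd_repD(2)[OF fd(3)]
        q g(1) ker] by blast
  have "e ` carrier U = {z \<in> q ` carrier V. h z = \<zero>\<^bsub>W\<^esub>}"
    unfolding e(3) using h(2) by force
  moreover have "(\<lambda>v. h (q v)) ` carrier V = g ` carrier V" using h(2) by (intro image_cong) auto
  then have "h ` carrier Q = carrier W" by (simp only: q(2)[symmetric] g(2) image_image)
  ultimately show ?thesis
    using q(2) by (intro short_exactI[OF fd(1,3,4) e(1) h(1) e(2)]) simp_all
qed

text \<open>Removing a simple submodule \<open>S\<close> removes \<open>[S]\<close> from every class of \<open>V\<close>: for an extension of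
  \<open>W\<close> by \<open>U\<close>, either \<open>S\<close> lies in \<open>U\<close> or it embeds in \<open>W\<close>.\<close>

lemma has_class_remove_simple:
  fixes V S Q :: "'g model"
  assumes "has_class G V x" "irreducible_rep G S" "short_exact G S V Q"
  shows "rep_has_class G Q (x - frag_of (irr_class G S))"
  using assms(1,3)
proof (induction arbitrary: Q rule: has_class.induct)
  case (zero V)
  from zero_short_exact(1)[OF zero.prems zero.hyps(2)] assms(2) show ?case
    by (simp add: irreducible_rep_def)
next
  case (irreducible V)
  obtain s q where sq: "s \<in> rep_hom G S V" "q \<in> rep_hom G V Q" "inj_on s (carrier S)"
    "s ` carrier S = {v \<in> carrier V. q v = \<zero>\<^bsub>Q\<^esub>}" "q ` carrier V = carrier Q"
    "fd_rep G S" "fd_rep G V" "fd_rep G Q"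
    using irreducible.prems by (rule short_exactE)
  note sp = sq(6-8)[THEN fd_repD(2)]
  \<comment> \<open>V is simple here: the image of S is nonzero, hence all of V, so Q vanishes and
    the two classes cancel.\<close>
  have "rep_sub G V (s ` carrier S)"
    using rep_sub_image[OF fd_repD(1)[OF sq(6)] fd_repD(1)[OF sq(7)] sq(1)
        rep_sub_carrier[OF fd_repD(1)[OF sq(6)]]] .
  moreover have "s ` carrier S \<noteq> {\<zero>\<^bsub>V\<^esub>}"
  proof
    assume im: "s ` carrier S = {\<zero>\<^bsub>V\<^esub>}"
    have "\<forall>t\<in>carrier S. s t = \<zero>\<^bsub>V\<^esub> \<longrightarrow> t = \<zero>\<^bsub>S\<^esub>"
      by (rule iffD1[OF inj_on_iff_kernel[OF sp(1,2) rep_hom_linmap[OF sq(1)]] sq(3)])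
    with im have "carrier S \<subseteq> {\<zero>\<^bsub>S\<^esub>}" by blast
    then have "carrier S = {\<zero>\<^bsub>S\<^esub>}" using complex_space.zero_cl[OF sp(1)] by blast
    with assms(2) show False by (simp add: irreducible_rep_def)
  qed
  ultimately have im: "s ` carrier S = carrier V"
    using irreducible.hyps by (auto simp: irreducible_rep_iff)
  then have "bij_betw s (carrier S) (carrier V)" using sq(3) by (simp add: bij_betw_def)
  with sq(1) have "rep_iso G S V" by (auto simp: rep_iso_def)
  then have cl: "irr_class G S = irr_class G V"
    by (rule irr_class_eq[OF assms(2) irreducible.hyps])
  have "q v = \<zero>\<^bsub>Q\<^esub>" if "v \<in> carrier V" for v
    using that sq(4) unfolding im by blast
  then have "carrier Q \<subseteq> {\<zero>\<^bsub>Q\<^esub>}" unfolding sq(5)[symmetric] by blast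
  then have "carrier Q = {\<zero>\<^bsub>Q\<^esub>}" using complex_space.zero_cl[OF sp(3)] by blast
  then show ?case using rep_has_class_zero[OF sq(8)] by (simp add: cl)
next
  case (short_exact U V W x y)
  obtain f g where fg: "f \<in> rep_hom G U V" "g \<in> rep_hom G V W" "inj_on f (carrier U)"
    "f ` carrier U = {v \<in> carrier V. g v = \<zero>\<^bsub>W\<^esub>}" "g ` carrier V = carrier W"
    "fd_rep G U" "fd_rep G V" "fd_rep G W"
    using short_exact.hyps(1) by (rule short_exactE)
  obtain s q where sq: "s \<in> rep_hom G S V" "q \<in> rep_hom G V Q" "inj_on s (carrier S)"
    "s ` carrier S = {v \<in> carrier V. q v = \<zero>\<^bsub>Q\<^esub>}" "q ` carrier V = carrier Q"
    "fd_rep G S" "fd_rep G V" "fd_rep G Q"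
    using short_exact.prems by (rule short_exactE)
  note spU = fd_repD(2)[OF fg(6)] and spV = fd_repD(2)[OF fg(7)] and spW = fd_repD(2)[OF fg(8)]
    and spS = fd_repD(2)[OF sq(6)] and spQ = fd_repD(2)[OF sq(8)]
  note linU = fd_repD(1)[OF fg(6)] and linV = fd_repD(1)[OF fg(7)] and linW = fd_repD(1)[OF fg(8)]
    and linS = fd_repD(1)[OF sq(6)] and linQ = fd_repD(1)[OF sq(8)]
  have kerg: "v \<in> f ` carrier U \<longleftrightarrow> g v = \<zero>\<^bsub>W\<^esub>" if "v \<in> carrier V" for v
    unfolding fg(4) using that by simp
  have kerq: "v \<in> s ` carrier S \<longleftrightarrow> q v = \<zero>\<^bsub>Q\<^esub>" if "v \<in> carrier V" for v
    unfolding sq(4) using that by simp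
  have fV: "f u \<in> carrier V" if "u \<in> carrier U" for u using rep_homD(1)[OF fg(1) that] .
  have sV: "s t \<in> carrier V" if "t \<in> carrier S" for t using rep_homD(1)[OF sq(1) that] .
  have subU: "rep_sub G V (f ` carrier U)"
    by (rule rep_sub_image[OF linU linV fg(1) rep_sub_carrier[OF linU]])
  from irreducible_image[OF assms(2) fg(7) sq(1) subU] show ?case
  proof
    assume SU: "\<forall>t\<in>carrier S. s t \<in> f ` carrier U"
    \<comment> \<open>The quotient U/S is realised as the image of U in Q. It keeps the carrier type
      of Q, so the induction hypothesis for U applies to it, and Q is an extension of W by
      it.\<close>
    let ?N = "(q \<circ> f) ` carrier U"
    let ?Q = "sub_rep Q ?N"
    have qf: "q \<circ> f \<in> rep_hom G U Q" by (rule rep_hom_comp[OF fg(1) sq(2)])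
    have N: "rep_sub G Q ?N" by (rule rep_sub_image[OF linU linQ qf rep_sub_carrier[OF linU]])
    have fQ: "fd_rep G ?Q" by (rule fd_rep_sub[OF sq(8) N])
    define s' where "s' t = inv_into (carrier U) f (s t)" for t
    have s': "s' t \<in> carrier U" "f (s' t) = s t" if "t \<in> carrier S" for t
      using SU that inv_into_into[of "s t" f "carrier U"] f_inv_into_f[of "s t" f "carrier U"]
      by (simp_all add: s'_def)
    have sU: "s ` carrier S \<subseteq> f ` carrier U" using SU by blast
    have cU: "csub V (f ` carrier U)" using subU by (simp add: rep_sub_def)
    have s'lin: "s' \<in> linmap S U"
      unfolding s'_def
      by (rule linmap_inverse[OF spU spV rep_hom_linmap[OF fg(1)] fg(3) cU subset_refl
            rep_hom_linmap[OF sq(1)] sU spS])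
    have s'hom: "s' \<in> rep_hom G S U"
      unfolding rep_hom_iff
    proof (intro conjI s'lin ballI)
      fix k t assume kt: "k \<in> carrier G" "t \<in> carrier S"
      note cl = lin_rep.act_cl[OF linS kt] lin_rep.act_cl[OF linU kt(1) s'(1)[OF kt(2)]]
      show "s' (act S k t) = act U k (s' t)"
        by (rule inj_onD[OF fg(3)])
          (use kt cl s' in \<open>simp_all add: rep_homD(4)[OF fg(1)] rep_homD(4)[OF sq(1)]\<close>)
    qed
    have "short_exact G S U ?Q"
    proof (rule short_exactI[OF sq(6) fg(6) fQ s'hom])
      show "q \<circ> f \<in> rep_hom G U ?Q" using qf by (auto simp: rep_hom_def)
      show "inj_on s' (carrier S)"
      proof (rule inj_onI)
        fix t t' assume t: "t \<in> carrier S" "t' \<in> carrier S" "s' t = s' t'"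
        from arg_cong[OF t(3), of f] have "s t = s t'" by (simp add: s' t(1,2))
        then show "t = t'" by (rule inj_onD[OF sq(3) _ t(1,2)])
      qed
      show "s' ` carrier S = {u \<in> carrier U. (q \<circ> f) u = \<zero>\<^bsub>?Q\<^esub>}"
      proof (intro equalityI subsetI)
        fix u assume "u \<in> s' ` carrier S"
        then obtain t where t: "t \<in> carrier S" "u = s' t" by blast
        then have "q (s t) = \<zero>\<^bsub>Q\<^esub>" using kerq[OF sV] by blast
        then show "u \<in> {u \<in> carrier U. (q \<circ> f) u = \<zero>\<^bsub>?Q\<^esub>}" using t s' by simp
      next
        fix u assume u: "u \<in> {u \<in> carrier U. (q \<circ> f) u = \<zero>\<^bsub>?Q\<^esub>}"
        then have "f u \<in> s ` carrier S" using kerq[OF fV] by simp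
        then obtain t where t: "t \<in> carrier S" "f u = s t" by blast
        have "u = s' t"
          by (rule inj_onD[OF fg(3)]) (use u t(2) s'[OF t(1)] in simp_all)
        with t show "u \<in> s' ` carrier S" by blast
      qed
      show "(q \<circ> f) ` carrier U = carrier ?Q" by simp
    qed
    then have h1: "rep_has_class G ?Q (x - frag_of (irr_class G S))" by (rule short_exact.IH(1))
    have "short_exact G ?Q Q W"
    proof (rule short_exact_induced[OF fQ fg(7) sq(8) fg(8) sq(2,5) fg(2,5)])
      show "g v = \<zero>\<^bsub>W\<^esub>" if "v \<in> carrier V" "q v = \<zero>\<^bsub>Q\<^esub>" for v
        using that SU kerq[of v] kerg[of v] by blast
      have "?N \<subseteq> carrier Q" using N csubD(1) by (auto simp: rep_sub_def)
      then show "(\<lambda>z. z) \<in> rep_hom G ?Q Q" by (auto simp: rep_hom_def)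
      show "(\<lambda>z. z) ` carrier ?Q = q ` {v \<in> carrier V. g v = \<zero>\<^bsub>W\<^esub>}"
        by (simp only: sub_rep_simps image_ident image_comp[symmetric] fg(4))
    qed simp
    then have "rep_has_class G Q ((x - frag_of (irr_class G S)) + y)"
      by (rule rep_has_class_exact[OF _ h1 has_class_rep_has_class[OF short_exact.hyps(3)]])
    then show ?thesis by (simp add: algebra_simps)
  next
    assume SU: "\<forall>t\<in>carrier S. s t \<in> f ` carrier U \<longrightarrow> t = \<zero>\<^bsub>S\<^esub>"
    \<comment> \<open>Now g is injective on S. With R = W/S the induction hypothesis for W applies,
      while U still embeds in Q, with quotient R.\<close>
    have gs: "g \<circ> s \<in> rep_hom G S W" by (rule rep_hom_comp[OF sq(1) fg(2)])
    let ?N = "(g \<circ> s) ` carrier S"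
    have N: "rep_sub G W ?N" by (rule rep_sub_image[OF linS linW gs rep_sub_carrier[OF linS]])
    obtain R :: "'g model" and p where R: "fd_rep G R" "p \<in> rep_hom G W R"
      "p ` carrier W = carrier R" "\<forall>w\<in>carrier W. p w = \<zero>\<^bsub>R\<^esub> \<longleftrightarrow> w \<in> ?N"
      using quotient_model[OF fg(8) N] by blast
    note spR = fd_repD(2)[OF R(1)]
    have "short_exact G S W R"
    proof (rule short_exactI[OF sq(6) fg(8) R(1) gs R(2) _ _ R(3)])
      have "\<forall>t\<in>carrier S. (g \<circ> s) t = \<zero>\<^bsub>W\<^esub> \<longrightarrow> t = \<zero>\<^bsub>S\<^esub>"
        using SU kerg[OF sV] by simp
      then show "inj_on (g \<circ> s) (carrier S)"
        by (rule iffD2[OF inj_on_iff_kernel[OF spS spW rep_hom_linmap[OF gs]]])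
      have "?N \<subseteq> carrier W" using N csubD(1) by (auto simp: rep_sub_def)
      with R(4) show "?N = {w \<in> carrier W. p w = \<zero>\<^bsub>R\<^esub>}" by blast
    qed
    then have h2: "rep_has_class G R (y - frag_of (irr_class G S))" by (rule short_exact.IH(2))
    have pg: "p \<circ> g \<in> rep_hom G V R" by (rule rep_hom_comp[OF fg(2) R(2)])
    have gW: "g v \<in> carrier W" if "v \<in> carrier V" for v using rep_homD(1)[OF fg(2) that] .
    have qf: "q \<circ> f \<in> rep_hom G U Q" by (rule rep_hom_comp[OF fg(1) sq(2)])
    have pgR: "(p \<circ> g) ` carrier V = carrier R" by (simp only: image_comp[symmetric] fg(5) R(3))
    have "short_exact G U Q R"
    proof (rule short_exact_induced[OF fg(6,7) sq(8) R(1) sq(2,5) pg pgR _ qf])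
      show "(p \<circ> g) v = \<zero>\<^bsub>R\<^esub>" if v: "v \<in> carrier V" "q v = \<zero>\<^bsub>Q\<^esub>" for v
      proof -
        obtain t where "t \<in> carrier S" "v = s t" using kerq[OF v(1)] v(2) by blast
        then have "g v \<in> ?N" by auto
        then show ?thesis using R(4) gW[OF v(1)] by simp
      qed
      have "u = \<zero>\<^bsub>U\<^esub>" if u: "u \<in> carrier U" "(q \<circ> f) u = \<zero>\<^bsub>Q\<^esub>" for u
      proof -
        obtain t where t: "t \<in> carrier S" "f u = s t" using kerq[OF fV[OF u(1)]] u(2) by auto
        moreover have "s t \<in> f ` carrier U" using u(1) t(2) by (metis image_eqI)
        ultimately have "t = \<zero>\<^bsub>S\<^esub>" using SU by blast
        then have "f u = f \<zero>\<^bsub>U\<^esub>"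
          by (simp add: t rep_hom_zero[OF spS spV sq(1)] rep_hom_zero[OF spU spV fg(1)])
        then show ?thesis by (rule inj_onD[OF fg(3) _ u(1) complex_space.zero_cl[OF spU]])
      qed
      then show "inj_on (q \<circ> f) (carrier U)"
        by (intro iffD2[OF inj_on_iff_kernel[OF spU spQ rep_hom_linmap[OF qf]]]) blast
      show "(q \<circ> f) ` carrier U = q ` {v \<in> carrier V. (p \<circ> g) v = \<zero>\<^bsub>R\<^esub>}"
      proof (intro equalityI subsetI)
        fix z assume "z \<in> (q \<circ> f) ` carrier U"
        then obtain u where u: "u \<in> carrier U" "z = q (f u)" by auto
        then have "g (f u) = \<zero>\<^bsub>W\<^esub>" using kerg[OF fV] by blast
        then have "f u \<in> {v \<in> carrier V. (p \<circ> g) v = \<zero>\<^bsub>R\<^esub>}"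
          using u(1) fV by (simp add: rep_hom_zero[OF spW spR R(2)])
        with u(2) show "z \<in> q ` {v \<in> carrier V. (p \<circ> g) v = \<zero>\<^bsub>R\<^esub>}" by (rule image_eqI)
      next
        fix z assume "z \<in> q ` {v \<in> carrier V. (p \<circ> g) v = \<zero>\<^bsub>R\<^esub>}"
        then obtain v where v: "v \<in> carrier V" "z = q v" and "p (g v) = \<zero>\<^bsub>R\<^esub>" by auto
        then obtain t where t: "t \<in> carrier S" "g v = g (s t)" using R(4) gW[OF v(1)] by auto
        \<comment> \<open>Since g v = g (s t), the difference v - s t lies in the kernel of g, that
          is, in the image of U. It has the same image in Q as v, because q kills s t.\<close>
        let ?d = "v \<oplus>\<^bsub>V\<^esub> (-1) \<odot>\<^bsub>V\<^esub> s t"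
        interpret V: complex_space V by (rule spV)
        interpret W: complex_space W by (rule spW)
        interpret Q: complex_space Q by (rule spQ)
        have st: "(-1) \<odot>\<^bsub>V\<^esub> s t \<in> carrier V" "s t \<in> carrier V" using sV[OF t(1)]
          by (simp_all add: V.smult_cl)
        have d: "?d \<in> carrier V" using v(1) st by (simp add: V.add_cl)
        have "g ?d = \<zero>\<^bsub>W\<^esub>"
          using gW[OF st(2)] by (simp add: rep_homD(2)[OF fg(2) v(1) st(1)]
            rep_homD(3)[OF fg(2) st(2)] t(2) W.smult_m1_add)
        then obtain u where u: "u \<in> carrier U" "?d = f u" using kerg[OF d] by blast
        have "q (s t) = \<zero>\<^bsub>Q\<^esub>" using kerq[OF st(2)] t(1) by blast
        then have "q ?d = q v"
          using rep_homD(1)[OF sq(2) v(1)]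
          by (simp add: rep_homD(2)[OF sq(2) v(1) st(1)] rep_homD(3)[OF sq(2) st(2)] Q.smult_zero)
        then have "z = (q \<circ> f) u" using u v by simp
        then show "z \<in> (q \<circ> f) ` carrier U" using u(1) by (rule image_eqI)
      qed
    qed
    then have "rep_has_class G Q (x + (y - frag_of (irr_class G S)))"
      by (rule rep_has_class_exact[OF _ has_class_rep_has_class[OF short_exact.hyps(2)] h2])
    then show ?thesis by (simp add: algebra_simps)
  qed
qed

lemma rep_has_class_remove_simple:
  fixes V S Q :: "'g model"
  assumes "rep_has_class G V x" "irreducible_rep G S" "short_exact G S V Q"
  shows "rep_has_class G Q (x - frag_of (irr_class G S))"
proof -
  obtain M where M: "rep_iso G M V" "has_class G M x" using assms(1) by (auto simp: rep_has_class_def)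
  have fd: "fd_rep G S" "fd_rep G Q" using assms(3) by (simp_all add: short_exact_def)
  have "short_exact G S M Q"
    by (rule short_exact_iso[OF assms(3) fd(1) has_class_fd[OF M(2)] fd(2) rep_iso_refl M(1)
          rep_iso_refl])
  then show ?thesis by (rule has_class_remove_simple[OF M(2) assms(2)])
qed

section \<open>Existence and uniqueness of classes\<close>

lemma quotient_short_exact:
  fixes V :: "('g, 'a) rep"
  assumes V: "fd_rep G V" and B: "generates V B" and N: "rep_sub G V N" and N0: "N \<noteq> {\<zero>\<^bsub>V\<^esub>}"
  shows "\<exists>(Q :: 'g model) C. short_exact G (sub_rep V N) V Q \<and> generates Q C \<and> card C < card B"
proof -
  obtain Q :: "'g model" and p where Q: "fd_rep G Q" "p \<in> rep_hom G V Q"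
    "p ` carrier V = carrier Q" "\<forall>v\<in>carrier V. p v = \<zero>\<^bsub>Q\<^esub> \<longleftrightarrow> v \<in> N"
    using quotient_model[OF V N] by blast
  have c: "csub V N" using N by (simp add: rep_sub_def)
  note c = csubD[OF c]
  have "short_exact G (sub_rep V N) V Q"
  proof (rule short_exactI[OF fd_rep_sub[OF V N] V Q(1) _ Q(2) _ _ Q(3)])
    show "(\<lambda>v. v) \<in> rep_hom G (sub_rep V N) V" using c(5) by (auto simp: rep_hom_def)
    show "(\<lambda>v. v) ` carrier (sub_rep V N) = {v \<in> carrier V. p v = \<zero>\<^bsub>Q\<^esub>}"
      using Q(4) c(5) by auto
  qed simp
  moreover obtain u where u: "u \<in> N" "u \<noteq> \<zero>\<^bsub>V\<^esub>" using N0 c(2) by blast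
  ultimately show ?thesis
    using complex_space.gen_image_kernel[OF fd_repD(2)[OF V] fd_repD(2)[OF Q(1)]
        rep_hom_linmap[OF Q(2)] Q(3) B c(5)[OF u(1)] u(2)] Q(4) c(5)[OF u(1)] u(1) by blast
qed

lemma rep_sub_trans:
  assumes "rep_sub G V N" "rep_sub G (sub_rep V N) M"
  shows "rep_sub G V M"
  using assms by (auto simp: rep_sub_def csub_def)

text \<open>Descent through proper nonzero subrepresentations, each spanned by fewer elements than
  the one before.\<close>

lemma irreducible_sub_exists:
  assumes "fd_rep G V" "generates V B" "carrier V \<noteq> {\<zero>\<^bsub>V\<^esub>}"
  shows "\<exists>N. rep_sub G V N \<and> irreducible_rep G (sub_rep V N)"
  using assms
proof (induction "card B" arbitrary: V B rule: less_induct)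
  case less
  show ?case
  proof (cases "irreducible_rep G V")
    case True
    then show ?thesis
      using rep_sub_carrier[OF fd_repD(1)[OF less.prems(1)]] by (intro exI[of _ "carrier V"]) simp
  next
    case False
    then obtain N where N: "rep_sub G V N" "N \<noteq> {\<zero>\<^bsub>V\<^esub>}" "N \<noteq> carrier V"
      using less.prems by (auto simp: irreducible_rep_iff)
    then have "csub V N" by (simp add: rep_sub_def)
    then obtain C where C: "generates (sub_rep V N) C" "card C < card B"
      using gen_sub[OF fd_repD(2)[OF less.prems(1)] _ less.prems(2)] N(3) by blast
    obtain M where "rep_sub G (sub_rep V N) M" "irreducible_rep G (sub_rep (sub_rep V N) M)"
      using less.hyps[OF C(2) fd_rep_sub[OF less.prems(1) N(1)] C(1)] N(2) by auto
    with rep_sub_trans[OF N(1)] show ?thesis by auto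
  qed
qed

text \<open>For a simple submodule S, subtracting [S] from x and from y gives two classes of V/S,
  which is spanned by fewer elements; by induction they agree.\<close>

lemma rep_has_class_unique_model:
  fixes V :: "'g model"
  assumes "generates V B" "rep_has_class G V x" "rep_has_class G V y"
  shows "x = y"
  using assms
proof (induction "card B" arbitrary: V B x y rule: less_induct)
  case less
  have V: "fd_rep G V" using less.prems(2) by (simp add: rep_has_class_def)
  show ?case
  proof (cases "carrier V = {\<zero>\<^bsub>V\<^esub>}")
    case True
    then show ?thesis using rep_has_class_zero_unique less.prems(2,3) by blast
  next
    case False
    obtain N where N: "rep_sub G V N" "irreducible_rep G (sub_rep V N)"
      using irreducible_sub_exists[OF V less.prems(1) False] by blast
    then have "N \<noteq> {\<zero>\<^bsub>V\<^esub>}" by (auto simp: irreducible_rep_def)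
    then obtain Q :: "'g model" and C where
      Q: "short_exact G (sub_rep V N) V Q" "generates Q C" "card C < card B"
      using quotient_short_exact[OF V less.prems(1) N(1)] by blast
    from less.hyps[OF Q(3,2) rep_has_class_remove_simple[OF less.prems(2) N(2) Q(1)]
        rep_has_class_remove_simple[OF less.prems(3) N(2) Q(1)]]
    show ?thesis by simp
  qed
qed

text \<open>A V that is neither zero nor simple is an extension of two representations, each spanned
  by fewer elements than V.\<close>

lemma rep_has_class_exists_model:
  fixes V :: "'g model"
  assumes "fd_rep G V" "generates V B"
  shows "\<exists>x. rep_has_class G V x"
  using assms
proof (induction "card B" arbitrary: V B rule: less_induct)
  case less
  consider "carrier V = {\<zero>\<^bsub>V\<^esub>}" | "irreducible_rep G V"
    | N where "rep_sub G V N" "N \<noteq> {\<zero>\<^bsub>V\<^esub>}" "N \<noteq> carrier V"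
    using less.prems(1) by (auto simp: irreducible_rep_iff)
  then show ?case
  proof cases
    case 1
    then show ?thesis using rep_has_class_zero[OF less.prems(1)] by blast
  next
    case 2
    then show ?thesis using has_class_rep_has_class[OF has_class.irreducible] by blast
  next
    case (3 N)
    then have "csub V N" by (simp add: rep_sub_def)
    then obtain C where C: "generates (sub_rep V N) C" "card C < card B"
      using gen_sub[OF fd_repD(2)[OF less.prems(1)] _ less.prems(2)] 3(3) by blast
    obtain x where x: "rep_has_class G (sub_rep V N) x"
      using less.hyps[OF C(2) fd_rep_sub[OF less.prems(1) 3(1)] C(1)] by blast
    obtain Q :: "'g model" and D where
      Q: "short_exact G (sub_rep V N) V Q" "generates Q D" "card D < card B"
      using quotient_short_exact[OF less.prems 3(1,2)] by blast
    have "fd_rep G Q" using Q(1) by (simp add: short_exact_def)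
    then obtain y where "rep_has_class G Q y" using less.hyps[OF Q(3) _ Q(2)] by blast
    from rep_has_class_exact[OF Q(1) x this] show ?thesis by blast
  qed
qed

text \<open>Two models of V are isomorphic to each other, so both candidate classes become classes
  of one model, where uniqueness is known.\<close>

lemma rep_class_eqI:
  assumes "rep_has_class G V x"
  shows "rep_class G V = x"
  unfolding rep_class_def
proof (rule the_equality)
  show "\<exists>M. rep_iso G M V \<and> has_class G M x" using assms by (simp add: rep_has_class_def)
  fix y assume "\<exists>M. rep_iso G M V \<and> has_class G M y"
  then obtain N where N: "rep_iso G N V" "has_class G N y" by blast
  obtain M where M: "rep_iso G M V" "has_class G M x" and V: "fd_rep G V"
    using assms by (auto simp: rep_has_class_def)
  note fM = has_class_fd[OF M(2)] and fN = has_class_fd[OF N(2)]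
  have "rep_has_class G M y"
    by (rule rep_has_class_iso[OF has_class_rep_has_class[OF N(2)]
          rep_iso_trans[OF N(1) fd_rep_iso_sym[OF fM V M(1)]] fM])
  moreover obtain B where "generates M B" using fd_repD(3)[OF fM] by blast
  ultimately show "y = x" using rep_has_class_unique_model has_class_rep_has_class[OF M(2)] by blast
qed

lemma rep_has_class_rep_class:
  assumes "fd_rep G V"
  shows "rep_has_class G V (rep_class G V)"
proof -
  obtain M :: "'a model" where M: "fd_rep G M" "rep_iso G M V"
    using model_exists[OF assms] by blast
  obtain B where "generates M B" using fd_repD(3)[OF M(1)] by blast
  then obtain x where "rep_has_class G M x" using rep_has_class_exists_model[OF M(1)] by blast
  then have "rep_has_class G V x" by (rule rep_has_class_iso[OF _ M(2) assms])
  with rep_class_eqI[OF this] show ?thesis by simp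
qed

lemma rep_class_exact:
  assumes "short_exact G U V W"
  shows "rep_class G V = rep_class G U + rep_class G W"
proof -
  have "fd_rep G U" "fd_rep G W" using assms by (simp_all add: short_exact_def)
  then show ?thesis by (intro rep_class_eqI rep_has_class_exact[OF assms] rep_has_class_rep_class)
qed

lemma rep_class_iso:
  assumes "fd_rep G V" "fd_rep G W" "rep_iso G V W"
  shows "rep_class G W = rep_class G V"
  by (rule rep_class_eqI[OF rep_has_class_iso[OF rep_has_class_rep_class[OF assms(1)] assms(3,2)]])

lemma rep_class_zero: "\<lbrakk>fd_rep G V; carrier V = {\<zero>\<^bsub>V\<^esub>}\<rbrakk> \<Longrightarrow> rep_class G V = 0"
  by (rule rep_class_eqI[OF rep_has_class_zero])

lemma has_class_keys: "has_class G V x \<Longrightarrow> Poly_Mapping.keys x \<subseteq> irr_classes G"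
proof (induction rule: has_class.induct)
  case (short_exact U V W x y)
  then show ?case using Poly_Mapping.keys_add[of x y] by blast
qed (auto simp: irr_classes_def)

lemma rep_class_in_groth_ring:
  assumes "fd_rep G V"
  shows "rep_class G V \<in> carrier (groth_ring G)"
  using rep_has_class_rep_class[OF assms] has_class_keys
  by (auto simp: rep_has_class_def groth_ring_def free_Abelian_group_def)

text \<open>The negative in the ring is a definite description over its carrier, so membership of y
  is what identifies it with the negative of the coefficient family.\<close>

lemma groth_ring_minus:
  assumes "y \<in> carrier (groth_ring G)"
  shows "x \<ominus>\<^bsub>groth_ring G\<^esub> y = x - y"
proof -
  have "-y \<in> carrier (groth_ring G)"
    using assms by (simp add: groth_ring_def free_Abelian_group_def)
  then have "(THE z. z \<in> carrier (groth_ring G) \<and> y + z = 0 \<and> z + y = 0) = -y"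
    by (intro the_equality) (auto simp: eq_neg_iff_add_eq_0 add.commute)
  then have "\<ominus>\<^bsub>groth_ring G\<^esub> y = -y"
    by (simp add: a_inv_def m_inv_def) (simp add: groth_ring_def)
  then show ?thesis by (simp add: a_minus_def) (simp add: groth_ring_def)
qed

section \<open>Tensor products\<close>

lemma lookup_scale [simp]:
  "Poly_Mapping.lookup (Poly_Mapping.map ((*) c) x) k = (c::complex) * Poly_Mapping.lookup x k"
  by (simp add: Poly_Mapping.map.rep_eq when_def)

lemma keys_scale: "Poly_Mapping.keys (Poly_Mapping.map ((*) (c::complex)) x) \<subseteq> Poly_Mapping.keys x"
  by (auto simp: in_keys_iff)

lemma scale_single [simp]:
  "Poly_Mapping.map ((*) (c::complex)) (Poly_Mapping.single k a) = Poly_Mapping.single k (c * a)"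
  by (rule poly_mapping_eqI) (simp add: lookup_single when_def)

lemma scale_add:
  "Poly_Mapping.map ((*) (c::complex)) (x + y) =
     Poly_Mapping.map ((*) c) x + Poly_Mapping.map ((*) c) y"
  by (rule poly_mapping_eqI) (simp add: lookup_add algebra_simps)

lemma sum_keys_superset:
  assumes "finite A" "Poly_Mapping.keys x \<subseteq> A" "\<And>k. T k 0 = 0"
  shows "(\<Sum>k\<in>Poly_Mapping.keys x. T k (Poly_Mapping.lookup x k)) =
    (\<Sum>k\<in>A. T k (Poly_Mapping.lookup x k))"
  using assms by (intro sum.mono_neutral_left) (auto simp: in_keys_iff)

text \<open>Terms of x and y may cancel, so the supports do not simply unite; all three sums are
  extended to the union of the supports. The additivity of \<open>push\<close>,
  \<open>ext_map\<close> and \<open>ext_deriv\<close> comes from here.\<close>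

lemma sum_keys_add:
  fixes x y :: "'k \<Rightarrow>\<^sub>0 complex" and T :: "'k \<Rightarrow> complex \<Rightarrow> 'b::ab_group_add"
  assumes "\<And>k a b. T k (a + b) = T k a + T k b"
  shows "(\<Sum>k\<in>Poly_Mapping.keys (x + y). T k (Poly_Mapping.lookup (x + y) k)) =
    (\<Sum>k\<in>Poly_Mapping.keys x. T k (Poly_Mapping.lookup x k)) +
    (\<Sum>k\<in>Poly_Mapping.keys y. T k (Poly_Mapping.lookup y k))"
proof -
  let ?A = "Poly_Mapping.keys x \<union> Poly_Mapping.keys y"
  have T0: "T k 0 = 0" for k using assms[of k 0 0] by simp
  note sup = sum_keys_superset[where A = ?A and T = T, OF _ _ T0]
  show ?thesis
    unfolding sup[OF _ Poly_Mapping.keys_add, simplified] sup[of x, simplified]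
      sup[of y, simplified]
    by (simp add: lookup_add assms sum.distrib)
qed

lemma sum_keys_single:
  "T k 0 = 0 \<Longrightarrow> (\<Sum>j\<in>Poly_Mapping.keys (Poly_Mapping.single k a).
     T j (Poly_Mapping.lookup (Poly_Mapping.single k a) j)) = T k a"
  by (simp add: keys_single)

text \<open>The linear extension of a map between bases; the diagonal action on the free space on
  pairs has this form.\<close>

definition push :: "('k \<Rightarrow> 'l) \<Rightarrow> ('k \<Rightarrow>\<^sub>0 complex) \<Rightarrow> ('l \<Rightarrow>\<^sub>0 complex)" where
  "push f x = (\<Sum>k\<in>Poly_Mapping.keys x. Poly_Mapping.single (f k) (Poly_Mapping.lookup x k))"

lemma push_add: "push f (x + y) = push f x + push f y"
  unfolding push_def by (rule sum_keys_add) (simp add: single_add)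

lemma push_single [simp]: "push f (Poly_Mapping.single k a) = Poly_Mapping.single (f k) a"
  unfolding push_def
  by (rule sum_keys_single[where T = "\<lambda>k. Poly_Mapping.single (f k)"]) simp

lemma push_diff: "push f (x - y) = push f x - push f y"
  using push_add[of f "x - y" y] by simp

lemma push_push: "push f (push g x) = push (f \<circ> g) x"
  by (induction x rule: ext_coeffs_induct) (simp_all add: push_add)

lemma push_scale: "push f (Poly_Mapping.map ((*) c) x) = Poly_Mapping.map ((*) c) (push f x)"
  by (induction x rule: ext_coeffs_induct) (simp_all add: push_add scale_add)

lemma push_cong: "(\<And>k. k \<in> Poly_Mapping.keys x \<Longrightarrow> f k = g k) \<Longrightarrow> push f x = push g x"
  by (simp add: push_def)

lemma push_id: "push (\<lambda>k. k) x = x"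
  by (induction x rule: ext_coeffs_induct) (simp_all add: push_add)

lemma keys_push: "Poly_Mapping.keys (push f x) \<subseteq> f ` Poly_Mapping.keys x"
  using keys_sum[of "\<lambda>k. Poly_Mapping.single (f k) (Poly_Mapping.lookup x k)" "Poly_Mapping.keys x"]
  by (auto simp: push_def split: if_splits)

lemma sum_single_keys:
  fixes x :: "'k \<Rightarrow>\<^sub>0 complex"
  shows "(\<Sum>k\<in>Poly_Mapping.keys x. Poly_Mapping.single k (Poly_Mapping.lookup x k)) = x"
  using push_id[of x] by (simp add: push_def)

context complex_space
begin

text \<open>The linear map out of a free space that is prescribed on its basis. It serves for
  lifting bilinear maps and, later, for the inverse of the multiplication isomorphism.\<close>

definition lin_ext :: "('k \<Rightarrow> 'a) \<Rightarrow> ('k \<Rightarrow>\<^sub>0 complex) \<Rightarrow> 'a" where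
  "lin_ext b x = (\<Oplus>k\<in>Poly_Mapping.keys x. Poly_Mapping.lookup x k \<odot> b k)"

lemma lin_ext_superset:
  assumes "finite A" "Poly_Mapping.keys x \<subseteq> A" "\<And>k. k \<in> A \<Longrightarrow> b k \<in> carrier V"
  shows "lin_ext b x = (\<Oplus>k\<in>A. Poly_Mapping.lookup x k \<odot> b k)"
  unfolding lin_ext_def using assms
  by (intro M.add.finprod_mono_neutral_cong_left) (auto simp: in_keys_iff smult_0 smult_cl)

lemma lin_ext_closed:
  "(\<And>k. k \<in> Poly_Mapping.keys x \<Longrightarrow> b k \<in> carrier V) \<Longrightarrow> lin_ext b x \<in> carrier V"
  unfolding lin_ext_def by (intro finsum_closed) (auto intro: smult_cl)

lemma lin_ext_add:
  assumes "\<And>k. k \<in> Poly_Mapping.keys x \<union> Poly_Mapping.keys y \<Longrightarrow> b k \<in> carrier V"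
  shows "lin_ext b (x + y) = lin_ext b x \<oplus> lin_ext b y"
proof -
  let ?A = "Poly_Mapping.keys x \<union> Poly_Mapping.keys y"
  have "lin_ext b (x + y) = (\<Oplus>k\<in>?A. Poly_Mapping.lookup (x + y) k \<odot> b k)"
    by (rule lin_ext_superset) (use Poly_Mapping.keys_add[of x y] assms in auto)
  also have "\<dots> = (\<Oplus>k\<in>?A. Poly_Mapping.lookup x k \<odot> b k \<oplus> Poly_Mapping.lookup y k \<odot> b k)"
    using assms by (intro finsum_cong') (auto simp: lookup_add smult_add smult_cl add_cl)
  also have "\<dots> = (\<Oplus>k\<in>?A. Poly_Mapping.lookup x k \<odot> b k) \<oplus> (\<Oplus>k\<in>?A. Poly_Mapping.lookup y k \<odot> b k)"
    using assms by (intro finsum_addf) (auto simp: smult_cl)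
  also have "\<dots> = lin_ext b x \<oplus> lin_ext b y"
    using assms by (intro arg_cong2[where f = "(\<oplus>)"] lin_ext_superset[symmetric]) auto
  finally show ?thesis .
qed

lemma lin_ext_scale:
  assumes "\<And>k. k \<in> Poly_Mapping.keys x \<Longrightarrow> b k \<in> carrier V"
  shows "lin_ext b (Poly_Mapping.map ((*) c) x) = c \<odot> lin_ext b x"
proof -
  let ?A = "Poly_Mapping.keys x"
  have "lin_ext b (Poly_Mapping.map ((*) c) x) =
      (\<Oplus>k\<in>?A. Poly_Mapping.lookup (Poly_Mapping.map ((*) c) x) k \<odot> b k)"
    by (rule lin_ext_superset) (use keys_scale[of c x] assms in auto)
  also have "\<dots> = (\<Oplus>k\<in>?A. c \<odot> (Poly_Mapping.lookup x k \<odot> b k))"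
    using assms by (intro finsum_cong') (auto simp: smult_smult smult_cl)
  also have "\<dots> = c \<odot> lin_ext b x"
    unfolding lin_ext_def using assms
    by (intro finsum_smult_ldistr[symmetric]) (auto simp: smult_cl)
  finally show ?thesis .
qed

lemma lin_ext_single:
  assumes "b k \<in> carrier V"
  shows "lin_ext b (Poly_Mapping.single k a) = a \<odot> b k"
  using lin_ext_superset[of "{k}" "Poly_Mapping.single k a" b] assms
  by (simp add: smult_cl)

end

section \<open>The tensor product and its universal property\<close>

lemma free_pairs_simps [simp]:
  "carrier (free_pairs_rep V W) = {x. Poly_Mapping.keys x \<subseteq> carrier V \<times> carrier W}"
  "\<zero>\<^bsub>free_pairs_rep V W\<^esub> = 0" "x \<oplus>\<^bsub>free_pairs_rep V W\<^esub> y = x + y"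
  "c \<odot>\<^bsub>free_pairs_rep V W\<^esub> x = Poly_Mapping.map ((*) c) x"
  "act (free_pairs_rep V W) g x = push (\<lambda>(v, w). (act V g v, act W g w)) x"
  by (simp_all add: free_pairs_rep_def push_def case_prod_unfold)

lemma free_pairs_lin_rep:
  assumes "lin_rep G V" "lin_rep G W"
  shows "lin_rep G (free_pairs_rep V W)"
proof -
  interpret V: lin_rep G V by fact
  interpret W: lin_rep G W by fact
  let ?F = "free_pairs_rep V W"
  have "complex_space ?F"
  proof (rule complex_spaceI)
    show "x \<oplus>\<^bsub>?F\<^esub> y \<in> carrier ?F" if "x \<in> carrier ?F" "y \<in> carrier ?F" for x y
      using that Poly_Mapping.keys_add[of x y] by auto
    show "c \<odot>\<^bsub>?F\<^esub> x \<in> carrier ?F" if "x \<in> carrier ?F" for c x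
      using that keys_scale[of c x] by auto
  qed (auto simp: algebra_simps lookup_add intro!: poly_mapping_eqI)
  moreover have "lin_rep_axioms G ?F"
  proof
    fix g h x assume g: "g \<in> carrier G" and x: "x \<in> carrier ?F"
    then show "act ?F g x \<in> carrier ?F"
      using keys_push[of "\<lambda>(v, w). (act V g v, act W g w)" x]
      by (force simp: subset_iff V.act_cl W.act_cl)
    show "act ?F (g \<otimes>\<^bsub>G\<^esub> h) x = act ?F g (act ?F h x)" if "h \<in> carrier G"
      using x g that by (auto simp: push_push V.act_mult W.act_mult subset_iff intro!: push_cong)
  next
    fix x assume x: "x \<in> carrier ?F"
    have "push (\<lambda>(v, w). (act V \<one>\<^bsub>G\<^esub> v, act W \<one>\<^bsub>G\<^esub> w)) x = push (\<lambda>k. k) x"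
      using x by (intro push_cong) (auto simp: V.act_one W.act_one)
    then show "act ?F \<one>\<^bsub>G\<^esub> x = x" by (simp add: push_id)
  qed (simp_all add: push_add push_scale)
  ultimately show ?thesis by (simp add: lin_rep_def V.G.is_group)
qed

definition tensor_relations ::
  "('g, 'a) rep \<Rightarrow> ('g, 'b) rep \<Rightarrow> (('a \<times> 'b) \<Rightarrow>\<^sub>0 complex) set" where
  "tensor_relations V W =
     (\<lambda>N. submodule N complex_ring (free_pairs_rep V W)) hull bilinear_relations V W"

text \<open>The elementary tensor of v and w.\<close>

definition pure :: "('g, 'a) rep \<Rightarrow> ('g, 'b) rep \<Rightarrow> 'a \<Rightarrow> 'b \<Rightarrow> (('a \<times> 'b) \<Rightarrow>\<^sub>0 complex) set" where
  "pure V W v w =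
     tensor_relations V W +>\<^bsub>free_pairs_rep V W\<^esub> Poly_Mapping.single (v, w) 1"

lemma tensor_rep_eq: "tensor_rep V W = quot_rep (free_pairs_rep V W) (tensor_relations V W)"
  by (simp add: tensor_rep_def tensor_relations_def Let_def)

locale tensor = V: lin_rep G V + W: lin_rep G W
  for G :: "('g, 'm) monoid_scheme" and V :: "('g, 'a) rep" and W :: "('g, 'b) rep"
begin

abbreviation "F \<equiv> free_pairs_rep V W"
abbreviation "T \<equiv> tensor_rep V W"
abbreviation "N \<equiv> tensor_relations V W"
abbreviation "p \<equiv> \<lambda>x. N +>\<^bsub>F\<^esub> x"
abbreviation single where "single \<equiv> Poly_Mapping.single"

lemma F_lin_rep: "lin_rep G F"
  by (rule free_pairs_lin_rep) unfold_locales

sublocale F: lin_rep G F by (rule F_lin_rep)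

lemma diff_closed: "\<lbrakk>x \<in> carrier F; y \<in> carrier F\<rbrakk> \<Longrightarrow> x - y \<in> carrier F"
  using keys_diff[of x y] by auto

lemma single_closed: "\<lbrakk>v \<in> carrier V; w \<in> carrier W\<rbrakk> \<Longrightarrow> single (v, w) c \<in> carrier F"
  by (simp add: keys_single)

lemma bilinear_relations_closed: "bilinear_relations V W \<subseteq> carrier F"
  unfolding bilinear_relations_def
  by (auto simp del: free_pairs_simps
      intro!: diff_closed single_closed V.add_cl W.add_cl V.smult_cl W.smult_cl)

lemma relations_minimal:
  "\<lbrakk>csub F M; bilinear_relations V W \<subseteq> M\<rbrakk> \<Longrightarrow> N \<subseteq> M"
  unfolding tensor_relations_def by (rule hull_minimal) (simp_all add: F.submodule_iff_csub)

lemma csub_relations: "csub F N"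
  unfolding tensor_relations_def hull_def
  by (rule F.csub_Inter)
    (use F.submodule_iff_csub F.csub_carrier bilinear_relations_closed in blast)+

lemma relations_subset: "bilinear_relations V W \<subseteq> N"
  unfolding tensor_relations_def by (rule hull_subset)

lemma act_linmap: "g \<in> carrier G \<Longrightarrow> act F g \<in> linmap F F"
  by (rule linmapI) (simp_all only: F.act_cl F.act_add F.act_smult)

text \<open>The group maps each bilinearity relation to a relation of the same kind. So the preimage
  of N under the action is a subspace that contains all relations, and N, being the smallest such
  subspace, lies in it.\<close>

lemma rep_sub_relations: "rep_sub G F N"
  unfolding rep_sub_def
proof (intro conjI csub_relations ballI)
  fix g x assume g: "g \<in> carrier G" and "x \<in> N"
  have "N \<subseteq> {x \<in> carrier F. act F g x \<in> N}"
  proof (rule relations_minimal)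
    show "csub F {x \<in> carrier F. act F g x \<in> N}"
      by (rule F.csub_preimage[OF F.complex_space_axioms act_linmap[OF g] csub_relations])
    have "act F g r \<in> bilinear_relations V W" if "r \<in> bilinear_relations V W" for r
      using that g unfolding bilinear_relations_def
      by (elim UnE CollectE exE conjE)
        (simp_all add: push_diff V.act_add W.act_add V.act_smult W.act_smult,
          (metis V.act_cl W.act_cl)+)
    then show "bilinear_relations V W \<subseteq> {x \<in> carrier F. act F g x \<in> N}"
      using bilinear_relations_closed relations_subset by blast
  qed
  with \<open>x \<in> N\<close> show "act F g x \<in> N" by blast
qed

lemmas proj = quot_rep_proj[OF F_lin_rep rep_sub_relations, folded tensor_rep_eq]

sublocale T: lin_rep G T by (rule proj(5))

text \<open>Both additivity relations have the shape a - b - c; the case c = 0 covers the two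
  scaling relations.\<close>

lemma proj_relation:
  assumes "a - b - c \<in> bilinear_relations V W" "b \<in> carrier F" "c \<in> carrier F"
  shows "p a = p b \<oplus>\<^bsub>T\<^esub> p c"
proof -
  let ?r = "a - b - c"
  have r: "?r \<in> N" "?r \<in> carrier F"
    using assms(1) relations_subset bilinear_relations_closed by blast+
  have bc: "b + c \<in> carrier F" using F.add_cl[OF assms(2,3)] by simp
  have "p a = p (?r \<oplus>\<^bsub>F\<^esub> (b \<oplus>\<^bsub>F\<^esub> c))" by simp
  also have "\<dots> = p ?r \<oplus>\<^bsub>T\<^esub> (p b \<oplus>\<^bsub>T\<^esub> p c)"
    using rep_homD(2)[OF proj(1) r(2) F.add_cl[OF assms(2,3)]]
      rep_homD(2)[OF proj(1) assms(2,3)] by (simp only:)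
  also have "p ?r = \<zero>\<^bsub>T\<^esub>" using proj(4)[OF r(2)] r(1) by blast
  finally show ?thesis
    using T.add_cl[OF rep_homD(1)[OF proj(1) assms(2)] rep_homD(1)[OF proj(1) assms(3)]] by simp
qed

lemma proj_zero: "p 0 = \<zero>\<^bsub>T\<^esub>"
  using proj(3) by simp

lemma proj_relation2:
  assumes "a - b \<in> bilinear_relations V W" "b \<in> carrier F"
  shows "p a = p b"
  using proj_relation[of a b 0] assms F.zero_cl rep_homD(1)[OF proj(1) assms(2)]
  by (simp add: proj_zero del: quot_rep_simps)

lemma pure_closed: "\<lbrakk>v \<in> carrier V; w \<in> carrier W\<rbrakk> \<Longrightarrow> pure V W v w \<in> carrier T"
  unfolding pure_def by (rule rep_homD(1)[OF proj(1) single_closed])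

lemma pure_add_left:
  assumes "v \<in> carrier V" "v' \<in> carrier V" "w \<in> carrier W"
  shows "pure V W (v \<oplus>\<^bsub>V\<^esub> v') w = pure V W v w \<oplus>\<^bsub>T\<^esub> pure V W v' w"
  unfolding pure_def using assms
  by (intro proj_relation single_closed) (auto simp: bilinear_relations_def)

lemma pure_add_right:
  assumes "v \<in> carrier V" "w \<in> carrier W" "w' \<in> carrier W"
  shows "pure V W v (w \<oplus>\<^bsub>W\<^esub> w') = pure V W v w \<oplus>\<^bsub>T\<^esub> pure V W v w'"
  unfolding pure_def using assms
  by (intro proj_relation single_closed) (auto simp: bilinear_relations_def)

lemma proj_single:
  assumes "v \<in> carrier V" "w \<in> carrier W"
  shows "p (single (v, w) c) = c \<odot>\<^bsub>T\<^esub> pure V W v w"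
  using rep_homD(3)[OF proj(1) single_closed[OF assms], of c 1] by (simp add: pure_def)

lemma pure_smult_left:
  assumes "v \<in> carrier V" "w \<in> carrier W"
  shows "pure V W (c \<odot>\<^bsub>V\<^esub> v) w = c \<odot>\<^bsub>T\<^esub> pure V W v w"
proof -
  have "pure V W (c \<odot>\<^bsub>V\<^esub> v) w = p (single (v, w) c)"
    unfolding pure_def using assms
    by (intro proj_relation2 single_closed) (auto simp: bilinear_relations_def)
  then show ?thesis by (simp only: proj_single[OF assms])
qed

lemma pure_smult_right:
  assumes "v \<in> carrier V" "w \<in> carrier W"
  shows "pure V W v (c \<odot>\<^bsub>W\<^esub> w) = c \<odot>\<^bsub>T\<^esub> pure V W v w"
proof -
  have "pure V W v (c \<odot>\<^bsub>W\<^esub> w) = p (single (v, w) c)"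
    unfolding pure_def using assms
    by (intro proj_relation2 single_closed) (auto simp: bilinear_relations_def)
  then show ?thesis by (simp only: proj_single[OF assms])
qed

lemma pure_act:
  assumes "g \<in> carrier G" "v \<in> carrier V" "w \<in> carrier W"
  shows "act T g (pure V W v w) = pure V W (act V g v) (act W g w)"
  unfolding pure_def rep_homD(4)[OF proj(1) single_closed[OF assms(2,3)] assms(1), symmetric]
  by simp

lemma pure_zero_left: "w \<in> carrier W \<Longrightarrow> pure V W \<zero>\<^bsub>V\<^esub> w = \<zero>\<^bsub>T\<^esub>"
  using pure_smult_left[OF V.zero_cl, of w 0] pure_closed[OF V.zero_cl, of w]
  by (simp only: V.smult_zero T.smult_0)

lemma pure_zero_right: "v \<in> carrier V \<Longrightarrow> pure V W v \<zero>\<^bsub>W\<^esub> = \<zero>\<^bsub>T\<^esub>"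
  using pure_smult_right[OF _ W.zero_cl, of v 0] pure_closed[OF _ W.zero_cl, of v]
  by (simp only: W.smult_zero T.smult_0)

text \<open>The preimage of M in the free space contains every multiple of a pair, hence every
  finite sum of such multiples. Statements about the tensor product are thereby reduced to
  elementary tensors.\<close>

lemma tensor_span:
  assumes M: "csub T M" and pures: "\<And>v w. \<lbrakk>v \<in> carrier V; w \<in> carrier W\<rbrakk> \<Longrightarrow> pure V W v w \<in> M"
  shows "carrier T \<subseteq> M"
proof -
  let ?P = "{x \<in> carrier F. p x \<in> M}"
  have P: "csub F ?P"
    by (rule F.csub_preimage[OF T.complex_space_axioms rep_hom_linmap[OF proj(1)] M])
  have "x \<in> ?P" if x: "x \<in> carrier F" for x
  proof -
    have single: "single k c \<in> ?P" if "k \<in> carrier V \<times> carrier W" for k c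
      using that pures csubD(4)[OF M] single_closed proj_single by (cases k) fastforce
    have "(\<Sum>k\<in>A. single k (Poly_Mapping.lookup x k)) \<in> ?P"
      if "finite A" "A \<subseteq> Poly_Mapping.keys x" for A
      using that
    proof (induction A rule: finite_induct)
      case empty
      then show ?case using csubD(2)[OF P] by simp
    next
      case (insert k A)
      then have "single k (Poly_Mapping.lookup x k) \<in> ?P" using single x by auto
      with insert have "single k (Poly_Mapping.lookup x k) \<oplus>\<^bsub>F\<^esub>
          (\<Sum>k\<in>A. single k (Poly_Mapping.lookup x k)) \<in> ?P"
        by (intro csubD(3)[OF P]) simp_all
      with insert.hyps show ?case by simp
    qed
    from this[of "Poly_Mapping.keys x"] show ?thesis by (simp add: sum_single_keys)
  qed
  then show ?thesis unfolding proj(2)[symmetric] by blast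
qed

lemma tensor_ext:
  assumes Z: "complex_space Z" and h: "h \<in> linmap T Z" "h' \<in> linmap T Z"
    and eq: "\<And>v w. \<lbrakk>v \<in> carrier V; w \<in> carrier W\<rbrakk> \<Longrightarrow> h (pure V W v w) = h' (pure V W v w)"
    and x: "x \<in> carrier T"
  shows "h x = h' x"
proof -
  have "csub T {x \<in> carrier T. h x = h' x}" by (rule T.csub_equalizer[OF Z h])
  then have "carrier T \<subseteq> {x \<in> carrier T. h x = h' x}"
    by (rule tensor_span) (use eq pure_closed in blast)
  with x show ?thesis by blast
qed

lemma tensor_rep_homI:
  assumes "lin_rep G Z" and h: "h \<in> linmap T Z"
    and eq: "\<And>g v w. \<lbrakk>g \<in> carrier G; v \<in> carrier V; w \<in> carrier W\<rbrakk> \<Longrightarrow>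
      h (pure V W (act V g v) (act W g w)) = act Z g (h (pure V W v w))"
  shows "h \<in> rep_hom G T Z"
proof -
  interpret Z: lin_rep G Z by fact
  have "h (act T g x) = act Z g (h x)" if g: "g \<in> carrier G" and x: "x \<in> carrier T" for g x
  proof (rule tensor_ext[OF Z.complex_space_axioms _ _ _ x])
    show "(\<lambda>x. h (act T g x)) \<in> linmap T Z"
      by (rule linmapI)
        (simp_all only: T.act_cl[OF g] T.act_add[OF g] T.act_smult[OF g] linmapD[OF h])
    show "(\<lambda>x. act Z g (h x)) \<in> linmap T Z"
      by (rule linmapI)
        (simp_all only: Z.act_cl[OF g] Z.act_add[OF g] Z.act_smult[OF g] linmapD[OF h])
    fix v w assume "v \<in> carrier V" "w \<in> carrier W"
    then show "h (act T g (pure V W v w)) = act Z g (h (pure V W v w))"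
      by (simp only: pure_act[OF g] eq[OF g])
  qed
  with h show ?thesis by (simp add: rep_hom_iff)
qed

text \<open>The linear extension of b to the free space kills the four kinds of relations, so the
  subspace generated by them lies in its kernel and the extension factors through the
  quotient.\<close>

lemma tensor_lift:
  assumes Z: "complex_space Z"
    and cl: "\<And>v w. \<lbrakk>v \<in> carrier V; w \<in> carrier W\<rbrakk> \<Longrightarrow> b v w \<in> carrier Z"
    and add: "\<And>v v' w. \<lbrakk>v \<in> carrier V; v' \<in> carrier V; w \<in> carrier W\<rbrakk> \<Longrightarrow>
      b (v \<oplus>\<^bsub>V\<^esub> v') w = b v w \<oplus>\<^bsub>Z\<^esub> b v' w"
      "\<And>v w w'. \<lbrakk>v \<in> carrier V; w \<in> carrier W; w' \<in> carrier W\<rbrakk> \<Longrightarrow>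
      b v (w \<oplus>\<^bsub>W\<^esub> w') = b v w \<oplus>\<^bsub>Z\<^esub> b v w'"
    and smult: "\<And>c v w. \<lbrakk>v \<in> carrier V; w \<in> carrier W\<rbrakk> \<Longrightarrow> b (c \<odot>\<^bsub>V\<^esub> v) w = c \<odot>\<^bsub>Z\<^esub> b v w"
      "\<And>c v w. \<lbrakk>v \<in> carrier V; w \<in> carrier W\<rbrakk> \<Longrightarrow> b v (c \<odot>\<^bsub>W\<^esub> w) = c \<odot>\<^bsub>Z\<^esub> b v w"
  shows "\<exists>h\<in>linmap T Z. \<forall>v\<in>carrier V. \<forall>w\<in>carrier W. h (pure V W v w) = b v w"
proof -
  interpret Z: complex_space Z by fact
  define l where "l = Z.lin_ext (case_prod b)"
  have l: "l \<in> linmap F Z"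
    unfolding l_def
    by (rule linmapI) (auto intro!: Z.lin_ext_closed Z.lin_ext_add Z.lin_ext_scale cl dest: subsetD)
  have ls: "l (single (v, w) c) = c \<odot>\<^bsub>Z\<^esub> b v w" if "v \<in> carrier V" "w \<in> carrier W" for v w c
    unfolding l_def using Z.lin_ext_single[of "case_prod b" "(v, w)" c] cl that by simp
  have diff: "l (x - y) = l x \<oplus>\<^bsub>Z\<^esub> (-1) \<odot>\<^bsub>Z\<^esub> l y" if "x \<in> carrier F" "y \<in> carrier F" for x y
  proof -
    have "x - y = x \<oplus>\<^bsub>F\<^esub> (-1) \<odot>\<^bsub>F\<^esub> y"
      by (rule poly_mapping_eqI) (simp add: lookup_add lookup_minus)
    then show ?thesis
      using linmapD(2)[OF l that(1) F.smult_cl[OF that(2)]] linmapD(3)[OF l that(2)] by (simp only:)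
  qed
  have aux: "(x \<oplus>\<^bsub>Z\<^esub> y) \<oplus>\<^bsub>Z\<^esub> (-1) \<odot>\<^bsub>Z\<^esub> x \<oplus>\<^bsub>Z\<^esub> (-1) \<odot>\<^bsub>Z\<^esub> y = \<zero>\<^bsub>Z\<^esub>"
    if "x \<in> carrier Z" "y \<in> carrier Z" for x y
    using that Z.add_combination[of x y "(-1) \<odot>\<^bsub>Z\<^esub> x" "(-1) \<odot>\<^bsub>Z\<^esub> y"]
    by (simp add: Z.M.a_assoc Z.smult_cl Z.smult_m1_add Z.add_cl)
  have "N \<subseteq> {x \<in> carrier F. l x = \<zero>\<^bsub>Z\<^esub>}"
  proof (rule relations_minimal[OF F.csub_kernel[OF Z l]])
    have "l r = \<zero>\<^bsub>Z\<^esub>" if "r \<in> bilinear_relations V W" for r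
      using that unfolding bilinear_relations_def
      by (elim UnE CollectE exE conjE)
        (simp_all add: diff diff_closed single_closed ls V.add_cl W.add_cl V.smult_cl W.smult_cl
          add smult cl Z.smult_1 Z.smult_cl aux Z.add_cl Z.smult_m1_add
          del: free_pairs_simps)
    with bilinear_relations_closed
    show "bilinear_relations V W \<subseteq> {x \<in> carrier F. l x = \<zero>\<^bsub>Z\<^esub>}" by blast
  qed
  then have ker: "l x = \<zero>\<^bsub>Z\<^esub>" if "x \<in> carrier F" "p x = \<zero>\<^bsub>T\<^esub>" for x
    using proj(4)[OF that(1)] that(2) by blast
  obtain h where h: "h \<in> linmap T Z" "\<forall>x\<in>carrier F. h (p x) = l x"
    using linmap_factor[OF F.complex_space_axioms Z rep_hom_linmap[OF proj(1)] proj(2)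
        T.complex_space_axioms l ker] by blast
  have "h (pure V W v w) = b v w" if "v \<in> carrier V" "w \<in> carrier W" for v w
    unfolding pure_def using bspec[OF h(2) single_closed[OF that, of 1]] ls[OF that, of 1] cl[OF that]
    by (simp add: Z.smult_1)
  with h(1) show ?thesis by blast
qed

text \<open>Bilinearity is used in one variable at a time: first v ranges over the span of B with w
  in C, then w ranges over the span of C with v arbitrary.\<close>

lemma gen_tensor:
  assumes B: "generates V B" and C: "generates W C"
  shows "generates T (case_prod (pure V W) ` (B \<times> C))"
  unfolding generates_def
proof (intro conjI allI impI)
  have BC: "B \<subseteq> carrier V" "C \<subseteq> carrier W" using B C by (simp_all add: generates_def)
  show "finite (case_prod (pure V W) ` (B \<times> C))" using B C by (simp add: generates_def)
  show "case_prod (pure V W) ` (B \<times> C) \<subseteq> carrier T"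
    by (auto intro!: pure_closed dest: subsetD[OF BC(1)] subsetD[OF BC(2)])
  fix M assume M: "csub T M \<and> case_prod (pure V W) ` (B \<times> C) \<subseteq> M"
  then have cM: "csub T M" by blast
  note M' = csubD[OF cM]
  have "carrier V \<subseteq> {v \<in> carrier V. \<forall>w\<in>C. pure V W v w \<in> M}"
  proof (rule genD[OF B])
    show "csub V {v \<in> carrier V. \<forall>w\<in>C. pure V W v w \<in> M}"
      using BC M'(2-4) unfolding csub_def
      by (auto simp: pure_zero_left pure_add_left pure_smult_left V.zero_cl V.add_cl V.smult_cl
          subset_iff simp del: quot_rep_simps)
  qed (use BC M in auto)
  then have "carrier W \<subseteq> {w \<in> carrier W. \<forall>v\<in>carrier V. pure V W v w \<in> M}"
    using BC M'(2-4) by (intro genD[OF C])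
      (auto simp: csub_def pure_zero_right pure_add_right pure_smult_right W.zero_cl W.add_cl
        W.smult_cl subset_iff simp del: quot_rep_simps)
  then show "carrier T \<subseteq> M" by (intro tensor_span[OF cM]) blast
qed

end

lemma fd_rep_tensor:
  assumes "fd_rep G V" "fd_rep G W"
  shows "fd_rep G (tensor_rep V W)"
proof -
  interpret tensor G V W using assms by (simp add: tensor_def fd_repD(1))
  obtain B C where "generates V B" "generates W C"
    using fd_repD(3)[OF assms(1)] fd_repD(3)[OF assms(2)] by blast
  from gen_tensor[OF this] T.lin_rep_axioms show ?thesis unfolding fd_rep_iff by blast
qed

text \<open>Functoriality is stated for maps that are merely linear, because the splitting of a
  short exact sequence need not be equivariant.\<close>

lemma tensor_map:
  assumes "lin_rep G V" "lin_rep G W" "lin_rep G V'" "lin_rep G W'"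
    and f: "f \<in> linmap V V'" and g: "g \<in> linmap W W'"
  shows "\<exists>h\<in>linmap (tensor_rep V W) (tensor_rep V' W').
    \<forall>v\<in>carrier V. \<forall>w\<in>carrier W. h (pure V W v w) = pure V' W' (f v) (g w)"
proof -
  interpret A: tensor G V W using assms by (simp add: tensor_def)
  interpret B: tensor G V' W' using assms by (simp add: tensor_def)
  show ?thesis
    by (rule A.tensor_lift[OF B.T.complex_space_axioms])
      (simp_all only: linmapD[OF f] linmapD[OF g] B.pure_closed B.pure_add_left B.pure_add_right
        B.pure_smult_left B.pure_smult_right)
qed

lemma tensor_map_equivariant:
  assumes "lin_rep G V" "lin_rep G W" "lin_rep G V'" "lin_rep G W'"
    and f: "f \<in> rep_hom G V V'" and g: "g \<in> rep_hom G W W'"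
    and h: "h \<in> linmap (tensor_rep V W) (tensor_rep V' W')"
    and eq: "\<And>v w. \<lbrakk>v \<in> carrier V; w \<in> carrier W\<rbrakk> \<Longrightarrow> h (pure V W v w) = pure V' W' (f v) (g w)"
  shows "h \<in> rep_hom G (tensor_rep V W) (tensor_rep V' W')"
proof -
  interpret A: tensor G V W using assms by (simp add: tensor_def)
  interpret B: tensor G V' W' using assms by (simp add: tensor_def)
  show ?thesis
    by (rule A.tensor_rep_homI[OF B.T.lin_rep_axioms h])
      (simp only: eq A.V.act_cl A.W.act_cl B.pure_act rep_homD[OF f] rep_homD[OF g])
qed

section \<open>Exactness and symmetry of the tensor product\<close>

lemma linmap_id: "(\<lambda>v. v) \<in> linmap V V"
  by (simp add: linmap_def)

lemma linmap_add:
  assumes "complex_space W" "f \<in> linmap V W" "g \<in> linmap V W"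
  shows "(\<lambda>v. f v \<oplus>\<^bsub>W\<^esub> g v) \<in> linmap V W"
proof -
  interpret W: complex_space W by fact
  show ?thesis
    by (rule linmapI)
      (simp_all add: linmapD[OF assms(2)] linmapD[OF assms(3)] W.add_cl W.smult_add_right
        W.add_combination)
qed

text \<open>The identities r f = 1 and f r + s g = 1 of a linear splitting survive tensoring with Y.
  The first gives injectivity; the second shows that an element killed by H is F of its image under
  R. Only F and H have to be equivariant.\<close>

lemma tensor_exact_left:
  assumes ex: "short_exact G U V W" and Y: "fd_rep G Y"
  shows "short_exact G (tensor_rep U Y) (tensor_rep V Y) (tensor_rep W Y)"
proof -
  obtain f g where fg: "f \<in> rep_hom G U V" "g \<in> rep_hom G V W" "inj_on f (carrier U)"
    "f ` carrier U = {v \<in> carrier V. g v = \<zero>\<^bsub>W\<^esub>}" "g ` carrier V = carrier W"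
    "fd_rep G U" "fd_rep G V" "fd_rep G W"
    using ex by (rule short_exactE)
  note lin = fd_repD(1)[OF Y] fg(6-8)[THEN fd_repD(1)]
  note f = rep_hom_linmap[OF fg(1)] and g = rep_hom_linmap[OF fg(2)]
  interpret U: tensor G U Y using lin by (simp add: tensor_def)
  interpret V: tensor G V Y using lin by (simp add: tensor_def)
  interpret W: tensor G W Y using lin by (simp add: tensor_def)
  obtain B where B: "generates V B" using fd_repD(3)[OF fg(7)] by blast
  obtain r s where rs: "r \<in> linmap V U" "s \<in> linmap W V" "\<forall>u\<in>carrier U. r (f u) = u"
    "\<forall>v\<in>carrier V. f (r v) \<oplus>\<^bsub>V\<^esub> s (g v) = v"
    using linear_splitting[OF U.V.complex_space_axioms V.V.complex_space_axioms
        W.V.complex_space_axioms B f g fg(3,5,4)] by blast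
  have gf: "g (f u) = \<zero>\<^bsub>W\<^esub>" if "u \<in> carrier U" for u
  proof -
    have "f u \<in> f ` carrier U" using that by (rule imageI)
    then show ?thesis unfolding fg(4) by blast
  qed
  obtain F where F: "F \<in> linmap U.T V.T"
    "\<And>u x. \<lbrakk>u \<in> carrier U; x \<in> carrier Y\<rbrakk> \<Longrightarrow> F (pure U Y u x) = pure V Y (f u) x"
    using tensor_map[OF lin(2,1,3,1) f linmap_id] by blast
  obtain H where H: "H \<in> linmap V.T W.T"
    "\<And>v x. \<lbrakk>v \<in> carrier V; x \<in> carrier Y\<rbrakk> \<Longrightarrow> H (pure V Y v x) = pure W Y (g v) x"
    using tensor_map[OF lin(3,1,4,1) g linmap_id] by blast
  obtain R where R: "R \<in> linmap V.T U.T"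
    "\<And>v x. \<lbrakk>v \<in> carrier V; x \<in> carrier Y\<rbrakk> \<Longrightarrow> R (pure V Y v x) = pure U Y (r v) x"
    using tensor_map[OF lin(3,1,2,1) rs(1) linmap_id] by blast
  obtain S where S: "S \<in> linmap W.T V.T"
    "\<And>w x. \<lbrakk>w \<in> carrier W; x \<in> carrier Y\<rbrakk> \<Longrightarrow> S (pure W Y w x) = pure V Y (s w) x"
    using tensor_map[OF lin(4,1,3,1) rs(2) linmap_id] by blast
  have idY: "(\<lambda>x. x) \<in> rep_hom G Y Y" by (simp add: rep_hom_def)
  have Fhom: "F \<in> rep_hom G U.T V.T"
    by (rule tensor_map_equivariant[OF lin(2,1,3,1) fg(1) idY F])
  have Hhom: "H \<in> rep_hom G V.T W.T"
    by (rule tensor_map_equivariant[OF lin(3,1,4,1) fg(2) idY H])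
  have RF: "R (F z) = z" if "z \<in> carrier U.T" for z
  proof -
    have "(R \<circ> F) z = z"
      by (rule U.tensor_ext[OF U.T.complex_space_axioms linmap_comp[OF F(1) R(1)] linmap_id _ that])
        (simp add: F(2) R(2) rs(3) linmapD(1)[OF f])
    then show ?thesis by simp
  qed
  have HF: "H (F z) = \<zero>\<^bsub>W.T\<^esub>" if "z \<in> carrier U.T" for z
  proof -
    have "(\<lambda>_. \<zero>\<^bsub>W.T\<^esub>) \<in> linmap U.T W.T"
      by (rule linmapI) (simp_all only: W.T.zero_cl W.T.smult_zero W.T.M.l_zero)
    then have "(H \<circ> F) z = \<zero>\<^bsub>W.T\<^esub>"
      by (rule U.tensor_ext[OF W.T.complex_space_axioms linmap_comp[OF F(1) H(1)] _ _ that])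
        (simp only: F(2) H(2) gf o_apply linmapD(1)[OF f] W.pure_zero_left)
    then show ?thesis by simp
  qed
  have split: "F (R z) \<oplus>\<^bsub>V.T\<^esub> S (H z) = z" if "z \<in> carrier V.T" for z
  proof -
    have "(F \<circ> R) z \<oplus>\<^bsub>V.T\<^esub> (S \<circ> H) z = z"
    proof (rule V.tensor_ext[OF V.T.complex_space_axioms linmap_add[OF V.T.complex_space_axioms
            linmap_comp[OF R(1) F(1)] linmap_comp[OF H(1) S(1)]] linmap_id _ that])
      fix v x assume vx: "v \<in> carrier V" "x \<in> carrier Y"
      have "(F \<circ> R) (pure V Y v x) \<oplus>\<^bsub>V.T\<^esub> (S \<circ> H) (pure V Y v x) =
          pure V Y (f (r v)) x \<oplus>\<^bsub>V.T\<^esub> pure V Y (s (g v)) x"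
        using vx by (simp only: F(2) R(2) S(2) H(2) o_apply linmapD(1)[OF rs(1)] linmapD(1)[OF g])
      also have "\<dots> = pure V Y (f (r v) \<oplus>\<^bsub>V\<^esub> s (g v)) x"
        using vx by (intro V.pure_add_left[symmetric])
          (simp_all only: linmapD(1)[OF rs(1)] linmapD(1)[OF g] linmapD(1)[OF f] linmapD(1)[OF rs(2)])
      also have "f (r v) \<oplus>\<^bsub>V\<^esub> s (g v) = v" using vx rs(4) by blast
      finally show "(F \<circ> R) (pure V Y v x) \<oplus>\<^bsub>V.T\<^esub> (S \<circ> H) (pure V Y v x) = pure V Y v x" .
    qed
    then show ?thesis by simp
  qed
  show ?thesis
  proof (rule short_exactI[OF fg(6-8)[THEN fd_rep_tensor[OF _ Y]] Fhom Hhom])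
    show "inj_on F (carrier U.T)" using RF by (rule inj_on_inverseI)
    show "F ` carrier U.T = {z \<in> carrier V.T. H z = \<zero>\<^bsub>W.T\<^esub>}"
    proof (intro equalityI subsetI)
      fix z assume "z \<in> F ` carrier U.T"
      then show "z \<in> {z \<in> carrier V.T. H z = \<zero>\<^bsub>W.T\<^esub>}" using HF linmapD(1)[OF F(1)] by blast
    next
      fix z assume "z \<in> {z \<in> carrier V.T. H z = \<zero>\<^bsub>W.T\<^esub>}"
      then have z: "z \<in> carrier V.T" "H z = \<zero>\<^bsub>W.T\<^esub>" by blast+
      have FR: "F (R z) \<in> carrier V.T" using linmapD(1)[OF F(1) linmapD(1)[OF R(1) z(1)]] .
      have "z = F (R z)"
        using split[OF z(1)] z(2) FR
          linmap_zero[OF W.T.complex_space_axioms V.T.complex_space_axioms S(1)]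
        by (simp only: V.T.M.r_zero)
      then show "z \<in> F ` carrier U.T" using linmapD(1)[OF R(1) z(1)] by (rule image_eqI)
    qed
    have "carrier W.T \<subseteq> H ` carrier V.T"
    proof (rule W.tensor_span)
      show "csub W.T (H ` carrier V.T)"
        by (rule V.T.csub_image[OF W.T.complex_space_axioms H(1) V.T.csub_carrier])
      fix w x assume wx: "w \<in> carrier W" "x \<in> carrier Y"
      then obtain v where v: "v \<in> carrier V" "w = g v" unfolding fg(5)[symmetric] by blast
      show "pure W Y w x \<in> H ` carrier V.T"
        unfolding v(2) H(2)[OF v(1) wx(2), symmetric]
        by (rule imageI[OF V.pure_closed[OF v(1) wx(2)]])
    qed
    then show "H ` carrier V.T = carrier W.T" using linmapD(1)[OF H(1)] by blast
  qed
qed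

text \<open>Swapping the factors transfers exactness and invariance under isomorphism from the first
  variable to the second.\<close>

lemma tensor_commute:
  assumes "lin_rep G V" "lin_rep G W"
  shows "rep_iso G (tensor_rep V W) (tensor_rep W V)"
proof -
  interpret A: tensor G V W using assms by (simp add: tensor_def)
  interpret B: tensor G W V using assms by (simp add: tensor_def)
  have "\<exists>h\<in>linmap A.T B.T. \<forall>v\<in>carrier V. \<forall>w\<in>carrier W. h (pure V W v w) = pure W V w v"
    by (rule A.tensor_lift[OF B.T.complex_space_axioms])
      (simp_all only: B.pure_closed B.pure_add_left B.pure_add_right B.pure_smult_left
        B.pure_smult_right)
  then obtain h where h: "h \<in> linmap A.T B.T"
    "\<forall>v\<in>carrier V. \<forall>w\<in>carrier W. h (pure V W v w) = pure W V w v" by blast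
  have "\<exists>k\<in>linmap B.T A.T. \<forall>w\<in>carrier W. \<forall>v\<in>carrier V. k (pure W V w v) = pure V W v w"
    by (rule B.tensor_lift[OF A.T.complex_space_axioms])
      (simp_all only: A.pure_closed A.pure_add_left A.pure_add_right A.pure_smult_left
        A.pure_smult_right)
  then obtain k where k: "k \<in> linmap B.T A.T"
    "\<forall>w\<in>carrier W. \<forall>v\<in>carrier V. k (pure W V w v) = pure V W v w" by blast
  have kh: "(k \<circ> h) x = x" if "x \<in> carrier A.T" for x
    by (rule A.tensor_ext[OF A.T.complex_space_axioms linmap_comp[OF h(1) k(1)] linmap_id _ that])
      (simp add: h(2) k(2))
  have hk: "(h \<circ> k) x = x" if "x \<in> carrier B.T" for x
    by (rule B.tensor_ext[OF B.T.complex_space_axioms linmap_comp[OF k(1) h(1)] linmap_id _ that])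
      (simp add: h(2) k(2))
  have hom: "h \<in> rep_hom G A.T B.T"
    by (rule A.tensor_rep_homI[OF B.T.lin_rep_axioms h(1)])
      (simp only: h(2)[rule_format] A.V.act_cl A.W.act_cl B.pure_act)
  show ?thesis by (rule rep_isoI[OF hom k(1)]) (use kh hk in auto)
qed

lemma tensor_iso_left:
  assumes lin: "lin_rep G V" "lin_rep G V'" "lin_rep G Y" and iso: "rep_iso G V V'"
  shows "rep_iso G (tensor_rep V Y) (tensor_rep V' Y)"
proof -
  interpret A: tensor G V Y using lin by (simp add: tensor_def)
  interpret B: tensor G V' Y using lin by (simp add: tensor_def)
  obtain f f' where f: "f \<in> rep_hom G V V'" and f': "f' \<in> rep_hom G V' V"
    and ff: "\<And>v. v \<in> carrier V \<Longrightarrow> f' (f v) = v" "\<And>v. v \<in> carrier V' \<Longrightarrow> f (f' v) = v"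
    using rep_iso_inverse[OF lin(1,2) iso] by metis
  obtain h where h: "h \<in> linmap A.T B.T"
    "\<And>v y. \<lbrakk>v \<in> carrier V; y \<in> carrier Y\<rbrakk> \<Longrightarrow> h (pure V Y v y) = pure V' Y (f v) y"
    using tensor_map[OF lin(1,3,2,3) rep_hom_linmap[OF f] linmap_id] by blast
  obtain k where k: "k \<in> linmap B.T A.T"
    "\<And>v y. \<lbrakk>v \<in> carrier V'; y \<in> carrier Y\<rbrakk> \<Longrightarrow> k (pure V' Y v y) = pure V Y (f' v) y"
    using tensor_map[OF lin(2,3,1,3) rep_hom_linmap[OF f'] linmap_id] by blast
  have kh: "(k \<circ> h) x = x" if "x \<in> carrier A.T" for x
    by (rule A.tensor_ext[OF A.T.complex_space_axioms linmap_comp[OF h(1) k(1)] linmap_id _ that])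
      (simp add: h(2) k(2) rep_homD(1)[OF f] ff)
  have hk: "(h \<circ> k) x = x" if "x \<in> carrier B.T" for x
    by (rule B.tensor_ext[OF B.T.complex_space_axioms linmap_comp[OF k(1) h(1)] linmap_id _ that])
      (simp add: h(2) k(2) rep_homD(1)[OF f'] ff)
  have idY: "(\<lambda>y. y) \<in> rep_hom G Y Y" by (simp add: rep_hom_def)
  show ?thesis
    by (rule rep_isoI[OF tensor_map_equivariant[OF lin(1,3,2,3) f idY h] k(1)])
      (use kh hk in auto)
qed

lemma tensor_iso:
  assumes "lin_rep G V" "lin_rep G V'" "lin_rep G W" "lin_rep G W'"
    "rep_iso G V V'" "rep_iso G W W'"
  shows "rep_iso G (tensor_rep V W) (tensor_rep V' W')"
proof (rule rep_iso_trans[OF tensor_iso_left[OF assms(1,2,3,5)]])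
  show "rep_iso G (tensor_rep V' W) (tensor_rep V' W')"
    by (rule rep_iso_trans[OF rep_iso_trans[OF tensor_commute[OF assms(2,3)]
            tensor_iso_left[OF assms(3,4,2,6)]] tensor_commute[OF assms(4,2)]])
qed

lemma rep_class_tensor_commute:
  assumes "fd_rep G V" "fd_rep G W"
  shows "rep_class G (tensor_rep V W) = rep_class G (tensor_rep W V)"
  by (rule rep_class_iso[OF fd_rep_tensor[OF assms(2,1)] fd_rep_tensor[OF assms]
        tensor_commute[OF fd_repD(1)[OF assms(2)] fd_repD(1)[OF assms(1)]]])

lemma rep_class_tensor_zero:
  assumes "fd_rep G V" "fd_rep G W" "carrier V = {\<zero>\<^bsub>V\<^esub>}"
  shows "rep_class G (tensor_rep V W) = 0"
proof (rule rep_class_zero[OF fd_rep_tensor[OF assms(1,2)]])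
  interpret tensor G V W using assms by (simp add: tensor_def fd_repD(1))
  have "carrier T \<subseteq> {\<zero>\<^bsub>T\<^esub>}"
    by (rule tensor_span[OF T.csub_zero]) (use assms(3) pure_zero_left in auto)
  then show "carrier T = {\<zero>\<^bsub>T\<^esub>}" using T.zero_cl by blast
qed

section \<open>The product of classes\<close>

lemma groth_mult_0 [simp]: "groth_mult G 0 y = 0" "groth_mult G x 0 = 0"
  by (simp_all add: groth_mult_def frag_extend_eq_0)

lemma groth_mult_add:
  "groth_mult G (x + x') y = groth_mult G x y + groth_mult G x' y"
  "groth_mult G x (y + y') = groth_mult G x y + groth_mult G x y'"
  unfolding groth_mult_def frag_extend_add
  by (simp_all add: frag_extend_def frag_cmul_distrib2 sum.distrib)

lemma some_irr_class:
  assumes "irreducible_rep G V"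
  shows "fd_rep G (SOME S. S \<in> irr_class G V)" "rep_iso G (SOME S. S \<in> irr_class G V) V"
proof -
  have "V \<in> irr_class G V" using assms rep_iso_refl by (simp add: irr_class_def)
  then have "(SOME S. S \<in> irr_class G V) \<in> irr_class G V" by (rule someI)
  then show "fd_rep G (SOME S. S \<in> irr_class G V)" "rep_iso G (SOME S. S \<in> irr_class G V) V"
    by (simp_all add: irr_class_def irreducible_rep_def)
qed

text \<open>Both sides are additive in W along short exact sequences, the right one because
  tensoring is exact. The derivation of the class of W thus reduces the claim to a simple W, where
  the product is defined through chosen representatives isomorphic to V and W. The same induction in
  the first factor follows.\<close>

lemma groth_mult_irreducible:
  assumes V: "irreducible_rep G V" and "has_class G W y"
  shows "groth_mult G (frag_of (irr_class G V)) y = rep_class G (tensor_rep V W)"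
  using assms(2)
proof (induction rule: has_class.induct)
  case (zero W)
  have fV: "fd_rep G V" using V by (simp add: irreducible_rep_def)
  then show ?case
    using rep_class_tensor_zero[OF zero.hyps(1) fV zero.hyps(2)]
      rep_class_tensor_commute[OF fV zero.hyps(1)] by simp
next
  case (irreducible W)
  have fd: "fd_rep G V" "fd_rep G W" using V irreducible by (simp_all add: irreducible_rep_def)
  note s = some_irr_class[OF V] some_irr_class[OF irreducible]
  show ?case
    using rep_class_iso[OF fd_rep_tensor[OF s(1,3)] fd_rep_tensor[OF fd]
        tensor_iso[OF fd_repD(1)[OF s(1)] fd_repD(1)[OF fd(1)] fd_repD(1)[OF s(3)]
          fd_repD(1)[OF fd(2)] s(2,4)]]
    by (simp add: groth_mult_def)
next
  case (short_exact U W Q x y)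
  have fd: "fd_rep G V" "fd_rep G U" "fd_rep G W" "fd_rep G Q"
    using V short_exact.hyps(1) by (simp_all add: irreducible_rep_def short_exact_def)
  show ?case
    using rep_class_exact[OF tensor_exact_left[OF short_exact.hyps(1) fd(1)]] short_exact.IH
    by (simp add: groth_mult_add rep_class_tensor_commute[OF fd(1)] fd)
qed

lemma groth_mult_has_class:
  assumes "has_class G V x" "has_class G W y"
  shows "groth_mult G x y = rep_class G (tensor_rep V W)"
  using assms(1)
proof (induction rule: has_class.induct)
  case (zero V)
  then show ?case using rep_class_tensor_zero has_class_fd[OF assms(2)] by simp
next
  case (irreducible V)
  then show ?case by (rule groth_mult_irreducible[OF _ assms(2)])
next
  case (short_exact U V Q x x')
  show ?case
    using rep_class_exact[OF tensor_exact_left[OF short_exact.hyps(1) has_class_fd[OF assms(2)]]]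
      short_exact.IH by (simp add: groth_mult_add)
qed

lemma groth_mult_rep_class:
  assumes V: "fd_rep G V" and W: "fd_rep G W"
  shows "groth_mult G (rep_class G V) (rep_class G W) = rep_class G (tensor_rep V W)"
proof -
  obtain M N where M: "rep_iso G M V" "has_class G M (rep_class G V)"
    and N: "rep_iso G N W" "has_class G N (rep_class G W)"
    using rep_has_class_rep_class[OF V] rep_has_class_rep_class[OF W]
    by (auto simp: rep_has_class_def)
  note fM = has_class_fd[OF M(2)] and fN = has_class_fd[OF N(2)]
  show ?thesis
    unfolding groth_mult_has_class[OF M(2) N(2)]
    by (rule rep_class_iso[symmetric, OF fd_rep_tensor[OF fM fN] fd_rep_tensor[OF V W]
          tensor_iso[OF fd_repD(1)[OF fM] fd_repD(1)[OF V] fd_repD(1)[OF fN] fd_repD(1)[OF W]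
            M(1) N(1)]])
qed

section \<open>Calculus in the exterior algebra\<close>

lemma ext_scale_add: "ext_scale c (f + g) = ext_scale c f + ext_scale c g"
  by transfer (rule poly_mapping_eqI, simp add: lookup_add algebra_simps)

lemma ext_scale_add_left: "ext_scale (a + b) f = ext_scale a f + ext_scale b f"
  by transfer (rule poly_mapping_eqI, simp add: lookup_add algebra_simps)

lemma ext_scale_scale [simp]: "ext_scale a (ext_scale b f) = ext_scale (a * b) f"
  by transfer (rule poly_mapping_eqI, simp)

lemma ext_scale_1 [simp]: "ext_scale 1 f = f"
  by transfer (rule poly_mapping_eqI, simp)

lemma ext_scale_0 [simp]: "ext_scale 0 f = 0" "ext_scale c 0 = 0"
  by (transfer, rule poly_mapping_eqI, simp)+

lemma ext_scale_m1: "ext_scale (- 1) f = - f"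
  using ext_scale_add_left[of 1 "- 1" f] by (simp add: eq_neg_iff_add_eq_0 add.commute)

lemma ext_scale_monomial [simp]: "ext_scale c (ext_monomial S a) = ext_monomial S (c * a)"
  by transfer (rule poly_mapping_eqI,
      simp add: lookup_single when_def)

lemma ext_monomial_0 [simp]: "ext_monomial S 0 = 0"
  by transfer simp

lemma ext_monomial_minus: "ext_monomial S (- c) = - ext_monomial S c"
  by transfer (simp add: single_uminus)

lemma ext_monomial_add: "ext_monomial S (a + b) = ext_monomial S a + ext_monomial S b"
  by transfer (simp add: single_add)

lemma ext_induct [case_names monomial add]:
  fixes f :: "'g::linorder ext"
  assumes "\<And>S c. P (ext_monomial S c)" "\<And>f g. P f \<Longrightarrow> P g \<Longrightarrow> P (f + g)"
  shows "P f"
proof -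
  have "P (Abs_ext x)" for x
  proof (induction x rule: ext_coeffs_induct)
    case (single k v)
    then show ?case using assms(1)[of k v] by (simp add: ext_monomial.abs_eq)
  next
    case (add x y)
    then show ?case using assms(2)[of "Abs_ext x" "Abs_ext y"] by (simp add: plus_ext.abs_eq)
  qed
  from this[of "ext_coeffs f"] show ?thesis by (simp add: ext_coeffs_inverse)
qed

lemma monomial_mult:
  "ext_monomial A a * ext_monomial B b =
     (if A |\<inter>| B = {||} then ext_monomial (A |\<union>| B) (shuffle_sign A B * a * b) else 0)"
  by transfer (simp add: wedge_coeffs_single wedge_monomials_def)

lemma monomial_mult_ordered:
  assumes "\<And>x y. x |\<in>| A \<Longrightarrow> y |\<in>| B \<Longrightarrow> x < y"
  shows "ext_monomial A a * ext_monomial B b = ext_monomial (A |\<union>| B) (a * b)"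
proof -
  have "{(x, y). x |\<in>| A \<and> y |\<in>| B \<and> y < x} = {}" using assms by fastforce
  then have "shuffle_sign A B = 1" unfolding shuffle_sign_def by (simp only: card.empty power_0)
  moreover have "A |\<inter>| B = {||}" using assms by fastforce
  ultimately show ?thesis by (simp add: monomial_mult)
qed

lemma ext_scale_mult_left: "ext_scale c f * g = ext_scale c (f * (g :: 'g::linorder ext))"
proof (induction f rule: ext_induct)
  case (monomial S a)
  show ?case
  proof (induction g rule: ext_induct)
    case (monomial S' b)
    then show ?case by (simp add: monomial_mult mult_ac)
  qed (simp add: ext_scale_add ring_distribs)
qed (simp add: ext_scale_add ring_distribs)

lemma ext_scale_mult_right: "f * ext_scale c g = ext_scale c (f * (g :: 'g::linorder ext))"
proof (induction f rule: ext_induct)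
  case (monomial S a)
  show ?case
  proof (induction g rule: ext_induct)
    case (monomial S' b)
    then show ?case by (simp add: monomial_mult mult_ac)
  qed (simp add: ext_scale_add ring_distribs)
qed (simp add: ext_scale_add ring_distribs)

lemma ext_monomial_empty: "ext_monomial {||} c = ext_scale c 1"
  by transfer simp

text \<open>Elements enter in decreasing order. A new generator then stands in front of all the
  others, and left multiplication by it creates no sign.\<close>

lemma fset_min_induct [case_names empty insert]:
  fixes S :: "'a::linorder fset"
  assumes "P {||}" "\<And>x S. \<lbrakk>\<And>y. y |\<in>| S \<Longrightarrow> x < y; P S\<rbrakk> \<Longrightarrow> P (finsert x S)"
  shows "P S"
proof -
  have "\<forall>S. fset S = A \<longrightarrow> P S" if "finite A" for A
    using that
  proof (induction A rule: finite_linorder_min_induct)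
    case empty
    then show ?case using assms(1) by (metis bot_fset.rep_eq fset_inject)
  next
    case (insert b A)
    show ?case
    proof (intro allI impI)
      fix S assume S: "fset S = insert b A"
      have "b \<notin> A" using insert.hyps(2) by blast
      then have "fset (S |-| {|b|}) = A" using S by auto
      then have "P (S |-| {|b|})" using insert.IH by blast
      moreover have "b < y" if "y |\<in>| S |-| {|b|}" for y
        using that S insert.hyps(2) by auto
      ultimately have "P (finsert b (S |-| {|b|}))" by (rule assms(2)[rotated])
      moreover have "finsert b (S |-| {|b|}) = S" using S by auto
      ultimately show "P S" by simp
    qed
  qed
  from this[OF finite_fset] show ?thesis by blast
qed

lemma gen_mult_min:
  assumes "\<And>y. y |\<in>| S \<Longrightarrow> x < y"
  shows "ext_gen x * ext_monomial S c = ext_monomial (finsert x S) c"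
  unfolding ext_gen_def using monomial_mult_ordered[of "{|x|}" S 1 c] assms by simp

lemma gen_mult_monomial:
  "ext_gen x * ext_monomial S c =
     (if x |\<in>| S then 0 else ext_monomial (finsert x S) ((-1) ^ card {y. y |\<in>| S \<and> y < x} * c))"
proof -
  have "{(a, b). a |\<in>| {|x|} \<and> b |\<in>| S \<and> b < a} = Pair x ` {y. y |\<in>| S \<and> y < x}" by auto
  then have "shuffle_sign {|x|} S = (-1) ^ card {y. y |\<in>| S \<and> y < x}"
    by (simp add: shuffle_sign_def card_image inj_on_def)
  then show ?thesis by (auto simp: ext_gen_def monomial_mult)
qed

text \<open>Removes index sets and signs from later inductions: only scalars, sums and left
  multiplication by a generator remain.\<close>

lemma ext_gen_induct [case_names scalar add gen]:
  fixes f :: "'g::linorder ext"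
  assumes "\<And>c. P (ext_scale c 1)" "\<And>f g. P f \<Longrightarrow> P g \<Longrightarrow> P (f + g)"
    "\<And>x f. P f \<Longrightarrow> P (ext_gen x * f)"
  shows "P f"
proof (induction f rule: ext_induct)
  case (monomial S c)
  show ?case
  proof (induction S rule: fset_min_induct)
    case empty
    then show ?case by (simp add: ext_monomial_empty assms(1))
  next
    case (insert x S)
    then show ?case using assms(3)[OF insert(2), of x] by (simp add: gen_mult_min)
  qed
qed (rule assms(2))

lemma gen_mult_swap: "ext_gen x * (ext_gen y * f) = - (ext_gen y * (ext_gen x * f))"
  using arg_cong[OF ext_gen_anticommute[of x y], of "\<lambda>z. z * f"] by (simp add: mult.assoc)

lemma gen_mult_same [simp]: "ext_gen x * (ext_gen x * f) = 0"
  using arg_cong[OF ext_gen_square[of x], of "\<lambda>z. z * f"] by (simp add: mult.assoc)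

text \<open>Identities about left multiplication by a generator can be checked on monomials that avoid
  all smaller generators, because such a multiplication only produces multiples of such monomials.\<close>

lemma gen_mult_above:
  assumes "\<And>y. y |\<in>| S \<Longrightarrow> m < y" "m < x"
  shows "\<exists>T d. ext_gen x * ext_monomial S c = ext_monomial T d \<and> (\<forall>y. y |\<in>| T \<longrightarrow> m < y)"
proof (cases "x |\<in>| S")
  case True
  then show ?thesis by (intro exI[of _ "{||}"] exI[of _ 0]) (simp add: gen_mult_monomial)
next
  case False
  then show ?thesis using assms by (auto simp: gen_mult_monomial intro!: exI[of _ "finsert x S"])
qed

text \<open>Unlike in \<open>ext_act\<close>, the new generators may have another type. The cases p
  = \<open>Alpha\<close> and p = \<open>Theta\<close> embed the exterior powers into the bigraded
  algebra.\<close>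

definition ext_map :: "('g \<Rightarrow> 'h) \<Rightarrow> 'g::linorder ext \<Rightarrow> 'h::linorder ext" where
  "ext_map p f =
     (\<Sum>S\<in>Poly_Mapping.keys (ext_coeffs f).
        ext_scale (Poly_Mapping.lookup (ext_coeffs f) S)
          (prod_list (map (\<lambda>x. ext_gen (p x)) (sorted_list_of_fset S))))"

lemma ext_act_eq: "ext_act p = ext_map p"
  by (rule ext) (simp add: ext_act_def ext_map_def)

lemma ext_map_add: "ext_map p (f + g) = ext_map p f + ext_map p g"
  unfolding ext_map_def plus_ext.rep_eq
  by (rule sum_keys_add[where T = "\<lambda>S a. ext_scale a (prod_list (map (\<lambda>x. ext_gen (p x))
        (sorted_list_of_fset S)))"]) (rule ext_scale_add_left)

lemma ext_map_monomial:
  "ext_map p (ext_monomial S c) =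
     ext_scale c (prod_list (map (\<lambda>x. ext_gen (p x)) (sorted_list_of_fset S)))"
  unfolding ext_map_def ext_monomial.rep_eq
  by (rule sum_keys_single[where T = "\<lambda>S a. ext_scale a (prod_list (map (\<lambda>x. ext_gen (p x))
        (sorted_list_of_fset S)))"]) simp

lemma ext_map_0 [simp]: "ext_map p 0 = 0"
  using ext_map_add[of p 0 0] by simp

lemma ext_map_minus: "ext_map p (- f) = - ext_map p f"
  using ext_map_add[of p f "- f"] by (simp add: eq_neg_iff_add_eq_0 add.commute)

lemma ext_map_scale: "ext_map p (ext_scale c f) = ext_scale c (ext_map p f)"
  by (induction f rule: ext_induct) (simp_all add: ext_map_monomial ext_map_add ext_scale_add)

lemma ext_map_1 [simp]: "ext_map p 1 = 1"
  using ext_map_monomial[of p "{||}" 1] by (simp add: ext_monomial_empty sorted_list_of_fset.rep_eq)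

lemma ext_map_gen_mult_min:
  assumes "\<And>y. y |\<in>| S \<Longrightarrow> x < y"
  shows "ext_map p (ext_gen x * ext_monomial S c) = ext_gen (p x) * ext_map p (ext_monomial S c)"
proof -
  have "x \<notin> fset S" using assms by fastforce
  then have "sorted_list_of_fset (finsert x S) = insort x (sorted_list_of_fset S)"
    by (simp add: sorted_list_of_fset.rep_eq)
  also have "\<dots> = x # sorted_list_of_fset S"
    using assms by (intro insort_is_Cons) (auto simp: sorted_list_of_fset.rep_eq less_imp_le)
  finally show ?thesis
    using assms by (simp add: gen_mult_min ext_map_monomial ext_scale_mult_right)
qed

text \<open>Let m be the smallest generator of the monomial. A generator x below m is the ordered
  case, and for x = m both sides are zero. For x above m, moving m to the front costs a sign, and
  the generators p x and p m return the same sign, whatever p does to the order.\<close>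

lemma ext_map_gen_mult_monomial:
  "ext_map p (ext_gen x * ext_monomial S c) = ext_gen (p x) * ext_map p (ext_monomial S c)"
proof (induction S arbitrary: c rule: fset_min_induct)
  case empty
  then show ?case by (rule ext_map_gen_mult_min) simp
next
  case (insert m S)
  note S = gen_mult_min[OF insert(1), symmetric]
  consider "x < m" | "x = m" | "m < x" by fastforce
  then show ?case
  proof cases
    case 1
    then show ?thesis
      using insert(1) by (intro ext_map_gen_mult_min) (auto dest: less_trans)
  next
    case 2
    then show ?thesis by (simp add: S ext_map_gen_mult_min[OF insert(1)])
  next
    case 3
    then obtain T d where T: "ext_gen x * ext_monomial S c = ext_monomial T d"
      "\<And>y. y |\<in>| T \<Longrightarrow> m < y"
      using gen_mult_above[where S = S and m = m and x = x and c = c, OF insert(1)] by blast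
    have "ext_map p (ext_gen x * ext_monomial (finsert m S) c) =
        - ext_map p (ext_gen m * ext_monomial T d)"
      by (simp add: S gen_mult_swap[of x m] ext_map_minus T(1))
    also have "\<dots> = - (ext_gen (p m) * ext_map p (ext_gen x * ext_monomial S c))"
      by (simp add: ext_map_gen_mult_min[OF T(2)] T(1))
    also have "\<dots> = ext_gen (p x) * (ext_gen (p m) * ext_map p (ext_monomial S c))"
      by (simp add: insert(2) gen_mult_swap[of "p x"])
    finally show ?thesis by (simp add: S ext_map_gen_mult_min[OF insert(1)])
  qed
qed

lemma ext_map_gen_mult: "ext_map p (ext_gen x * f) = ext_gen (p x) * ext_map p f"
  by (induction f rule: ext_induct)
    (simp_all add: ext_map_gen_mult_monomial ring_distribs ext_map_add)

text \<open>The definition of \<open>ext_map\<close> only evaluates increasing products; this shows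
  that it is the algebra map determined by its values on the generators.\<close>

lemma ext_map_mult: "ext_map p (f * g) = ext_map p f * ext_map p g"
  by (induction f rule: ext_gen_induct)
    (simp_all add: ext_scale_mult_left ext_map_scale ext_map_add ring_distribs ext_map_gen_mult
      mult.assoc)

lemma ext_map_comp: "ext_map p (ext_map q f) = ext_map (\<lambda>x. p (q x)) f"
  by (induction f rule: ext_gen_induct)
    (simp_all add: ext_map_scale ext_map_add ext_map_gen_mult)

lemma ext_map_id: "ext_map (\<lambda>x. x) f = f"
  by (induction f rule: ext_gen_induct)
    (simp_all add: ext_map_scale ext_map_add ext_map_gen_mult)

text \<open>Sorting the images can change the sign. The coefficient is left open because membership
  in a graded component depends on the index set alone.\<close>

lemma ext_map_monomial_inj:
  assumes "inj_on p (fset S)"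
  shows "\<exists>d. ext_map p (ext_monomial S c) = ext_monomial (p |`| S) d"
  using assms
proof (induction S rule: fset_min_induct)
  case empty
  then show ?case by (auto simp: ext_monomial_empty ext_map_scale)
next
  case (insert m S)
  have "m \<notin> fset S" using insert(1) by fastforce
  with insert.prems have p: "p m |\<notin>| p |`| S" "inj_on p (fset S)" by auto
  from insert(2)[OF p(2)] obtain d where
    d: "ext_map p (ext_monomial S c) = ext_monomial (p |`| S) d" by blast
  have "ext_map p (ext_monomial (finsert m S) c) = ext_gen (p m) * ext_monomial (p |`| S) d"
    by (simp only: gen_mult_min[OF insert(1), symmetric] ext_map_gen_mult d)
  with p(1) show ?case by (simp only: gen_mult_monomial if_False fimage_finsert) blast
qed

text \<open>An increasing p keeps the factors sorted, so no sign arises.\<close>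

lemma ext_map_monomial_mono:
  assumes "\<And>x y. x < y \<Longrightarrow> p x < p y"
  shows "ext_map p (ext_monomial S c) = ext_monomial (p |`| S) c"
proof (induction S rule: fset_min_induct)
  case empty
  then show ?case by (auto simp: ext_monomial_empty ext_map_scale)
next
  case (insert m S)
  have "p m < y" if "y |\<in>| p |`| S" for y using that insert(1) assms by auto
  then show ?case
    by (simp add: gen_mult_min[OF insert(1), symmetric] ext_map_gen_mult insert(2))
      (subst gen_mult_min, auto)
qed

section \<open>Fermionic derivatives\<close>

lemma ext_deriv_add: "ext_deriv x (f + g) = ext_deriv x f + ext_deriv x g"
  unfolding ext_deriv_def plus_ext.rep_eq
  by (rule sum_keys_add[where T = "\<lambda>S a. if x |\<in>| S
        then ext_monomial (S |-| {|x|}) ((-1) ^ card {y. y |\<in>| S \<and> y < x} * a) else 0"])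
    (simp add: ring_distribs ext_monomial_add)

lemma ext_deriv_monomial:
  "ext_deriv x (ext_monomial S c) =
     (if x |\<in>| S
      then ext_monomial (S |-| {|x|}) ((-1) ^ card {y. y |\<in>| S \<and> y < x} * c) else 0)"
  unfolding ext_deriv_def ext_monomial.rep_eq
  by (rule sum_keys_single[where T = "\<lambda>S a. if x |\<in>| S
        then ext_monomial (S |-| {|x|}) ((-1) ^ card {y. y |\<in>| S \<and> y < x} * a) else 0"]) simp

lemma ext_deriv_0 [simp]: "ext_deriv x 0 = 0"
  using ext_deriv_add[of x 0 0] by simp

lemma ext_deriv_minus: "ext_deriv x (- f) = - ext_deriv x f"
  using ext_deriv_add[of x f "- f"] by (simp add: eq_neg_iff_add_eq_0 add.commute)

lemma ext_deriv_diff: "ext_deriv x (f - g) = ext_deriv x f - ext_deriv x g"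
  using ext_deriv_add[of x f "- g"] by (simp add: ext_deriv_minus)

lemma ext_deriv_scale: "ext_deriv x (ext_scale c f) = ext_scale c (ext_deriv x f)"
  by (induction f rule: ext_induct)
    (simp_all add: ext_deriv_monomial ext_deriv_add ext_scale_add mult_ac)

lemma ext_deriv_gen_mult_min:
  assumes "\<And>z. z |\<in>| S \<Longrightarrow> y < z"
  shows "ext_deriv x (ext_gen y * ext_monomial S c) =
    (if x = y then ext_monomial S c else 0) - ext_gen y * ext_deriv x (ext_monomial S c)"
proof (cases "x = y")
  case True
  have y: "y |\<notin>| S" using assms by blast
  have "{z. (z = y \<or> z |\<in>| S) \<and> z < y} = {}" using assms by (auto dest: less_asym)
  then have c: "card {z. (z = y \<or> z |\<in>| S) \<and> z < y} = 0" by (simp only: card.empty)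
  have "finsert y S |-| {|y|} = S" using y by auto
  then show ?thesis
    using True y by (simp add: gen_mult_min[OF assms] ext_deriv_monomial c)
next
  case False
  show ?thesis
  proof (cases "x |\<in>| S")
    case True
    \<comment> \<open>The factor y precedes x, so one more factor is passed; this is the minus sign
      of the rule.\<close>
    have "{z. z |\<in>| finsert y S \<and> z < x} = insert y {z. z |\<in>| S \<and> z < x}"
      using assms[OF True] by auto
    moreover have "y \<notin> {z. z |\<in>| S \<and> z < x}" using assms by auto
    moreover have "finite {z. z |\<in>| S \<and> z < x}" by (rule finite_subset[OF _ finite_fset]) auto
    ultimately have c: "card {z. z |\<in>| finsert y S \<and> z < x} = Suc (card {z. z |\<in>| S \<and> z < x})"
      by simp
    have "finsert y S |-| {|x|} = finsert y (S |-| {|x|})" using False by auto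
    moreover have "ext_gen y * ext_monomial (S |-| {|x|}) d =
        ext_monomial (finsert y (S |-| {|x|})) d" for d
      using assms by (intro gen_mult_min) auto
    ultimately show ?thesis
      using True False c
      by (simp add: gen_mult_min[OF assms] ext_deriv_monomial ext_monomial_minus)
  next
    case xS: False
    then show ?thesis using False by (simp add: gen_mult_min[OF assms] ext_deriv_monomial)
  qed
qed

lemma ext_deriv_gen_mult_monomial:
  "ext_deriv x (ext_gen y * ext_monomial S c) =
     (if x = y then ext_monomial S c else 0) - ext_gen y * ext_deriv x (ext_monomial S c)"
proof (induction S arbitrary: c rule: fset_min_induct)
  case empty
  then show ?case by (rule ext_deriv_gen_mult_min) simp
next
  case (insert m S)
  note S = gen_mult_min[OF insert(1), symmetric]
  note D = ext_deriv_gen_mult_min[OF insert(1)]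
  consider "y < m" | "y = m" | "m < y" by fastforce
  then show ?case
  proof cases
    case 1
    then show ?thesis
      using insert(1) by (intro ext_deriv_gen_mult_min) (auto dest: less_trans)
  next
    case 2
    then show ?thesis by (simp add: S D ring_distribs)
  next
    case 3
    then obtain T d where T: "ext_gen y * ext_monomial S c = ext_monomial T d"
      "\<And>z. z |\<in>| T \<Longrightarrow> m < z"
      using gen_mult_above[where S = S and m = m and x = y and c = c, OF insert(1)] by blast
    have "ext_deriv x (ext_gen y * ext_monomial (finsert m S) c) =
        - ext_deriv x (ext_gen m * ext_monomial T d)"
      by (simp add: S gen_mult_swap[of y m] ext_deriv_minus T(1))
    also have "\<dots> = - ((if x = m then ext_monomial T d else 0) -
        ext_gen m * ext_deriv x (ext_gen y * ext_monomial S c))"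
      by (simp add: ext_deriv_gen_mult_min[OF T(2)] T(1))
    finally show ?thesis
      by (simp add: S D insert(2) T(1)[symmetric] ring_distribs gen_mult_swap[of m y])
  qed
qed

text \<open>The canonical anticommutation relation between a derivative and the multiplication by a
  generator, on which the commutator of \<open>tau\<close> and \<open>sigma\<close> rests.\<close>

lemma ext_deriv_gen_mult:
  "ext_deriv x (ext_gen y * f) = (if x = y then f else 0) - ext_gen y * ext_deriv x f"
  by (induction f rule: ext_induct)
    (simp_all add: ext_deriv_gen_mult_monomial ring_distribs ext_deriv_add)

lemma ext_deriv_1 [simp]: "ext_deriv x 1 = 0"
  using ext_deriv_monomial[of x "{||}" 1] by (simp add: ext_monomial_empty)

text \<open>The sum of the two composites kills scalars and commutes with left multiplication by
  every generator, so it vanishes on the whole algebra.\<close>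

lemma ext_deriv_swap: "ext_deriv x (ext_deriv y f) = - ext_deriv y (ext_deriv x f)"
proof -
  have "ext_deriv x (ext_deriv y f) + ext_deriv y (ext_deriv x f) = 0"
  proof (induction f rule: ext_gen_induct)
    case (add f g)
    have "ext_deriv x (ext_deriv y (f + g)) + ext_deriv y (ext_deriv x (f + g)) =
        (ext_deriv x (ext_deriv y f) + ext_deriv y (ext_deriv x f)) +
        (ext_deriv x (ext_deriv y g) + ext_deriv y (ext_deriv x g))"
      by (simp add: ext_deriv_add ac_simps)
    with add show ?case by simp
  next
    case (gen z f)
    have "ext_deriv x (ext_deriv y (ext_gen z * f)) + ext_deriv y (ext_deriv x (ext_gen z * f)) =
        ext_gen z * (ext_deriv x (ext_deriv y f) + ext_deriv y (ext_deriv x f))"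
      by (simp add: ext_deriv_gen_mult ext_deriv_diff distrib_left)
    with gen show ?case by simp
  qed (simp add: ext_deriv_scale)
  then show ?thesis by (simp add: eq_neg_iff_add_eq_0)
qed

lemma ext_map_diff: "ext_map p (f - g) = ext_map p f - ext_map p g"
  using ext_map_add[of p f "- g"] by (simp add: ext_map_minus)

lemma ext_deriv_map:
  assumes "inj p"
  shows "ext_deriv (p x) (ext_map p f) = ext_map p (ext_deriv x f)"
proof (induction f rule: ext_gen_induct)
  case (gen y f)
  then show ?case
    by (simp add: ext_deriv_gen_mult ext_map_gen_mult ext_map_diff inj_eq[OF assms])
qed (simp_all add: ext_deriv_scale ext_map_scale ext_deriv_add ext_map_add)

text \<open>Removing x and putting it back count the same smaller generators, so the two signs
  cancel and the composite projects onto the monomials that contain x.\<close>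

lemma gen_mult_deriv_monomial:
  "ext_gen x * ext_deriv x (ext_monomial S c) = (if x |\<in>| S then ext_monomial S c else 0)"
proof (cases "x |\<in>| S")
  case True
  have "{y. y |\<in>| S |-| {|x|} \<and> y < x} = {y. y |\<in>| S \<and> y < x}" by auto
  moreover have "finsert x (S |-| {|x|}) = S" using True by auto
  moreover have "(-1) ^ k * ((-1) ^ k * c) = c" for k :: nat
    by (simp add: mult.assoc[symmetric] power_mult_distrib[symmetric])
  ultimately show ?thesis using True by (simp add: ext_deriv_monomial gen_mult_monomial)
qed (simp add: ext_deriv_monomial)

section \<open>Exterior algebras as representations\<close>

lemma sum_monomials:
  fixes f :: "'g::linorder ext"
  shows "(\<Sum>S\<in>Poly_Mapping.keys (ext_coeffs f).
    ext_monomial S (Poly_Mapping.lookup (ext_coeffs f) S)) = f"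
proof (induction f rule: ext_induct)
  case (monomial S c)
  show ?case
    unfolding ext_monomial.rep_eq by (rule sum_keys_single[where T = ext_monomial]) simp
next
  case (add f g)
  then show ?case
    unfolding plus_ext.rep_eq sum_keys_add[where T = ext_monomial, OF ext_monomial_add]
    by (simp only:)
qed

definition ext_space :: "('g fset \<Rightarrow> bool) \<Rightarrow> 'g ext set" where
  "ext_space P = {f. \<forall>S\<in>Poly_Mapping.keys (ext_coeffs f). P S}"

lemma ext_space_0: "0 \<in> ext_space P"
  by (simp add: ext_space_def zero_ext.rep_eq)

lemma ext_space_monomial: "P S \<Longrightarrow> ext_monomial S c \<in> ext_space P"
  by (simp add: ext_space_def ext_monomial.rep_eq)

lemma ext_space_add: "\<lbrakk>f \<in> ext_space P; g \<in> ext_space P\<rbrakk> \<Longrightarrow> f + g \<in> ext_space P"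
  using Poly_Mapping.keys_add[of "ext_coeffs f" "ext_coeffs g"]
  by (auto simp: ext_space_def plus_ext.rep_eq)

lemma ext_space_scale: "f \<in> ext_space P \<Longrightarrow> ext_scale c f \<in> ext_space P"
  using keys_scale[of c "ext_coeffs f"] by (auto simp: ext_space_def ext_scale.rep_eq)

lemma ext_space_sum: "(\<And>a. a \<in> A \<Longrightarrow> f a \<in> ext_space P) \<Longrightarrow> sum f A \<in> ext_space P"
  by (induction A rule: infinite_finite_induct) (simp_all add: ext_space_0 ext_space_add)

lemma ext_space_diff: "\<lbrakk>f \<in> ext_space P; g \<in> ext_space P\<rbrakk> \<Longrightarrow> f - g \<in> ext_space P"
  using ext_space_add[of f P "ext_scale (-1) g"] ext_space_scale[of g P "-1"]
  by (simp add: ext_scale_m1)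

text \<open>Every monomial that occurs in f satisfies P itself, so splitting f never leaves the
  space.\<close>

lemma ext_space_induct [consumes 1, case_names zero monomial add]:
  fixes f :: "'g::linorder ext"
  assumes f: "f \<in> ext_space P" and "Q 0" "\<And>S c. P S \<Longrightarrow> Q (ext_monomial S c)"
    "\<And>f g. \<lbrakk>f \<in> ext_space P; g \<in> ext_space P; Q f; Q g\<rbrakk> \<Longrightarrow> Q (f + g)"
  shows "Q f"
proof -
  have "(\<Sum>S\<in>A. ext_monomial S (Poly_Mapping.lookup (ext_coeffs f) S)) \<in> ext_space P \<and>
      Q (\<Sum>S\<in>A. ext_monomial S (Poly_Mapping.lookup (ext_coeffs f) S))"
    if "finite A" "A \<subseteq> Poly_Mapping.keys (ext_coeffs f)" for A
    using that
  proof (induction A rule: finite_induct)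
    case (insert S A)
    then have "P S" using f by (auto simp: ext_space_def)
    with insert show ?case by (simp add: assms ext_space_add ext_space_monomial)
  qed (simp add: assms ext_space_0)
  from this[of "Poly_Mapping.keys (ext_coeffs f)"] show ?thesis by (simp add: sum_monomials)
qed

lemma ext_space_map:
  assumes f: "f \<in> ext_space P" and P: "\<And>S. P S \<Longrightarrow> inj_on p (fset S) \<and> Q (p |`| S)"
  shows "ext_map p f \<in> ext_space Q"
  using f
proof (induction rule: ext_space_induct)
  case (monomial S c)
  then obtain d where "ext_map p (ext_monomial S c) = ext_monomial (p |`| S) d"
    using ext_map_monomial_inj[of p S c] P by blast
  with monomial P show ?case by (simp add: ext_space_monomial)
qed (simp_all add: ext_space_0 ext_map_add ext_space_add)

lemma ext_space_gen_mult:
  assumes f: "f \<in> ext_space P" and P: "\<And>S. \<lbrakk>P S; x |\<notin>| S\<rbrakk> \<Longrightarrow> Q (finsert x S)"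
  shows "ext_gen x * f \<in> ext_space Q"
  using f
  by (induction rule: ext_space_induct)
    (simp_all add: ext_space_0 gen_mult_monomial ext_space_monomial P ring_distribs ext_space_add)

lemma ext_space_deriv:
  assumes f: "f \<in> ext_space P" and P: "\<And>S. \<lbrakk>P S; x |\<in>| S\<rbrakk> \<Longrightarrow> Q (S |-| {|x|})"
  shows "ext_deriv x f \<in> ext_space Q"
  using f
  by (induction rule: ext_space_induct)
    (simp_all add: ext_space_0 ext_deriv_monomial ext_space_monomial P ext_deriv_add ext_space_add)

lemma ext_space_mult:
  assumes f: "f \<in> ext_space P" and g: "g \<in> ext_space Q"
    and R: "\<And>A B. \<lbrakk>P A; Q B; A |\<inter>| B = {||}\<rbrakk> \<Longrightarrow> R (A |\<union>| B)"
  shows "f * g \<in> ext_space R"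
  using f
proof (induction rule: ext_space_induct)
  case (monomial A a)
  from g show ?case
    by (induction rule: ext_space_induct)
      (simp_all add: ext_space_0 monomial_mult ext_space_monomial R monomial ring_distribs
        ext_space_add)
qed (simp_all add: ext_space_0 ring_distribs ext_space_add)

lemma ext_rep_simps [simp]:
  "carrier (ext_rep P a) = ext_space P" "\<zero>\<^bsub>ext_rep P a\<^esub> = 0" "f \<oplus>\<^bsub>ext_rep P a\<^esub> g = f + g"
  "c \<odot>\<^bsub>ext_rep P a\<^esub> f = ext_scale c f" "act (ext_rep P a) w f = ext_map (a w) f"
  by (simp_all add: ext_rep_def ext_space_def ext_act_eq)

lemma ext_rep_space: "complex_space (ext_rep P a)"
  by (rule complex_spaceI)
    (simp_all add: ext_space_0 ext_space_add ext_space_scale ext_scale_add ext_scale_add_left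
      ext_scale_m1 algebra_simps)

lemma ext_rep_gen:
  fixes a :: "'p \<Rightarrow> 'g::linorder \<Rightarrow> 'g"
  assumes "finite {S. P S}"
  shows "generates (ext_rep P a) ((\<lambda>S. ext_monomial S 1) ` {S. P S})"
  unfolding generates_def
proof (intro conjI allI impI)
  show "finite ((\<lambda>S. ext_monomial S 1) ` {S. P S})" using assms by simp
  show "(\<lambda>S. ext_monomial S 1) ` {S. P S} \<subseteq> carrier (ext_rep P a)"
    by (auto simp: ext_space_monomial)
  fix N assume N: "csub (ext_rep P a) N \<and> (\<lambda>S. ext_monomial S 1) ` {S. P S} \<subseteq> N"
  then have "csub (ext_rep P a) N" by blast
  note c = csubD[OF this]
  show "carrier (ext_rep P a) \<subseteq> N"
  proof
    fix f :: "'g ext"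
    assume "f \<in> carrier (ext_rep P a)"
    then have "f \<in> ext_space P" by simp
    then show "f \<in> N"
    proof (induction rule: ext_space_induct)
      case (monomial S d)
      then have "ext_monomial S 1 \<in> N" using N by blast
      from c(4)[OF this, of d] show ?case by simp
    qed (use c(2,3) in simp_all)
  qed
qed

lemma ext_rep_fd:
  fixes a :: "'p \<Rightarrow> 'g::linorder \<Rightarrow> 'g"
  assumes G: "group G" and fin: "finite {S. P S}"
    and cl: "\<And>w S. \<lbrakk>w \<in> carrier G; P S\<rbrakk> \<Longrightarrow> inj_on (a w) (fset S) \<and> P (a w |`| S)"
    and one: "a \<one>\<^bsub>G\<^esub> = (\<lambda>x. x)"
    and mult: "\<And>v w. \<lbrakk>v \<in> carrier G; w \<in> carrier G\<rbrakk> \<Longrightarrow> a (v \<otimes>\<^bsub>G\<^esub> w) = (\<lambda>x. a v (a w x))"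
  shows "fd_rep G (ext_rep P a)"
proof -
  have "lin_rep_axioms G (ext_rep P a)"
  proof
    show "act (ext_rep P a) w f \<in> carrier (ext_rep P a)"
      if "w \<in> carrier G" "f \<in> carrier (ext_rep P a)" for w f
      using that cl by (auto intro: ext_space_map)
  qed (simp_all add: ext_map_add ext_map_scale one mult ext_map_id ext_map_comp)
  then show ?thesis
    using ext_rep_gen[OF fin, of a] G by (auto simp: fd_rep_iff lin_rep_def ext_rep_space)
qed

section \<open>The bigraded pieces\<close>

definition adeg :: "nat gen fset \<Rightarrow> int" where
  "adeg S = int (card (fset S \<inter> range Alpha))"

definition tdeg :: "nat gen fset \<Rightarrow> int" where
  "tdeg S = int (card (fset S \<inter> range Theta))"

definition bideg :: "nat \<Rightarrow> int \<Rightarrow> int \<Rightarrow> nat gen fset \<Rightarrow> bool" where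
  "bideg n i j S \<longleftrightarrow> fset S \<subseteq> Alpha ` {1..n} \<union> Theta ` {1..n} \<and> adeg S = i \<and> tdeg S = j"

lemma E_eq: "E n i j = ext_rep (bideg n i j) map_gen"
  by (simp add: E_def bideg_def[abs_def] adeg_def tdeg_def)

lemma card_insert_inter:
  "finite A \<Longrightarrow> x \<notin> A \<Longrightarrow> int (card (insert x A \<inter> D)) = int (card (A \<inter> D)) + (if x \<in> D then 1 else 0)"
  by (cases "x \<in> D") (simp_all add: Int_insert_left)

lemma deg_finsert:
  assumes "x |\<notin>| S"
  shows "adeg (finsert x S) = adeg S + (if x \<in> range Alpha then 1 else 0)"
    "tdeg (finsert x S) = tdeg S + (if x \<in> range Theta then 1 else 0)"
  using assms by (simp_all add: adeg_def tdeg_def card_insert_inter)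

lemma deg_fminus:
  assumes "x |\<in>| S"
  shows "adeg (S |-| {|x|}) = adeg S - (if x \<in> range Alpha then 1 else 0)"
    "tdeg (S |-| {|x|}) = tdeg S - (if x \<in> range Theta then 1 else 0)"
proof -
  have "finsert x (S |-| {|x|}) = S" using assms by auto
  then show "adeg (S |-| {|x|}) = adeg S - (if x \<in> range Alpha then 1 else 0)"
    "tdeg (S |-| {|x|}) = tdeg S - (if x \<in> range Theta then 1 else 0)"
    using deg_finsert[of x "S |-| {|x|}"] by auto
qed

lemma Alpha_notin_Theta [simp]: "Alpha k \<notin> range Theta" "Theta k \<notin> range Alpha"
  by auto

lemma Alpha_mult_mem:
  "\<lbrakk>f \<in> ext_space (bideg n i j); k \<in> {1..n}\<rbrakk> \<Longrightarrow> ext_gen (Alpha k) * f \<in> ext_space (bideg n (i + 1) j)"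
  by (erule ext_space_gen_mult) (simp add: bideg_def deg_finsert)

lemma Theta_mult_mem:
  "\<lbrakk>f \<in> ext_space (bideg n i j); k \<in> {1..n}\<rbrakk> \<Longrightarrow> ext_gen (Theta k) * f \<in> ext_space (bideg n i (j + 1))"
  by (erule ext_space_gen_mult) (simp add: bideg_def deg_finsert)

lemma Alpha_deriv_mem:
  "f \<in> ext_space (bideg n i j) \<Longrightarrow> ext_deriv (Alpha k) f \<in> ext_space (bideg n (i - 1) j)"
  by (erule ext_space_deriv) (auto simp: bideg_def deg_fminus)

lemma Theta_deriv_mem:
  "f \<in> ext_space (bideg n i j) \<Longrightarrow> ext_deriv (Theta k) f \<in> ext_space (bideg n i (j - 1))"
  by (erule ext_space_deriv) (auto simp: bideg_def deg_fminus)

text \<open>The lowering operator that completes \<open>tau\<close> to an sl2-triple.\<close>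

definition sigma :: "nat \<Rightarrow> nat gen ext \<Rightarrow> nat gen ext" where
  "sigma n f = (\<Sum>i=1..n. ext_gen (Theta i) * ext_deriv (Alpha i) f)"

lemma tau_mem: "f \<in> ext_space (bideg n i j) \<Longrightarrow> tau n f \<in> ext_space (bideg n (i + 1) (j - 1))"
  unfolding tau_def by (intro ext_space_sum Alpha_mult_mem Theta_deriv_mem)

lemma sigma_mem: "f \<in> ext_space (bideg n i j) \<Longrightarrow> sigma n f \<in> ext_space (bideg n (i - 1) (j + 1))"
  unfolding sigma_def by (intro ext_space_sum Theta_mult_mem Alpha_deriv_mem)

section \<open>The sl2 relations and the kernel and image of \<open>tau\<close>\<close>

lemma ext_scale_sum: "ext_scale c (sum f A) = (\<Sum>a\<in>A. ext_scale c (f a))"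
  by (induction A rule: infinite_finite_induct) (simp_all add: ext_scale_add)

lemma ext_deriv_sum: "ext_deriv x (sum f A) = (\<Sum>a\<in>A. ext_deriv x (f a))"
  by (induction A rule: infinite_finite_induct) (simp_all add: ext_deriv_add)

lemma ext_map_sum: "ext_map p (sum f A) = (\<Sum>a\<in>A. ext_map p (f a))"
  by (induction A rule: infinite_finite_induct) (simp_all add: ext_map_add)

lemma tau_add: "tau n (f + g) = tau n f + tau n g"
  by (simp add: tau_def ext_deriv_add distrib_left sum.distrib)

lemma tau_scale: "tau n (ext_scale c f) = ext_scale c (tau n f)"
  by (simp add: tau_def ext_deriv_scale ext_scale_mult_right ext_scale_sum)

lemma tau_0 [simp]: "tau n 0 = 0"
  by (simp add: tau_def)

lemma tau_diff: "tau n (f - g) = tau n f - tau n g"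
  by (simp add: tau_def ext_deriv_diff right_diff_distrib sum_subtractf)

lemma sigma_scale: "sigma n (ext_scale c f) = ext_scale c (sigma n f)"
  by (simp add: sigma_def ext_deriv_scale ext_scale_mult_right ext_scale_sum)

lemma sigma_0 [simp]: "sigma n 0 = 0"
  by (simp add: sigma_def)

text \<open>By anticommutation each composite yields terms with two multiplications and two
  derivatives, and diagonal terms with one of each. The former agree in both composites after two
  sign changes, so the diagonal terms remain.\<close>

lemma tau_sigma_commutator:
  "tau n (sigma n f) - sigma n (tau n f) =
     (\<Sum>i=1..n. ext_gen (Alpha i) * ext_deriv (Alpha i) f) -
     (\<Sum>i=1..n. ext_gen (Theta i) * ext_deriv (Theta i) f)"
proof -
  let ?A = "\<lambda>i j. ext_gen (Alpha i) *
    ext_deriv (Theta i) (ext_gen (Theta j) * ext_deriv (Alpha j) f)"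
  let ?B = "\<lambda>i j. ext_gen (Theta j) *
    ext_deriv (Alpha j) (ext_gen (Alpha i) * ext_deriv (Theta i) f)"
  let ?d = "\<lambda>i. ext_gen (Alpha i) * ext_deriv (Alpha i) f - ext_gen (Theta i) * ext_deriv (Theta i) f"
  have "?A i j - ?B i j = (if i = j then ?d i else 0)" for i j
  proof -
    have "ext_gen (Theta j) * (ext_gen (Alpha i) * ext_deriv (Alpha j) (ext_deriv (Theta i) f)) =
        ext_gen (Alpha i) * (ext_gen (Theta j) * ext_deriv (Theta i) (ext_deriv (Alpha j) f))"
      by (subst ext_deriv_swap, subst gen_mult_swap) simp
    then show ?thesis by (simp add: ext_deriv_gen_mult right_diff_distrib)
  qed
  then have "(\<Sum>i=1..n. \<Sum>j=1..n. ?A i j) - (\<Sum>i=1..n. \<Sum>j=1..n. ?B i j) = (\<Sum>i=1..n. ?d i)"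
    by (simp add: sum_subtractf[symmetric] sum.delta)
  moreover have "tau n (sigma n f) = (\<Sum>i=1..n. \<Sum>j=1..n. ?A i j)"
    by (simp add: tau_def sigma_def ext_deriv_sum sum_distrib_left)
  moreover have "sigma n (tau n f) = (\<Sum>i=1..n. \<Sum>j=1..n. ?B i j)"
    by (subst sum.swap) (simp add: tau_def sigma_def ext_deriv_sum sum_distrib_left)
  ultimately show ?thesis by (simp add: sum_subtractf)
qed

lemma sum_const_ext: "(\<Sum>a\<in>A. (f :: 'g::linorder ext)) = ext_scale (of_nat (card A)) f"
  by (induction A rule: infinite_finite_induct) 
    (simp_all add: ext_scale_add_left del: sum_constant)

lemma number_operator_monomial:
  fixes h :: "nat \<Rightarrow> nat gen"
  assumes "inj h" "fset S \<inter> range h \<subseteq> h ` {1..n}"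
  shows "(\<Sum>i=1..n. ext_gen (h i) * ext_deriv (h i) (ext_monomial S c)) =
    ext_scale (of_nat (card (fset S \<inter> range h))) (ext_monomial S c)"
proof -
  let ?A = "{i \<in> {1..n}. h i |\<in>| S}"
  have "fset S \<inter> range h = h ` ?A" using assms(2) by auto
  then have "card (fset S \<inter> range h) = card ?A"
    using assms(1) by (simp add: card_image inj_on_def)
  moreover have "(\<Sum>i=1..n. ext_gen (h i) * ext_deriv (h i) (ext_monomial S c)) =
      (\<Sum>i\<in>?A. ext_monomial S c)"
    unfolding gen_mult_deriv_monomial by (rule sum.inter_filter[symmetric]) simp
  ultimately show ?thesis by (simp only: sum_const_ext)
qed

text \<open>These Euler operators count the generators of each kind; they turn the commutator into
  multiplication by the weight i - j.\<close>

lemma number_operator: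
  assumes "f \<in> ext_space (bideg n i j)"
  shows "(\<Sum>k=1..n. ext_gen (Alpha k) * ext_deriv (Alpha k) f) = ext_scale (of_int i) f"
    "(\<Sum>k=1..n. ext_gen (Theta k) * ext_deriv (Theta k) f) = ext_scale (of_int j) f"
  using assms
proof (induction rule: ext_space_induct)
  case (monomial S c)
  {
    case 1
    have "fset S \<inter> range Alpha \<subseteq> Alpha ` {1..n}"
      "(of_int i :: complex) = of_nat (card (fset S \<inter> range Alpha))"
      using monomial by (auto simp: bideg_def adeg_def)
    then show ?case using number_operator_monomial[of Alpha S n c] by (simp add: inj_def)
  next
    case 2
    have "fset S \<inter> range Theta \<subseteq> Theta ` {1..n}"
      "(of_int j :: complex) = of_nat (card (fset S \<inter> range Theta))"
      using monomial by (auto simp: bideg_def tdeg_def)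
    then show ?case using number_operator_monomial[of Theta S n c] by (simp add: inj_def)
  }
qed (simp_all add: ext_deriv_add distrib_left sum.distrib ext_scale_add)

lemma tau_sigma:
  assumes "f \<in> ext_space (bideg n i j)"
  shows "tau n (sigma n f) = sigma n (tau n f) + ext_scale (of_int (i - j)) f"
proof -
  have "ext_scale (of_int i) f - ext_scale (of_int j) f = ext_scale (of_int (i - j)) f"
    using ext_scale_add_left[of "of_int i - of_int j" "of_int j" f] by simp
  moreover have "tau n (sigma n f) - sigma n (tau n f) =
      ext_scale (of_int i) f - ext_scale (of_int j) f"
    unfolding tau_sigma_commutator number_operator[OF assms] ..
  ultimately show ?thesis by (simp add: diff_eq_eq add.commute)
qed

lemma sigma_pow_mem:
  "f \<in> ext_space (bideg n i j) \<Longrightarrow> (sigma n ^^ k) f \<in> ext_space (bideg n (i - int k) (j + int k))"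
proof (induction k)
  case (Suc k)
  from sigma_mem[OF Suc.IH[OF Suc.prems]] show ?case by (simp add: algebra_simps)
qed simp

lemma tau_pow_mem:
  "f \<in> ext_space (bideg n i j) \<Longrightarrow> (tau n ^^ k) f \<in> ext_space (bideg n (i + int k) (j - int k))"
proof (induction k)
  case (Suc k)
  from tau_mem[OF Suc.IH[OF Suc.prems]] show ?case by (simp add: algebra_simps)
qed simp

lemma tau_pow_scale: "(tau n ^^ k) (ext_scale a f) = ext_scale a ((tau n ^^ k) f)"
  by (induction k) (simp_all add: tau_scale)

lemma tau_pow_diff: "(tau n ^^ k) (f - g) = (tau n ^^ k) f - (tau n ^^ k) g"
  by (induction k) (simp_all add: tau_diff)

lemma ext_space_negative:
  assumes "f \<in> ext_space (bideg n i j)" "i < 0 \<or> j < 0"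
  shows "f = 0"
  using assms(1)
  by (induction rule: ext_space_induct) (use assms(2) in \<open>auto simp: bideg_def adeg_def tdeg_def\<close>)

text \<open>The constant is the sum of the weights i - j, i - j - 2, ..., i - j - 2k that are picked
  up when \<open>tau\<close> passes the k + 1 factors \<open>sigma\<close>.\<close>

lemma tau_sigma_pow:
  assumes f: "f \<in> ext_space (bideg n i j)" and "tau n f = 0"
  shows "tau n ((sigma n ^^ Suc k) f) =
    ext_scale (of_int ((int k + 1) * (i - j - int k))) ((sigma n ^^ k) f)"
proof (induction k)
  case 0
  show ?case using tau_sigma[OF f] assms(2) by simp
next
  case (Suc k)
  have "tau n ((sigma n ^^ Suc (Suc k)) f) = sigma n (tau n ((sigma n ^^ Suc k) f)) +
      ext_scale (of_int ((i - int (Suc k)) - (j + int (Suc k)))) ((sigma n ^^ Suc k) f)"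
    using tau_sigma[OF sigma_pow_mem[OF f, of "Suc k"]] by simp
  also have "\<dots> = ext_scale (of_int ((int k + 1) * (i - j - int k)) +
      of_int ((i - int (Suc k)) - (j + int (Suc k)))) ((sigma n ^^ Suc k) f)"
    unfolding Suc.IH sigma_scale ext_scale_add_left by simp
  also have "of_int ((int k + 1) * (i - j - int k)) + of_int ((i - int (Suc k)) - (j + int (Suc k))) =
      (of_int ((int (Suc k) + 1) * (i - j - int (Suc k))) :: complex)"
    unfolding of_int_add[symmetric] by (rule arg_cong[where f = of_int]) (simp add: algebra_simps)
  finally show ?case .
qed

text \<open>For i < j every factor (k + 1)(i - j - k) is negative, so the vanishing of a power of
  \<open>sigma\<close> on f passes down to f itself.\<close>

lemma tau_injective:
  assumes f: "f \<in> ext_space (bideg n i j)" and "tau n f = 0" "i < j"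
  shows "f = 0"
proof -
  have "(sigma n ^^ k) f = 0 \<Longrightarrow> f = 0" for k
  proof (induction k)
    case (Suc k)
    have "ext_scale (of_int ((int k + 1) * (i - j - int k))) ((sigma n ^^ k) f) = 0"
      using tau_sigma_pow[OF f assms(2), of k] Suc.prems by simp
    from arg_cong[OF this, of "ext_scale (1 / of_int ((int k + 1) * (i - j - int k)))"]
    have "(sigma n ^^ k) f = 0" using assms(3) by (simp del: of_int_mult)
    then show ?case by (rule Suc.IH)
  qed simp
  \<comment> \<open>The power i + 1 leads to alpha-degree -1. For negative i the exponent
    \<open>nat (i + 1)\<close> is zero, and f already lies in a zero component.\<close>
  moreover have "(sigma n ^^ nat (i + 1)) f = 0"
    using ext_space_negative[OF sigma_pow_mem[OF f]] by simp
  ultimately show ?thesis by blast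
qed

text \<open>The scalar is the product of the factors (l + 1)(i - j - l) over l < k; the bound on k
  keeps each of them positive.\<close>

lemma tau_pow_sigma_pow:
  assumes f: "f \<in> ext_space (bideg n i j)" and "tau n f = 0" "i - j \<ge> int k"
  shows "\<exists>c. c \<noteq> 0 \<and> (tau n ^^ k) ((sigma n ^^ k) f) = ext_scale c f"
  using assms(3)
proof (induction k)
  case 0
  show ?case by (rule exI[of _ 1]) simp
next
  case (Suc k)
  then obtain c where c: "c \<noteq> 0" "(tau n ^^ k) ((sigma n ^^ k) f) = ext_scale c f" by auto
  let ?d = "of_int ((int k + 1) * (i - j - int k)) :: complex"
  have "(tau n ^^ Suc k) ((sigma n ^^ Suc k) f) = (tau n ^^ k) (tau n ((sigma n ^^ Suc k) f))"
    by (simp only: funpow_Suc_right o_apply)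
  also have "\<dots> = ext_scale (?d * c) f"
    unfolding tau_sigma_pow[OF f assms(2)] by (simp only: tau_pow_scale c(2) ext_scale_scale)
  finally have eq: "(tau n ^^ Suc k) ((sigma n ^^ Suc k) f) = ext_scale (?d * c) f" .
  have "(int k + 1) * (i - j - int k) \<noteq> 0" using Suc.prems by simp
  then have "?d * c \<noteq> 0" using c(1) by (simp only: of_int_eq_0_iff mult_eq_0_iff simp_thms)
  with eq show ?case by blast
qed

text \<open>Induction on a power of \<open>tau\<close> that kills f. A preimage is corrected by a
  term that removes the top image g of f under \<open>tau\<close>, after which a smaller power kills
  the remainder.\<close>

lemma tau_surjective:
  assumes "f \<in> ext_space (bideg n i j)" "i > j"
  shows "\<exists>h\<in>ext_space (bideg n (i - 1) (j + 1)). tau n h = f"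
proof -
  have "\<exists>h\<in>ext_space (bideg n (i - 1) (j + 1)). tau n h = f"
    if "f \<in> ext_space (bideg n i j)" "(tau n ^^ k) f = 0" for k f
    using that
  proof (induction k arbitrary: f)
    case 0
    then show ?case by (intro bexI[of _ 0]) (simp_all add: ext_space_0)
  next
    case (Suc k)
    let ?g = "(tau n ^^ k) f"
    have g: "?g \<in> ext_space (bideg n (i + int k) (j - int k))" "tau n ?g = 0"
      using tau_pow_mem[OF Suc.prems(1)] Suc.prems(2) by simp_all
    \<comment> \<open>The vector g has weight i - j + 2k, which is at least k + 1 as i > j. The
      power k + 1 of \<open>sigma\<close> takes g to bidegree (i - 1, j + 1), exactly where a
      preimage of f must lie.\<close>
    obtain c where c: "c \<noteq> 0" "(tau n ^^ Suc k) ((sigma n ^^ Suc k) ?g) = ext_scale c ?g"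
      using tau_pow_sigma_pow[OF g, of "Suc k"] assms(2) by auto
    let ?h = "ext_scale (1 / c) ((sigma n ^^ Suc k) ?g)"
    have h: "?h \<in> ext_space (bideg n (i - 1) (j + 1))"
      using ext_space_scale[OF sigma_pow_mem[OF g(1), of "Suc k"]] by (simp add: algebra_simps)
    have "(tau n ^^ k) (tau n ?h) = (tau n ^^ Suc k) ?h"
      by (simp only: funpow_Suc_right o_apply)
    also have "\<dots> = ?g" using c(1) by (simp only: tau_pow_scale c(2) ext_scale_scale) simp
    finally have "(tau n ^^ k) (f - tau n ?h) = 0" by (simp only: tau_pow_diff diff_self)
    moreover have "f - tau n ?h \<in> ext_space (bideg n i j)"
      using ext_space_diff[OF Suc.prems(1)] tau_mem[OF h] by simp
    ultimately obtain h' where h': "h' \<in> ext_space (bideg n (i - 1) (j + 1))"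
      "tau n h' = f - tau n ?h" using Suc.IH by blast
    then show ?case
      using ext_space_add[OF h' (1) h] by (intro bexI[of _ "h' + ?h"]) (simp_all add: tau_add)
  qed
  \<comment> \<open>The theta-degree has become negative; for negative j this holds already at the
    power zero.\<close>
  moreover have "(tau n ^^ nat (j + 1)) f = 0"
    using ext_space_negative[OF tau_pow_mem[OF assms(1)]] by simp
  ultimately show ?thesis using assms(1) by blast
qed

lemma map_gen_inj: "w permutes A \<Longrightarrow> inj (map_gen w)"
  by (rule gen.inj_map) (rule permutes_inj)

text \<open>The permutation w carries the i-th summand to the summand with index w i, so it only
  reorders the sum.\<close>

lemma tau_equivariant:
  assumes w: "w permutes {1..n}"
  shows "tau n (ext_map (map_gen w) f) = ext_map (map_gen w) (tau n f)"
proof -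
  let ?h = "\<lambda>i. ext_gen (Alpha i) * ext_deriv (Theta i) (ext_map (map_gen w) f)"
  have "?h (w i) = ext_map (map_gen w) (ext_gen (Alpha i) * ext_deriv (Theta i) f)" for i
    using ext_deriv_map[OF map_gen_inj[OF w], of "Theta i" f]
      ext_map_gen_mult[of "map_gen w" "Alpha i"] by simp
  then show ?thesis
    unfolding tau_def ext_map_sum using sum.permute[OF w, of ?h] by (simp add: o_def)
qed

lemma finite_fsets:
  assumes "finite A"
  shows "finite {S. fset S \<subseteq> A \<and> Q S}"
proof (rule finite_imageD)
  show "finite (fset ` {S. fset S \<subseteq> A \<and> Q S})"
    by (rule finite_subset[of _ "Pow A"]) (use assms in auto)
  show "inj_on fset {S. fset S \<subseteq> A \<and> Q S}" by (simp add: inj_on_def fset_inject)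
qed

lemma deg_map_gen:
  assumes "inj w"
  shows "adeg (map_gen w |`| S) = adeg S" "tdeg (map_gen w |`| S) = tdeg S"
proof -
  note inj = gen.inj_map[OF assms]
  have Alpha: "map_gen w x \<in> range Alpha \<longleftrightarrow> x \<in> range Alpha"
    and Theta: "map_gen w x \<in> range Theta \<longleftrightarrow> x \<in> range Theta" for x
    by (cases x; auto)+
  have image_Int: "f ` A \<inter> D = f ` (A \<inter> {x. f x \<in> D})" for f :: "'a \<Rightarrow> 'b" and A D
    by auto
  have "fset (map_gen w |`| S) \<inter> range Alpha = map_gen w ` (fset S \<inter> range Alpha)"
    "fset (map_gen w |`| S) \<inter> range Theta = map_gen w ` (fset S \<inter> range Theta)"
    unfolding fimage.rep_eq image_Int Alpha Theta Collect_mem_eq by (rule refl)+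
  then show "adeg (map_gen w |`| S) = adeg S" "tdeg (map_gen w |`| S) = tdeg S"
    using card_image[OF inj_on_subset[OF inj subset_UNIV]] by (simp_all only: adeg_def tdeg_def)
qed

lemma bideg_map_gen:
  assumes w: "w permutes {1..n}" and S: "bideg n i j S"
  shows "bideg n i j (map_gen w |`| S)"
proof -
  let ?X = "Alpha ` {1..n} \<union> Theta ` {1..n}"
  have "map_gen w ` fset S \<subseteq> map_gen w ` ?X" using S by (intro image_mono) (simp add: bideg_def)
  also have "\<dots> \<subseteq> ?X" using permutes_in_image[OF w] by auto
  finally show ?thesis using S by (simp add: bideg_def deg_map_gen[OF permutes_inj[OF w]])
qed

lemma finite_bideg: "finite {S. bideg n i j S}"
  unfolding bideg_def by (rule finite_fsets) simp

lemma E_fd_rep: "fd_rep (sym_group n) (E n i j)"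
  unfolding E_eq
proof (rule ext_rep_fd[OF sym_group_is_group])
  show "finite {S. bideg n i j S}" by (rule finite_bideg)
  show "inj_on (map_gen w) (fset S) \<and> bideg n i j (map_gen w |`| S)"
    if "w \<in> carrier (sym_group n)" "bideg n i j S" for w S
    using that bideg_map_gen[of w n i j S] inj_on_subset[OF map_gen_inj[of w "{1..n}"] subset_UNIV]
    by (simp add: sym_group_carrier)
  show "map_gen \<one>\<^bsub>sym_group n\<^esub> = (\<lambda>x. x)"
    by (simp add: sym_group_one gen.map_id0 id_def[symmetric])
  show "map_gen (v \<otimes>\<^bsub>sym_group n\<^esub> w) = (\<lambda>x. map_gen v (map_gen w x))" for v w
    by (rule ext) (simp add: sym_group_mult gen.map_comp)
qed

lemma ext_power_fd_rep: "fd_rep (sym_group n) (ext_power n k)"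
  unfolding ext_power_def
proof (rule ext_rep_fd[OF sym_group_is_group])
  show "finite {S. fset S \<subseteq> {1..n} \<and> int (fcard S) = k}" by (rule finite_fsets) simp
  show "inj_on w (fset S) \<and> fset (w |`| S) \<subseteq> {1..n} \<and> int (fcard (w |`| S)) = k"
    if "w \<in> carrier (sym_group n)" "fset S \<subseteq> {1..n} \<and> int (fcard S) = k" for w S
  proof -
    have w: "w permutes {1..n}" using that(1) by (simp add: sym_group_carrier)
    then have inj: "inj_on w (fset S)" using permutes_inj inj_on_subset subset_UNIV by metis
    then have "fcard (w |`| S) = fcard S" by (simp add: fcard.rep_eq card_image)
    with inj that(2) permutes_in_image[OF w] show ?thesis by auto
  qed
qed (simp_all add: sym_group_one sym_group_mult id_def o_def)

lemma tau_rep_hom: "tau n \<in> rep_hom (sym_group n) (E n (i - 1) (j + 1)) (E n i j)"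
proof -
  have "tau n f \<in> ext_space (bideg n i j)" if "f \<in> ext_space (bideg n (i - 1) (j + 1))" for f
    using tau_mem[OF that] by simp
  then show ?thesis
    by (auto simp: rep_hom_def E_eq tau_add tau_scale tau_equivariant sym_group_carrier)
qed

section \<open>Exterior powers and their product\<close>

definition alpha_part :: "nat gen fset \<Rightarrow> nat fset" where
  "alpha_part S = Abs_fset (Alpha -` fset S)"

definition theta_part :: "nat gen fset \<Rightarrow> nat fset" where
  "theta_part S = Abs_fset (Theta -` fset S)"

definition gen_join :: "nat fset \<Rightarrow> nat fset \<Rightarrow> nat gen fset" where
  "gen_join A B = Alpha |`| A |\<union>| Theta |`| B"

lemma fset_parts:
  "fset (alpha_part S) = Alpha -` fset S" "fset (theta_part S) = Theta -` fset S"
  unfolding alpha_part_def theta_part_def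
  by (rule Abs_fset_inverse, simp add: finite_vimageI inj_def)+

lemma fset_join: "fset (gen_join A B) = Alpha ` fset A \<union> Theta ` fset B"
  by (simp add: gen_join_def)

lemma parts_join [simp]: "alpha_part (gen_join A B) = A" "theta_part (gen_join A B) = B"
  by (auto simp: fset_inject[symmetric] fset_parts fset_join)

lemma join_parts [simp]: "gen_join (alpha_part S) (theta_part S) = S"
proof -
  have "x \<in> Alpha ` (Alpha -` fset S) \<union> Theta ` (Theta -` fset S) \<longleftrightarrow> x \<in> fset S" for x
    by (cases x) auto
  then show ?thesis unfolding fset_inject[symmetric] fset_join fset_parts by blast
qed

definition ext_deg :: "nat \<Rightarrow> int \<Rightarrow> nat fset \<Rightarrow> bool" where
  "ext_deg n k S \<longleftrightarrow> fset S \<subseteq> {1..n} \<and> int (fcard S) = k"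

lemma ext_power_eq: "ext_power n k = ext_rep (ext_deg n k) (\<lambda>w. w)"
  by (simp add: ext_power_def ext_deg_def[abs_def])

lemma finite_ext_deg: "finite {S. ext_deg n k S}"
  unfolding ext_deg_def by (rule finite_fsets) simp

lemma bideg_join: "bideg n i j (gen_join A B) \<longleftrightarrow> ext_deg n i A \<and> ext_deg n j B"
proof -
  have "fset (gen_join A B) \<inter> range Alpha = Alpha ` fset A"
    "fset (gen_join A B) \<inter> range Theta = Theta ` fset B"
    by (auto simp: fset_join)
  then have "adeg (gen_join A B) = int (fcard A)" "tdeg (gen_join A B) = int (fcard B)"
    by (simp_all add: adeg_def tdeg_def fcard.rep_eq card_image inj_on_def)
  moreover have "fset (gen_join A B) \<subseteq> Alpha ` {1..n} \<union> Theta ` {1..n} \<longleftrightarrow>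
      fset A \<subseteq> {1..n} \<and> fset B \<subseteq> {1..n}"
    by (auto simp: fset_join)
  ultimately show ?thesis by (auto simp: bideg_def ext_deg_def)
qed

text \<open>Every \<open>Alpha\<close> precedes every \<open>Theta\<close> and both constructors are
  increasing, so the product is already sorted and has no sign.\<close>

lemma mult_join:
  "ext_map Alpha (ext_monomial A a) * ext_map Theta (ext_monomial B b) =
     ext_monomial (gen_join A B) (a * b)"
proof -
  have "ext_map Alpha (ext_monomial A a) = ext_monomial (Alpha |`| A) a"
    "ext_map Theta (ext_monomial B b) = ext_monomial (Theta |`| B) b"
    by (rule ext_map_monomial_mono, simp add: less_gen_def)+
  then show ?thesis
    by (simp add: gen_join_def) (rule monomial_mult_ordered, auto simp: less_gen_def)
qed

lemma mult_mem:
  assumes "f \<in> ext_space (ext_deg n i)" "g \<in> ext_space (ext_deg n j)"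
  shows "ext_map Alpha f * ext_map Theta g \<in> ext_space (bideg n i j)"
proof (rule ext_space_mult)
  show "ext_map Alpha f \<in> ext_space (\<lambda>S. \<exists>A. S = Alpha |`| A \<and> ext_deg n i A)"
    by (rule ext_space_map[OF assms(1)]) (auto simp: inj_on_def)
  show "ext_map Theta g \<in> ext_space (\<lambda>S. \<exists>A. S = Theta |`| A \<and> ext_deg n j A)"
    by (rule ext_space_map[OF assms(2)]) (auto simp: inj_on_def)
qed (auto simp: bideg_join gen_join_def[symmetric])

text \<open>The isomorphism is multiplication; its inverse sends the monomial on \<open>S\<close> to the tensor of the
  monomials on the two parts of \<open>S\<close>.\<close>

lemma tensor_ext_power_iso:
  "rep_iso (sym_group n) (tensor_rep (ext_power n i) (ext_power n j)) (E n i j)"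
proof -
  let ?V = "ext_power n i" and ?W = "ext_power n j"
  note V = ext_power_fd_rep[of n i] and W = ext_power_fd_rep[of n j] and EE = E_fd_rep[of n i j]
  interpret tensor "sym_group n" ?V ?W by (simp add: tensor_def fd_repD(1)[OF V] fd_repD(1)[OF W])
  have cV: "carrier ?V = ext_space (ext_deg n i)" and cW: "carrier ?W = ext_space (ext_deg n j)"
    and cE: "carrier (E n i j) = ext_space (bideg n i j)"
    by (simp_all add: ext_power_eq E_eq)
  have "\<exists>h\<in>linmap T (E n i j). \<forall>v\<in>carrier ?V. \<forall>w\<in>carrier ?W.
      h (pure ?V ?W v w) = ext_map Alpha v * ext_map Theta w"
    by (rule tensor_lift[OF fd_repD(2)[OF EE]])
      (simp_all add: ext_power_eq E_eq mult_mem ext_map_add ext_map_scale ring_distribs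
        ext_scale_mult_left ext_scale_mult_right)
  then obtain h where h: "h \<in> linmap T (E n i j)"
    "\<And>v w. \<lbrakk>v \<in> carrier ?V; w \<in> carrier ?W\<rbrakk> \<Longrightarrow>
      h (pure ?V ?W v w) = ext_map Alpha v * ext_map Theta w"
    by blast
  have hom: "h \<in> rep_hom (sym_group n) T (E n i j)"
  proof (rule tensor_rep_homI[OF fd_repD(1)[OF EE] h(1)])
    fix p v w assume p: "p \<in> carrier (sym_group n)" "v \<in> carrier ?V" "w \<in> carrier ?W"
    have "h (pure ?V ?W (act ?V p v) (act ?W p w)) =
        ext_map Alpha (act ?V p v) * ext_map Theta (act ?W p w)"
      by (rule h(2)[OF V.act_cl[OF p(1,2)] W.act_cl[OF p(1,3)]])
    also have "\<dots> = act (E n i j) p (ext_map Alpha v * ext_map Theta w)"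
      by (simp add: ext_power_eq E_eq ext_map_mult ext_map_comp)
    finally show "h (pure ?V ?W (act ?V p v) (act ?W p w)) = act (E n i j) p (h (pure ?V ?W v w))"
      by (simp only: h(2)[OF p(2,3)])
  qed
  define b where
    "b S = pure ?V ?W (ext_monomial (alpha_part S) 1) (ext_monomial (theta_part S) 1)" for S
  have parts: "ext_monomial (alpha_part S) c \<in> carrier ?V"
    "ext_monomial (theta_part S) c \<in> carrier ?W"
    if "bideg n i j S" for S c
    using that bideg_join[of n i j "alpha_part S" "theta_part S"]
    by (simp_all add: cV cW ext_space_monomial)
  have b: "b S \<in> carrier T" if "bideg n i j S" for S
    unfolding b_def by (rule pure_closed[OF parts[OF that]])
  \<comment> \<open>Outside bidegree (i, j) the values of b need not lie in the tensor product, so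
    closure and linearity are claimed only for f whose monomials all have this bidegree.\<close>
  define k where "k f = T.lin_ext b (ext_coeffs f)" for f
  have keys: "b S \<in> carrier T"
    if "f \<in> ext_space (bideg n i j)" "S \<in> Poly_Mapping.keys (ext_coeffs f)" for f S
    using that by (intro b) (simp add: ext_space_def)
  have k: "k \<in> linmap (E n i j) T"
    unfolding k_def
    by (rule linmapI)
      (auto simp: E_eq plus_ext.rep_eq ext_scale.rep_eq simp del: quot_rep_simps
        intro!: T.lin_ext_closed T.lin_ext_add T.lin_ext_scale dest: keys)
  have km: "k (ext_monomial S c) = c \<odot>\<^bsub>T\<^esub> b S" if "bideg n i j S" for S c
    unfolding k_def ext_monomial.rep_eq
    by (rule T.lin_ext_single[where b = b and k = S, OF b[OF that]])
  have k_join: "k (ext_monomial (gen_join A B) 1) = pure ?V ?W (ext_monomial A 1) (ext_monomial B 1)"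
    if "ext_deg n i A" "ext_deg n j B" for A B
    using km[of "gen_join A B" 1] b[of "gen_join A B"] that
    by (simp add: bideg_join T.smult_1) (simp add: b_def)
  have h_pure: "h (pure ?V ?W (ext_monomial A 1) (ext_monomial B 1)) = ext_monomial (gen_join A B) 1"
    if "ext_deg n i A" "ext_deg n j B" for A B
    using h(2)[of "ext_monomial A 1" "ext_monomial B 1"] that
    by (simp add: cV cW ext_space_monomial mult_join)
  \<comment> \<open>Both composites are compared with the identity on spanning sets only: products
    of basis monomials here, monomials of bidegree (i, j) below.\<close>
  have "carrier T \<subseteq> {x \<in> carrier T. (k \<circ> h) x = x}"
  proof (rule genD[OF gen_tensor T.csub_equalizer[OF T.complex_space_axioms
          linmap_comp[OF h(1) k] linmap_id]])
    show "generates ?V ((\<lambda>S. ext_monomial S 1) ` {S. ext_deg n i S})"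
      "generates ?W ((\<lambda>S. ext_monomial S 1) ` {S. ext_deg n j S})"
      unfolding ext_power_eq by (rule ext_rep_gen[OF finite_ext_deg])+
    show "case_prod (pure ?V ?W) ` ((\<lambda>S. ext_monomial S 1) ` {S. ext_deg n i S} \<times>
        (\<lambda>S. ext_monomial S 1) ` {S. ext_deg n j S}) \<subseteq> {x \<in> carrier T. (k \<circ> h) x = x}"
      by (auto simp: h_pure k_join cV cW ext_space_monomial simp del: quot_rep_simps
          intro!: pure_closed)
  qed
  then have kh: "k (h x) = x" if "x \<in> carrier T" for x using that by auto
  interpret EE: complex_space "E n i j" by (rule fd_repD(2)[OF EE])
  have "carrier (E n i j) \<subseteq> {f \<in> carrier (E n i j). (h \<circ> k) f = f}"
  proof (rule genD[OF _ EE.csub_equalizer[OF EE.complex_space_axioms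
          linmap_comp[OF k h(1)] linmap_id]])
    show "generates (E n i j) ((\<lambda>S. ext_monomial S 1) ` {S. bideg n i j S})"
      unfolding E_eq by (rule ext_rep_gen[OF finite_bideg])
    have "h (k (ext_monomial S 1)) = ext_monomial S 1" if "bideg n i j S" for S
      using that bideg_join[of n i j "alpha_part S" "theta_part S"]
        k_join[of "alpha_part S" "theta_part S"] h_pure[of "alpha_part S" "theta_part S"] by simp
    then show "(\<lambda>S. ext_monomial S 1) ` {S. bideg n i j S} \<subseteq> {f \<in> carrier (E n i j). (h \<circ> k) f = f}"
      by (auto simp: cE ext_space_monomial)
  qed
  then have hk: "h (k f) = f" if "f \<in> carrier (E n i j)" for f using that by auto
  show ?thesis by (rule rep_isoI[OF hom k kh hk])
qed

lemma rep_class_E: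
  "rep_class (sym_group n) (E n i j) =
     rep_class (sym_group n) (ext_power n i) \<otimes>\<^bsub>groth_ring (sym_group n)\<^esub>
     rep_class (sym_group n) (ext_power n j)"
  using groth_mult_rep_class[OF ext_power_fd_rep[of n i] ext_power_fd_rep[of n j]]
    rep_class_iso[OF fd_rep_tensor[OF ext_power_fd_rep ext_power_fd_rep] E_fd_rep
      tensor_ext_power_iso[of n i j]]
  by (simp add: groth_ring_def)

section \<open>The cohomology quotient\<close>

lemma tau_image_rep_sub:
  "rep_sub (sym_group n) (E n i j) (tau n ` carrier (E n (i - 1) (j + 1)))"
  by (rule rep_sub_image[OF fd_repD(1)[OF E_fd_rep] fd_repD(1)[OF E_fd_rep] tau_rep_hom
        rep_sub_carrier[OF fd_repD(1)[OF E_fd_rep]]])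

lemmas H1_proj = quot_rep_proj[OF fd_repD(1)[OF E_fd_rep] tau_image_rep_sub, folded H1_def]

text \<open>The source of \<open>tau\<close> has weight i - j - 2, which is negative for i \<le> j,
  so \<open>tau\<close> is injective there and its image is the kernel of the projection.\<close>

lemma H1_short_exact:
  assumes "i \<le> j"
  shows "short_exact (sym_group n) (E n (i - 1) (j + 1)) (E n i j) (H1 n i j)"
proof -
  let ?U = "E n (i - 1) (j + 1)" and ?V = "E n i j"
  note U = E_fd_rep[of n "i - 1" "j + 1"] and V = E_fd_rep[of n i j]
  let ?N = "tau n ` carrier ?U"
  note p = H1_proj[where n = n and i = i and j = j]
  have "f = \<zero>\<^bsub>?U\<^esub>" if "f \<in> carrier ?U" "tau n f = \<zero>\<^bsub>?V\<^esub>" for f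
    using tau_injective[of f n "i - 1" "j + 1"] that assms by (simp add: E_eq)
  then have inj: "inj_on (tau n) (carrier ?U)"
    by (intro iffD2[OF inj_on_iff_kernel[OF fd_repD(2)[OF U] fd_repD(2)[OF V]
            rep_hom_linmap[OF tau_rep_hom]]]) blast
  have "?N \<subseteq> carrier ?V"
    using tau_image_rep_sub[of n i j] csubD(1)[of ?V ?N] unfolding rep_sub_def by blast
  then have "?N = {v \<in> carrier ?V. ?N +>\<^bsub>?V\<^esub> v = \<zero>\<^bsub>H1 n i j\<^esub>}" using p(4) by blast
  then show ?thesis
    by (rule short_exactI[OF U V fd_rep_image[OF V p(1-3)] tau_rep_hom p(1) inj _ p(2)])
qed

text \<open>The target of \<open>tau\<close> has positive weight i - j, so \<open>tau\<close> is
  onto and only the zero coset remains.\<close>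

lemma H1_zero:
  assumes "\<not> i \<le> j"
  shows "carrier (H1 n i j) = {\<zero>\<^bsub>H1 n i j\<^esub>}"
proof -
  let ?U = "E n (i - 1) (j + 1)" and ?V = "E n i j"
  note p = H1_proj[where n = n and i = i and j = j]
  have "carrier ?V \<subseteq> tau n ` carrier ?U"
    using tau_surjective[of _ n i j] assms by (fastforce simp: E_eq)
  then have "carrier (H1 n i j) \<subseteq> {\<zero>\<^bsub>H1 n i j\<^esub>}" unfolding p(2)[symmetric] using p(4) by blast
  moreover have "\<zero>\<^bsub>H1 n i j\<^esub> \<in> carrier (H1 n i j)"
    by (rule complex_space.zero_cl) (use p(5) in \<open>simp add: lin_rep_def\<close>)
  ultimately show ?thesis by blast
qed

theorem theorem3p7:
  fixes n :: nat and i j :: int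
  assumes "n \<ge> 1"
  shows "(\<not> i \<le> j \<longrightarrow> carrier (H1 n i j) = {\<zero>\<^bsub>H1 n i j\<^esub>}) \<and>
    (i \<le> j \<longrightarrow>
       (let S = sym_group n; K = groth_ring S in
          rep_class S (H1 n i j) =
            (rep_class S (ext_power n i) \<otimes>\<^bsub>K\<^esub> rep_class S (ext_power n j))
              \<ominus>\<^bsub>K\<^esub> (rep_class S (ext_power n (i - 1)) \<otimes>\<^bsub>K\<^esub> rep_class S (ext_power n (j + 1))) \<and>
          rep_class S (H1 n i j) =
            rep_class S (E n i j) \<ominus>\<^bsub>K\<^esub> rep_class S (E n (i - 1) (j + 1))))"
proof (intro conjI impI)
  show "carrier (H1 n i j) = {\<zero>\<^bsub>H1 n i j\<^esub>}" if "\<not> i \<le> j"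
    using that by (rule H1_zero)
  assume "i \<le> j"
  from rep_class_exact[OF H1_short_exact[OF this, of n]] have "rep_class (sym_group n) (H1 n i j) =
      rep_class (sym_group n) (E n i j) - rep_class (sym_group n) (E n (i - 1) (j + 1))"
    by (simp only: add_diff_cancel_left')
  \<comment> \<open>Read from right to left, \<open>rep_class_E\<close> turns each product into the
    class of a bigraded component, so both equations reduce to the difference just obtained.\<close>
  then show "let S = sym_group n; K = groth_ring S in
      rep_class S (H1 n i j) =
        (rep_class S (ext_power n i) \<otimes>\<^bsub>K\<^esub> rep_class S (ext_power n j))
          \<ominus>\<^bsub>K\<^esub> (rep_class S (ext_power n (i - 1)) \<otimes>\<^bsub>K\<^esub> rep_class S (ext_power n (j + 1))) \<and>
      rep_class S (H1 n i j) = rep_class S (E n i j) \<ominus>\<^bsub>K\<^esub> rep_class S (E n (i - 1) (j + 1))"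
    by (simp add: Let_def rep_class_E[symmetric] groth_ring_minus
        rep_class_in_groth_ring[OF E_fd_rep])
qed

end
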